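(* Let $W_0=1$ and, for $m\ge 1$, let $$W_m=\frac1{m!}\sum_{\alpha\in\mathbb S_m} w_{\mathfrak{gl}}(\alpha)\in\mathbb C[N;C_1,C_2,\dots]$$ be the average value of the universal $\mathfrak{gl}$-weight system over all permutations of $m$ elements, rewritten via the Schur substitution as a polynomial in $N$ and $S_1,S_2,\dots$. Put $\nu=N-1$ and $S_0=1$. Then $$\sum_{m=0}^{\infty}\frac{W_m}{(m+\nu)!}\,t^{m}=\left(\frac{e^{t/2}-e^{-t/2}}{t}\right)^{-\nu}\sum_{k=0}^{\infty}\frac{S_k}{(k+\nu)!}\,t^k .$$ In particular, each $W_m$ is a linear combination of the one-part Schur functions $S_0=1,S_1,S_2,\dots$ (with coefficients polynomial in $N$).
   Context: **$\mathfrak{gl}(N)$-weight system.** Let $E_{ij}$, $1\le i,j\le N$, be the standard generators of $U(\mathfrak{gl}(N))$ over $\mathbb C$, $[E_{ij},E_{kl}]=\delta_{jk}E_{il}-\delta_{il}E_{kj}$, and let $E=(E_{ij})$ be the matrix of generators. For $\alpha\in\mathbb S_m$ set $$w_{\mathfrak{gl}(N)}(\alpha)=\mathrm{Tr}(E_1\cdots E_mP_{\alpha^{-1}})=\sum_{i_1,\dots,i_m=1}^N E_{i_1i_{\alpha(1)}}E_{i_2i_{\alpha(2)}}\cdots E_{i_mi_{\alpha(m)}},$$ where $E_k$ is $E$ acting in the $k$-th tensor factor of $(\mathbb C^N)^{\otimes m}$, $P_\alpha(v_1\otimes\dots\otimes v_m)=v_{\alpha^{-1}(1)}\otimes\dots\otimes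 v_{\alpha^{-1}(m)}$, and the trace is over all $m$ tensor factors. This is an element of the center of $U(\mathfrak{gl}(N))$. The Casimir elements are $C_{m,N}=\mathrm{Tr}(E^m)=\sum E_{i_1i_2}E_{i_2i_3}\cdots E_{i_mi_1}$. **Universal $\mathfrak{gl}$-weight system.** It is known that for every $\alpha\in\mathbb S_m$ there is a unique polynomial $w_{\mathfrak{gl}}(\alpha)\in\mathbb C[N;C_1,C_2,\dots]$ ($N$, $C_i$ formal variables) such that for every specific positive integer $N$ the substitution $C_i=C_{i,N}$ turns it into $w_{\mathfrak{gl}(N)}(\alpha)$. **Schur substitution.** With $N$ a formal variable, $S_0=1$, and $S_1,S_2,\dots$ formal variables, the $C_m$ are expressed through the $S_i$ by $$1-Nv-\sum_{m\ge1}C_mv^{m+1}=\left(\frac{1-\frac{N+1}2v}{1-\frac{N-1}2v}\right)^N\cdot\frac{\sum_{i\ge0}v^i\left(1-\frac{N-1}2v\right)^{-i}S_i}{\sum_{i\ge0}v^i\left(1-\frac{N+1}2v\right)^{-i}S_i}.$$ (For a specific $N$, under the Harish-Chandra isomorphism given by $1-Nv-\sum_{m\ge1} C_mv^{m+1}=\prod_{i=1}^N\frac{1-(x_i+\frac{N+1}2)v}{1-(x_i+\frac{N-1}2)v}$, the $S_i$ become the complete homogeneous symmetric polynomials $S_i(x_1,\dots,x_N)$.) **Meaning of the factorials.** Since $N$ is formal, the identity is understood coefficientwise in $t$ after multiplying the coefficient of $t^m$ by $(m+\nu)!$, with $(m+\nu)!/(k+\nu)!$ read as the falling factorial $(m+\nu)_{m-k}=(m+\nu)(m+\nu-1)\cdots(k+\nu+1)$.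 The coefficients of the expansion of $\left(\frac{e^{t/2}-e^{-t/2}}t\right)^{-\nu}$ in $t$ are polynomials in $\nu$. *)

theory Defs
  imports
    Complex_Main
    "HOL-Library.Poly_Mapping"
    "HOL-Library.FuncSet"
    "HOL-Combinatorics.Permutations"
    "HOL-Computational_Algebra.Polynomial"
    "HOL-Computational_Algebra.Formal_Power_Series"
    "HOL-Algebra.QuotRing"
begin

text \<open>The free monoid is a type of its own, so that no class instance has to be put on lists.\<close>

datatype 'a fmon = Word (letters: "'a list")

instantiation fmon :: (type) monoid_add
begin

definition zero_fmon :: "'a fmon" where
  "0 = Word []"

definition plus_fmon :: "'a fmon \<Rightarrow> 'a fmon \<Rightarrow> 'a fmon" where
  "u + v = Word (letters u @ letters v)"

instance
  by standard (simp_all add: zero_fmon_def plus_fmon_def)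

end

text \<open>
  Finitely supported functions on the free monoid, with the convolution product of
  \<^theory>\<open>HOL-Library.Poly_Mapping\<close>, are noncommutative polynomials over the complex numbers.
\<close>

type_synonym 'a ncpoly = "'a fmon \<Rightarrow>\<^sub>0 complex"

definition nc_const :: "complex \<Rightarrow> 'a ncpoly" where
  "nc_const c = Poly_Mapping.single 0 c"

definition nc_gen :: "'a \<Rightarrow> 'a ncpoly" where
  "nc_gen a = Poly_Mapping.single (Word [a]) 1"

definition free_alg :: "'a set \<Rightarrow> 'a ncpoly ring" where
  "free_alg A = \<lparr>carrier = {p. \<forall>w\<in>Poly_Mapping.keys p. set (letters w) \<subseteq> A},
     monoid.mult = (*), one = 1, ring.zero = 0, add = (+)\<rparr>"

definition gl_gens :: "nat \<Rightarrow> (nat \<times> nat) set" where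
  "gl_gens N = {1..N} \<times> {1..N}"

definition gl_rels :: "nat \<Rightarrow> (nat \<times> nat) ncpoly set" where
  "gl_rels N =
     {nc_gen (i, j) * nc_gen (k, l) - nc_gen (k, l) * nc_gen (i, j)
        - ((if j = k then nc_gen (i, l) else 0) - (if i = l then nc_gen (k, j) else 0))
      | i j k l. i \<in> {1..N} \<and> j \<in> {1..N} \<and> k \<in> {1..N} \<and> l \<in> {1..N}}"

definition gl_ideal :: "nat \<Rightarrow> (nat \<times> nat) ncpoly set" where
  "gl_ideal N = Idl\<^bsub>free_alg (gl_gens N)\<^esub> (gl_rels N)"

definition U_gl :: "nat \<Rightarrow> (nat \<times> nat) ncpoly set ring" where
  "U_gl N = free_alg (gl_gens N) Quot gl_ideal N"

definition U_class :: "nat \<Rightarrow> (nat \<times> nat) ncpoly \<Rightarrow> (nat \<times> nat) ncpoly set" where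
  "U_class N p = gl_ideal N +>\<^bsub>free_alg (gl_gens N)\<^esub> p"

definition U_scalar :: "nat \<Rightarrow> complex \<Rightarrow> (nat \<times> nat) ncpoly set" where
  "U_scalar N c = U_class N (nc_const c)"

definition gl_E :: "nat \<Rightarrow> nat \<Rightarrow> nat \<Rightarrow> (nat \<times> nat) ncpoly set" where
  "gl_E N i j = U_class N (nc_gen (i, j))"

lemma free_alg_simps [simp]:
  "monoid.mult (free_alg A) = (*)" "one (free_alg A) = 1"
  "ring.zero (free_alg A) = 0" "add (free_alg A) = (+)"
  by (simp_all add: free_alg_def)

lemma ring_free_alg: "ring (free_alg A)"
proof -
  have mem: "p \<in> carrier (free_alg A)
      \<longleftrightarrow> (\<forall>w\<in>Poly_Mapping.keys p. set (letters w) \<subseteq> A)" for p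
    by (simp add: free_alg_def)
  have neg: "- p \<in> carrier (free_alg A)" if "p \<in> carrier (free_alg A)" for p
    using that by (simp add: mem)
  have plus: "p + q \<in> carrier (free_alg A)"
    if "p \<in> carrier (free_alg A)" "q \<in> carrier (free_alg A)" for p q
    using that Poly_Mapping.keys_add[of p q] by (auto simp: mem)
  have times: "p * q \<in> carrier (free_alg A)"
    if "p \<in> carrier (free_alg A)" "q \<in> carrier (free_alg A)" for p q
    using that keys_mult[of p q] by (fastforce simp: mem plus_fmon_def)
  have zero: "0 \<in> carrier (free_alg A)" and one: "1 \<in> carrier (free_alg A)"
    by (auto simp: mem zero_fmon_def)
  show ?thesis
    by (rule ringI, rule abelian_groupI, unfold free_alg_simps)
      (auto simp: plus times zero one algebra_simps intro!: monoidI
         intro: bexI[of _ "- _", OF _ neg])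
qed

lemma ideal_gl_ideal: "ideal (gl_ideal N) (free_alg (gl_gens N))"
proof -
  interpret ring "free_alg (gl_gens N)"
    by (rule ring_free_alg)
  have gen: "nc_gen (i, j) \<in> carrier (free_alg (gl_gens N))"
    if "i \<in> {1..N}" "j \<in> {1..N}" for i j
    using that by (auto simp: free_alg_def nc_gen_def gl_gens_def)
  have minus: "x - y \<in> carrier (free_alg (gl_gens N))"
    if "x \<in> carrier (free_alg (gl_gens N))" "y \<in> carrier (free_alg (gl_gens N))" for x y
    using that Poly_Mapping.keys_diff[of x y] by (auto simp: free_alg_def)
  have times: "x * y \<in> carrier (free_alg (gl_gens N))"
    if "x \<in> carrier (free_alg (gl_gens N))" "y \<in> carrier (free_alg (gl_gens N))" for x y
    using m_closed[OF that] by simp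
  have zero: "0 \<in> carrier (free_alg (gl_gens N))"
    using zero_closed by simp
  have "gl_rels N \<subseteq> carrier (free_alg (gl_gens N))"
    unfolding gl_rels_def by (clarify, intro minus times) (simp_all add: gen zero)
  then show ?thesis
    unfolding gl_ideal_def by (rule genideal_ideal)
qed

lemma ring_U_gl: "ring (U_gl N)"
  unfolding U_gl_def by (rule ideal.quotient_is_ring[OF ideal_gl_ideal])

definition list_mult :: "('a, 'b) ring_scheme \<Rightarrow> 'a list \<Rightarrow> 'a" where
  "list_mult R xs = foldr (monoid.mult R) xs (one R)"

text \<open>The number \<open>m\<close> of permuted elements is an argument, since it is not determined
  by the function \<open>\<alpha>\<close>.\<close>

definition w_glN :: "nat \<Rightarrow> nat \<Rightarrow> (nat \<Rightarrow> nat) \<Rightarrow> (nat \<times> nat) ncpoly set" where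
  "w_glN N m \<alpha> =
     finsum (U_gl N) (\<lambda>i. list_mult (U_gl N) (map (\<lambda>k. gl_E N (i k) (i (\<alpha> k))) [1..<Suc m]))
       ({1..m} \<rightarrow>\<^sub>E {1..N})"

primrec gl_E_power :: "nat \<Rightarrow> nat \<Rightarrow> nat \<Rightarrow> nat \<Rightarrow> (nat \<times> nat) ncpoly set" where
  "gl_E_power N 0 i j = (if i = j then one (U_gl N) else ring.zero (U_gl N))"
| "gl_E_power N (Suc m) i j =
     finsum (U_gl N) (\<lambda>k. monoid.mult (U_gl N) (gl_E_power N m i k) (gl_E N k j)) {1..N}"

definition casimir :: "nat \<Rightarrow> nat \<Rightarrow> (nat \<times> nat) ncpoly set" where
  "casimir N m = finsum (U_gl N) (\<lambda>i. gl_E_power N m i i) {1..N}"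

text \<open>
  Polynomials in variables numbered \<open>1, 2, \<dots>\<close> whose coefficients are polynomials in the
  formal variable \<open>N\<close>.  Exponent vectors are indexed from \<open>0\<close>: index \<open>i\<close> belongs to the
  variable with number \<open>i + 1\<close>.  The type serves both for \<open>\<complex>[N; C\<^sub>1, C\<^sub>2, \<dots>]\<close>
  and for \<open>\<complex>[N; S\<^sub>1, S\<^sub>2, \<dots>]\<close>.
\<close>

type_synonym gl_poly = "(nat \<Rightarrow>\<^sub>0 nat) \<Rightarrow>\<^sub>0 complex poly"

definition coef :: "complex poly \<Rightarrow> gl_poly" where
  "coef c = Poly_Mapping.single 0 c"

definition indet :: "nat \<Rightarrow> gl_poly" where
  "indet m = Poly_Mapping.single (Poly_Mapping.single (m - 1) 1) 1"

definition formal_N :: "complex poly" where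
  "formal_N = [:0, 1:]"

text \<open>
  Substitution of the integer \<open>N\<close> and of \<open>C\<^sub>i = C\<^sub>i\<^sub>,\<^sub>N\<close>.  The Casimir elements commute; the
  product is taken in increasing order of the indices only to have a definite expression.
\<close>

definition casimir_subst :: "nat \<Rightarrow> gl_poly \<Rightarrow> (nat \<times> nat) ncpoly set" where
  "casimir_subst N p =
     finsum (U_gl N)
       (\<lambda>\<mu>. monoid.mult (U_gl N)
          (U_scalar N (poly (Poly_Mapping.lookup p \<mu>) (of_nat N)))
          (list_mult (U_gl N)
             (map (\<lambda>i. casimir N (i + 1) [^]\<^bsub>U_gl N\<^esub> (Poly_Mapping.lookup \<mu> i))
               (sorted_list_of_set (Poly_Mapping.keys \<mu>)))))
       (Poly_Mapping.keys p)"

text \<open>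
  The numbering of variables from \<open>1\<close> matters here: with a variable \<open>C\<^sub>0\<close>, to be replaced
  by \<open>Tr(E\<^sup>0) = N\<close>, the polynomial would not be unique.
\<close>

definition w_gl :: "nat \<Rightarrow> (nat \<Rightarrow> nat) \<Rightarrow> gl_poly" where
  "w_gl m \<alpha> = (THE p. \<forall>N\<ge>1. casimir_subst N p = w_glN N m \<alpha>)"

definition W :: "nat \<Rightarrow> gl_poly" where
  "W m = (if m = 0 then 1
          else coef [:1 / fact m:] * (\<Sum>\<alpha> | \<alpha> permutes {1..m}. w_gl m \<alpha>))"

text \<open>The library's \<open>gchoose\<close> is constrained to fields, hence not available for polynomials.\<close>

definition poly_binomial :: "complex poly \<Rightarrow> nat \<Rightarrow> complex poly" where
  "poly_binomial a k = smult (1 / fact k) (\<Prod>i<k. a - of_nat i)"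

text \<open>The power \<open>f\<^sup>a\<close> of a series with constant term \<open>1\<close>, for an exponent polynomial in \<open>N\<close>.\<close>

definition fps_formal_power :: "complex poly fps \<Rightarrow> complex poly \<Rightarrow> complex poly fps" where
  "fps_formal_power f a = Abs_fps (poly_binomial a) oo (f - 1)"

definition fps_coef :: "complex poly fps \<Rightarrow> gl_poly fps" where
  "fps_coef f = Abs_fps (\<lambda>n. coef (fps_nth f n))"

definition schur_S :: "nat \<Rightarrow> gl_poly" where
  "schur_S k = (if k = 0 then 1 else indet k)"

text \<open>
  \<open>one_minus a\<close> is \<open>1 - a v\<close>, and \<open>S_series a\<close> is \<open>\<Sum>i\<ge>0. v\<^sup>i (1 - a v)\<^sup>-\<^sup>i S\<^sub>i\<close>.  All series
  inverted here have constant term \<open>1\<close>; the second argument of \<open>fps_right_inverse\<close> is the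
  inverse of that term.
\<close>

definition one_minus :: "complex poly \<Rightarrow> complex poly fps" where
  "one_minus a = 1 - fps_const a * fps_X"

definition S_series :: "complex poly \<Rightarrow> gl_poly fps" where
  "S_series a = Abs_fps schur_S oo fps_coef (fps_X * fps_right_inverse (one_minus a) 1)"

definition schur_series :: "gl_poly fps" where
  "schur_series =
     (let a = smult (1/2) (formal_N + 1); b = smult (1/2) (formal_N - 1)
      in fps_coef (fps_formal_power (one_minus a * fps_right_inverse (one_minus b) 1) formal_N)
         * (S_series b * fps_right_inverse (S_series a) 1))"

definition schur_C :: "nat \<Rightarrow> gl_poly" where
  "schur_C m = - fps_nth schur_series (m + 1)"

definition schur_subst :: "gl_poly \<Rightarrow> gl_poly" where
  "schur_subst p =
     (\<Sum>\<mu>\<in>Poly_Mapping.keys p. coef (Poly_Mapping.lookup p \<mu>) *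
        (\<Prod>i\<in>Poly_Mapping.keys \<mu>. schur_C (i + 1) ^ Poly_Mapping.lookup \<mu> i))"

lemma coef_0 [simp]: "coef 0 = 0"
  by (simp add: coef_def)

lemma coef_1 [simp]: "coef 1 = 1"
  unfolding coef_def by (rule single_one)

lemma coef_uminus: "coef (- c) = - coef c"
  by (simp add: coef_def single_uminus)

lemma S_series_nth_0 [simp]: "fps_nth (S_series a) 0 = 1"
  by (simp add: S_series_def fps_compose_nth schur_S_def)

lemma S_series_nth_1 [simp]: "fps_nth (S_series a) (Suc 0) = indet 1"
  by (simp add: S_series_def fps_compose_nth schur_S_def fps_coef_def one_minus_def)

lemma poly_binomial_0 [simp]: "poly_binomial a 0 = 1"
  by (simp add: poly_binomial_def flip: one_pCons)

lemma poly_binomial_1 [simp]: "poly_binomial a (Suc 0) = a"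
  by (simp add: poly_binomial_def)

lemma schur_relation:
  "1 - fps_const (coef formal_N) * fps_X - Abs_fps (\<lambda>n. if n < 2 then 0 else schur_C (n - 1))
     = schur_series"
proof (rule fps_ext)
  fix n :: nat
  have 0: "fps_nth schur_series 0 = 1"
    by (simp add: schur_series_def Let_def fps_coef_def fps_formal_power_def fps_compose_nth)
  have half: "- smult (1/2) (1 - formal_N) - smult (1/2) (formal_N + 1) = - 1"
    by (simp add: formal_N_def one_pCons)
  have 1: "fps_nth schur_series (Suc 0) = - coef formal_N"
    by (simp add: schur_series_def Let_def fps_coef_def fps_formal_power_def fps_compose_nth
        one_minus_def fps_mult_nth_1 half flip: coef_uminus)
  consider "n = 0" | "n = 1" | "n \<ge> 2" by linarith
  then show "fps_nth (1 - fps_const (coef formal_N) * fps_X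
      - Abs_fps (\<lambda>n. if n < 2 then 0 else schur_C (n - 1))) n = fps_nth schur_series n"
  proof cases
    case 3
    then show ?thesis
      by (cases n) (auto simp: schur_C_def)
  qed (use 0 1 in auto)
qed

definition nu :: "complex poly" where
  "nu = formal_N - 1"

text \<open>The series \<open>(exp (t/2) - exp (-t/2)) / t\<close>; division by \<open>t\<close> is exact, and the constant
  term is \<open>1\<close>.\<close>

definition sinh_series :: "complex fps" where
  "sinh_series = (fps_exp (1/2) - fps_exp (- (1/2))) / fps_X"

definition sinh_power :: "complex poly fps" where
  "sinh_power = fps_formal_power (Abs_fps (\<lambda>n. [:fps_nth sinh_series n:])) (- nu)"

text \<open>The quotient \<open>(m + \<nu>)! / (k + \<nu>)!\<close>, that is, the falling factorial
  \<open>(m + \<nu>) \<cdots> (k + \<nu> + 1)\<close>, for \<open>k \<le> m\<close>.\<close>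

definition fact_ratio :: "nat \<Rightarrow> nat \<Rightarrow> complex poly" where
  "fact_ratio m k = (\<Prod>j\<in>{k<..m}. of_nat j + nu)"

end

theory Submission
  imports
    Defs
    "HOL-Computational_Algebra.Fundamental_Theorem_Algebra"
    "HOL-Computational_Algebra.Polynomial_FPS"
begin

text \<open>
  For fixed \<open>N\<close> all elements are evaluated on a highest weight vector. Write \<open>l\<^sub>1, \<dots>, l\<^sub>N\<close> for the
  shifted weights \<open>l\<^sub>i = \<lambda>\<^sub>i + N - i\<close>. The sum over permutations of
  \<open>(E - c\<^sub>1) \<otimes> \<dots> \<otimes> (E - c\<^sub>m)\<close> is a linear functional of \<open>(X - c\<^sub>1) \<cdots> (X - c\<^sub>m)\<close>, up to the factor
  \<open>(m + \<nu>)!\<close>. For \<open>c = (0, 1, \<dots>, m - 1)\<close> the sum is symmetric in rows and columns, so that its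
  factors can be sorted; only diagonal terms then survive and give a shifted complete homogeneous
  polynomial. Those polynomials are the coefficients of the divided difference of
  \<open>x \<mapsto> (1 + u)\<^sup>x\<close> at the \<open>l\<^sub>i\<close>, and \<open>u = e\<^sup>t - 1\<close> turns it into the divided difference of
  \<open>x \<mapsto> e\<^bsup>x t\<^esup>\<close>, whose coefficients are the complete homogeneous polynomials \<open>S\<^sub>k\<close>; the factor
  \<open>u\<^sup>\<nu>\<close> accounts for the power of \<open>(e\<^bsup>t/2\<^esup> - e\<^bsup>-t/2\<^esup>) / t\<close>.

  The identity of polynomials in \<open>N, S\<^sub>1, S\<^sub>2, \<dots>\<close> follows because dominant weights are Zariski
  dense and every tuple \<open>S\<^sub>1, \<dots>, S\<^sub>N\<close> of complex numbers is of the form \<open>h\<^sub>i(x\<^sub>1, \<dots>, x\<^sub>N)\<close>. The same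
  argument shows that the universal polynomial of a permutation is unique; it exists because
  neighbouring factors commute up to diagrams with fewer chords.
\<close>

text \<open>\<open>w_gl\<close> is a definite description, so \<open>W\<close> cannot be evaluated
  before existence and uniqueness of the universal polynomials are proved. Existence uses the
  commutation relations alone. Uniqueness and the formula need enough points of evaluation. These
  are the sums of fundamental weights with natural coefficients, because their highest weight
  vectors can be written down: they are products of leading minors in the tensor algebra.

  The factor (m + nu)! has a combinatorial origin. When the shift of one of m factors changes, the
  difference contains a Kronecker delta at one label, and that label can be removed from the
  permutation. It was either a fixed point, whose index runs freely over N values, or it had been
  inserted at one of the m - 1 other labels, which determines its index. Each removed factor
  therefore costs N + m - 1 = m + nu, and these numbers multiply up to the factorial.\<close>

lemma poly_mapping_sum_single:
  fixes p :: "'a \<Rightarrow>\<^sub>0 'b::comm_monoid_add"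
  shows "p = (\<Sum>k\<in>Poly_Mapping.keys p. Poly_Mapping.single k (Poly_Mapping.lookup p k))"
  by (rule poly_mapping_eqI) (auto simp: lookup_sum lookup_single when_def sum.delta in_keys_iff)

lemma poly_mapping_induct [case_names single add]:
  fixes p :: "'a \<Rightarrow>\<^sub>0 'b::comm_monoid_add"
  assumes "\<And>k c. P (Poly_Mapping.single k c)" and "\<And>p q. P p \<Longrightarrow> P q \<Longrightarrow> P (p + q)"
  shows "P p"
proof -
  have "P (\<Sum>k\<in>A. Poly_Mapping.single k (Poly_Mapping.lookup p k))" if "finite A" for A
    using that
  proof (induction A rule: finite_induct)
    case empty
    show ?case using assms(1)[of undefined 0] by simp
  qed (simp add: assms)
  then show ?thesis
    by (subst poly_mapping_sum_single) simp
qed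

lemma sum_keys_superset:
  fixes p :: "'a \<Rightarrow>\<^sub>0 'b::zero" and F :: "'a \<Rightarrow> 'b \<Rightarrow> 'c::comm_monoid_add"
  assumes "finite A" "Poly_Mapping.keys p \<subseteq> A" "\<And>k. F k 0 = 0"
  shows "(\<Sum>k\<in>Poly_Mapping.keys p. F k (Poly_Mapping.lookup p k))
    = (\<Sum>k\<in>A. F k (Poly_Mapping.lookup p k))"
  by (rule sum.mono_neutral_left) (use assms in \<open>auto simp: in_keys_iff\<close>)

text \<open>Coefficients of \<open>p\<close> and \<open>q\<close> may cancel, so all three sums are
  first extended to the union of the supports. The evaluations \<open>phi\<close>,
  \<open>csR\<close> and \<open>ev\<close> are sums over keys and get their additivity here.\<close>

lemma sum_keys_add:
  fixes p q :: "'a \<Rightarrow>\<^sub>0 'b::comm_monoid_add" and F :: "'a \<Rightarrow> 'b \<Rightarrow> 'c::comm_monoid_add"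
  assumes "\<And>k. F k 0 = 0" "\<And>k a b. F k (a + b) = F k a + F k b"
  shows "(\<Sum>k\<in>Poly_Mapping.keys (p + q). F k (Poly_Mapping.lookup (p + q) k))
    = (\<Sum>k\<in>Poly_Mapping.keys p. F k (Poly_Mapping.lookup p k))
      + (\<Sum>k\<in>Poly_Mapping.keys q. F k (Poly_Mapping.lookup q k))"
proof -
  let ?A = "Poly_Mapping.keys p \<union> Poly_Mapping.keys q"
  have "finite ?A" by simp
  have s: "Poly_Mapping.keys (p + q) \<subseteq> ?A" by (rule Poly_Mapping.keys_add)
  show ?thesis
    by (subst (1 2 3) sum_keys_superset[where F = F and A = ?A])
      (use s assms in \<open>auto simp: lookup_add sum.distrib\<close>)
qed

section \<open>Highest weight functionals\<close>

definition gl_comm :: "nat \<Rightarrow> nat \<Rightarrow> nat \<Rightarrow> nat \<Rightarrow> (nat \<times> nat) ncpoly" where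
  "gl_comm i j k l = (if j = k then nc_gen (i, l) else 0) - (if i = l then nc_gen (k, j) else 0)"

definition gl_rel :: "nat \<Rightarrow> nat \<Rightarrow> nat \<Rightarrow> nat \<Rightarrow> (nat \<times> nat) ncpoly" where
  "gl_rel i j k l = nc_gen (i, j) * nc_gen (k, l) - nc_gen (k, l) * nc_gen (i, j) - gl_comm i j k l"

text \<open>Think of \<open>phi p\<close> as one coefficient of p v, normalized to 1 at p = 1, for a
  highest weight vector v of weight \<open>lam\<close>. The rightmost factor acts on v first, so the
  conditions on raising and diagonal generators concern right factors, whereas a relation may stand
  between any two factors.\<close>

locale hw_functional =
  fixes n :: nat and lam :: "nat \<Rightarrow> complex" and phi :: "(nat \<times> nat) ncpoly \<Rightarrow> complex"
  assumes phi_add: "phi (p + q) = phi p + phi q"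
    and phi_const: "phi (nc_const c * p) = c * phi p"
    and phi_1: "phi 1 = 1"
    and phi_upper: "1 \<le> i \<Longrightarrow> i < j \<Longrightarrow> j \<le> n \<Longrightarrow> phi (p * nc_gen (i, j)) = 0"
    and phi_diag: "1 \<le> i \<Longrightarrow> i \<le> n \<Longrightarrow> phi (p * nc_gen (i, i)) = lam i * phi p"
    and phi_rel: "phi (p * gl_rel i j k l * q) = 0"

text \<open>Vectors of the tensor algebra of \<open>\<complex>\<^sup>n\<close> are functions on words; \<open>tens_E i j\<close> is the
  action of \<open>E\<^sub>i\<^sub>j\<close> as a derivation.\<close>

definition tens_E :: "nat \<Rightarrow> nat \<Rightarrow> (nat list \<Rightarrow> complex) \<Rightarrow> nat list \<Rightarrow> complex" where
  "tens_E i j f w = (\<Sum>p<length w. if w ! p = i then f (w[p := j]) else 0)"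

text \<open>Terms in which the two operators act at different positions are symmetric in the
  operators and cancel. What remains is, position by position, the commutator of two matrix
  units.\<close>

lemma tens_E_commutator:
  "tens_E i j (tens_E k l f) w - tens_E k l (tens_E i j f) w
    = (if j = k then tens_E i l f w else 0) - (if i = l then tens_E k j f w else 0)"
proof -
  define m where "m = length w"
  define A where "A i j k l p q = (if w ! p = i \<and> w ! q = k then f (w[p := j, q := l]) else 0)" for i j k l p q
  have comp: "tens_E i j (tens_E k l f) w
      = (if j = k then tens_E i l f w else 0) + (\<Sum>p<m. \<Sum>q\<in>{..<m} - {p}. A i j k l p q)" for i j k l
  proof -
    have "tens_E i j (tens_E k l f) w = (\<Sum>p<m. \<Sum>q<m.
        if w ! p = i \<and> w[p := j] ! q = k then f (w[p := j, q := l]) else 0)"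
      by (auto simp: tens_E_def m_def intro!: sum.cong)
    also have "\<dots> = (\<Sum>p<m. (if w ! p = i \<and> j = k then f (w[p := l]) else 0)
        + (\<Sum>q\<in>{..<m} - {p}. A i j k l p q))"
    proof (rule sum.cong[OF refl])
      fix p assume p: "p \<in> {..<m}"
      show "(\<Sum>q<m. if w ! p = i \<and> w[p := j] ! q = k then f (w[p := j, q := l]) else 0)
        = (if w ! p = i \<and> j = k then f (w[p := l]) else 0) + (\<Sum>q\<in>{..<m} - {p}. A i j k l p q)"
        using p by (subst sum.remove[of _ p]) (auto simp: m_def A_def intro!: sum.cong)
    qed
    also have "\<dots> = (if j = k then tens_E i l f w else 0) + (\<Sum>p<m. \<Sum>q\<in>{..<m} - {p}. A i j k l p q)"
      by (auto simp: sum.distrib tens_E_def m_def)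
    finally show ?thesis .
  qed
  have sym: "A i j k l p q = A k l i j q p" if "p \<noteq> q" for p q
    using that by (auto simp: A_def list_update_swap)
  have "(\<Sum>p<m. \<Sum>q\<in>{..<m} - {p}. A i j k l p q) = (\<Sum>p<m. \<Sum>q<m. if q = p then 0 else A i j k l p q)" for i j k l
    by (intro sum.cong refl sum.mono_neutral_cong_left) auto
  moreover have "(\<Sum>p<m. \<Sum>q<m. if q = p then 0 else A i j k l p q) = (\<Sum>p<m. \<Sum>q<m. if q = p then 0 else A k l i j p q)"
    using sym by (subst sum.swap) (intro sum.cong refl, auto)
  ultimately have "(\<Sum>p<m. \<Sum>q\<in>{..<m} - {p}. A i j k l p q) = (\<Sum>p<m. \<Sum>q\<in>{..<m} - {p}. A k l i j p q)"
    by simp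
  then show ?thesis
    by (simp add: comp)
qed

text \<open>The degree \<open>d\<close> is recorded because \<open>cat_prod\<close>, the product of
  tensors, must know where to cut a word. On a first factor of degree \<open>d\<close> the operators
  satisfy the Leibniz rule, so weights add.\<close>

definition hw_vector :: "nat \<Rightarrow> (nat \<Rightarrow> complex) \<Rightarrow> nat \<Rightarrow> (nat list \<Rightarrow> complex) \<Rightarrow> bool" where
  "hw_vector n lam d f \<longleftrightarrow> f \<noteq> (\<lambda>_. 0) \<and> (\<forall>w. length w \<noteq> d \<longrightarrow> f w = 0)
    \<and> (\<forall>i j w. 1 \<le> i \<longrightarrow> i < j \<longrightarrow> j \<le> n \<longrightarrow> tens_E i j f w = 0)
    \<and> (\<forall>i w. 1 \<le> i \<longrightarrow> i \<le> n \<longrightarrow> tens_E i i f w = lam i * f w)"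

lemma hw_vector_const: "hw_vector n (\<lambda>_. 0) 0 (\<lambda>w. if w = [] then 1 else 0)"
  by (auto simp: hw_vector_def tens_E_def fun_eq_iff intro!: sum.neutral)

definition cat_prod :: "nat \<Rightarrow> (nat list \<Rightarrow> complex) \<Rightarrow> (nat list \<Rightarrow> complex) \<Rightarrow> nat list \<Rightarrow> complex" where
  "cat_prod d f g w = f (take d w) * g (drop d w)"

lemma tens_E_cat_prod:
  assumes "\<And>w. length w \<noteq> d \<Longrightarrow> f w = 0"
  shows "tens_E i j (cat_prod d f g) w = cat_prod d (tens_E i j f) g w + cat_prod d f (tens_E i j g) w"
proof (cases "d \<le> length w")
  case False
  then have z: "f (take d w) = 0" "\<And>p. f (take d (w[p := j])) = 0" "\<And>p. f (w[p := j]) = 0"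
    using assms by simp_all
  from False assms have "f w = 0" "length w < d" by simp_all
  with z show ?thesis by (simp add: tens_E_def cat_prod_def cong: if_cong)
next
  case True
  let ?F = "\<lambda>p. if w ! p = i then cat_prod d f g (w[p := j]) else 0"
  have split: "{..<length w} = {..<d} \<union> {d..<length w}" using True by auto
  have "tens_E i j (cat_prod d f g) w = sum ?F {..<d} + sum ?F {d..<length w}"
    unfolding tens_E_def split by (rule sum.union_disjoint) auto
  also have "sum ?F {..<d} = cat_prod d (tens_E i j f) g w"
    using True by (auto simp: cat_prod_def tens_E_def sum_distrib_right take_update_swap intro!: sum.cong)
  also have "sum ?F {d..<length w} = sum (\<lambda>p. ?F (p + d)) {..<length w - d}"
    by (rule sum.reindex_bij_witness[where i = "\<lambda>p. p + d" and j = "\<lambda>p. p - d"]) auto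
  also have "\<dots> = cat_prod d f (tens_E i j g) w"
    using True by (auto simp: cat_prod_def tens_E_def sum_distrib_left drop_update_swap add.commute intro!: sum.cong)
  finally show ?thesis .
qed

lemma hw_vector_cat_prod:
  assumes f: "hw_vector n lam d f" and g: "hw_vector n mu e g"
  shows "hw_vector n (\<lambda>i. lam i + mu i) (d + e) (cat_prod d f g)"
proof -
  have f0: "\<And>w. length w \<noteq> d \<Longrightarrow> f w = 0" and g0: "\<And>w. length w \<noteq> e \<Longrightarrow> g w = 0"
    using f g by (auto simp: hw_vector_def)
  obtain u v where "f u \<noteq> 0" "g v \<noteq> 0" using f g by (auto simp: hw_vector_def fun_eq_iff)
  moreover from this have "length u = d" using f0 by auto
  ultimately have "cat_prod d f g (u @ v) \<noteq> 0" by (simp add: cat_prod_def)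
  moreover have "cat_prod d f g w = 0" if "length w \<noteq> d + e" for w
    using that f0[of "take d w"] g0[of "drop d w"] by (cases "d \<le> length w") (auto simp: cat_prod_def)
  moreover have "tens_E i j (cat_prod d f g) w = 0" if "1 \<le> i" "i < j" "j \<le> n" for i j w
    using f g that by (subst tens_E_cat_prod[OF f0]) (auto simp: cat_prod_def hw_vector_def)
  moreover have "tens_E i i (cat_prod d f g) w = (lam i + mu i) * cat_prod d f g w" if "1 \<le> i" "i \<le> n" for i w
    using f g that by (subst tens_E_cat_prod[OF f0]) (auto simp: cat_prod_def hw_vector_def algebra_simps)
  ultimately show ?thesis by (auto simp: hw_vector_def fun_eq_iff)
qed

text \<open>Letters are numbered from 1 and positions from 0, hence the subtraction: a word is read
  as the one-line notation of a permutation.\<close>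

definition list_perm :: "nat list \<Rightarrow> nat \<Rightarrow> nat" where
  "list_perm w p = (if p < length w then w ! p - 1 else p)"

text \<open>The leading \<open>k \<times> k\<close> minor, as an alternating tensor.\<close>

definition minor :: "nat \<Rightarrow> nat list \<Rightarrow> complex" where
  "minor k w = (if length w = k \<and> set w = {1..k} then of_int (sign (list_perm w)) else 0)"

lemma list_perm_permutes:
  assumes "length w = k" "set w = {1..k}"
  shows "list_perm w permutes {..<k}"
proof (rule bij_imp_permutes)
  have d: "distinct w" using assms by (simp add: card_distinct)
  have "list_perm w ` {..<k} = (\<lambda>x. x - 1) ` set w"
    using assms(1) by (auto simp: list_perm_def set_conv_nth)
  also have "\<dots> = {..<k}"
    unfolding assms(2) by (force intro: image_eqI[of _ _ "Suc _"])
  finally have "list_perm w ` {..<k} = {..<k}" .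
  then show "bij_betw (list_perm w) {..<k} {..<k}"
    by (simp add: bij_betw_def finite_surj_inj)
  show "list_perm w x = x" if "x \<notin> {..<k}" for x
    using that assms(1) by (simp add: list_perm_def)
qed

lemma minor_swap:
  assumes "length w = k" "p < k" "q < k" "p \<noteq> q"
  shows "minor k (w[p := w ! q, q := w ! p]) = - minor k w"
proof (cases "set w = {1..k}")
  case False
  then show ?thesis using assms by (simp add: minor_def set_swap)
next
  case True
  let ?w = "w[p := w ! q, q := w ! p]"
  have "list_perm ?w = list_perm w \<circ> Transposition.transpose p q"
    using assms by (auto simp: fun_eq_iff list_perm_def nth_list_update Transposition.transpose_def)
  moreover have "permutation (list_perm w)"
    using list_perm_permutes[OF assms(1) True] finite_lessThan permutation_permutes by blast
  ultimately have "sign (list_perm ?w) = - sign (list_perm w)"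
    using assms by (simp add: sign_compose sign_swap_id permutation_swap_id)
  then show ?thesis using assms True by (simp add: minor_def set_swap)
qed

lemma tens_E_diag: "tens_E i i f w = of_nat (count_list w i) * f w"
proof -
  have "tens_E i i f w = (\<Sum>p<length w. if w ! p = i then f w else 0)"
    by (auto simp: tens_E_def intro!: sum.cong)
  also have "\<dots> = of_nat (card {p. p < length w \<and> w ! p = i}) * f w"
    by (simp flip: sum.inter_filter)
  also have "{p. p < length w \<and> w ! p = i} = {p. p < length w \<and> i = w ! p}" by auto
  also have "card \<dots> = count_list w i"
    by (simp add: count_list_eq_length_filter length_filter_conv_card)
  finally show ?thesis .
qed

lemma hw_vector_minor:
  "hw_vector n (\<lambda>i. if i \<le> k then 1 else 0) k (minor k)"
proof -
  have "minor k [1..<Suc k] \<noteq> 0"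
    by (auto simp: minor_def sign_def)
  then have "minor k \<noteq> (\<lambda>_. 0)" by (metis (full_types))
  moreover have "minor k w = 0" if "length w \<noteq> k" for w using that by (simp add: minor_def)
  moreover have "tens_E i j (minor k) w = 0" if ij: "1 \<le> i" "i < j" for i j w
  proof (cases "length w = k \<and> (\<exists>p<k. w ! p = i \<and> set (w[p := j]) = {1..k})")
    case False
    then show ?thesis by (auto simp: tens_E_def minor_def intro!: sum.neutral)
  next
    case True
    then obtain p where w: "length w = k" "p < k" "w ! p = i" and s: "set (w[p := j]) = {1..k}" by blast
    have "j \<in> {1..k}" using w set_update_memI[of p w j] unfolding s[symmetric] by simp
    \<comment> \<open>After the replacement every letter from 1 to k occurs exactly once, in
      particular i, so \<open>w\<close> has a second i at some position q. Replacing at p or at q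
      gives two words that differ by a swap, and their signs cancel.\<close>
    with ij s have "i \<in> set (w[p := j])" by auto
    then obtain q where q: "q < k" "w[p := j] ! q = i" using w by (auto simp: in_set_conv_nth)
    have qp: "q \<noteq> p" "w ! q = i" using q w ij by (auto simp: nth_list_update split: if_splits)
    have d: "distinct (w[p := j])" using s w by (simp add: card_distinct)
    have only: "r = p \<or> r = q" if "r < k" "w ! r = i" for r
      using that d q w qp by (metis nth_eq_iff_index_eq length_list_update nth_list_update_neq)
    have "tens_E i j (minor k) w = (\<Sum>r\<in>{p, q}. if w ! r = i then minor k (w[r := j]) else 0)"
      unfolding tens_E_def w(1) using only q w by (intro sum.mono_neutral_right) auto
    also have "\<dots> = minor k (w[p := j]) + minor k (w[q := j])" using qp w by auto
    also have "w[q := j] = (w[p := j])[p := w[p := j] ! q, q := w[p := j] ! p]"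
      using qp w q by (simp add: nth_list_update) (metis list_update_id)
    also have "minor k \<dots> = - minor k (w[p := j])"
      by (rule minor_swap) (use w q qp in auto)
    finally show ?thesis by simp
  qed
  moreover have "tens_E i i (minor k) w = (if i \<le> k then 1 else 0) * minor k w" if "1 \<le> i" for i w
  proof (cases "length w = k \<and> set w = {1..k}")
    case True
    then have d: "distinct w" by (simp add: card_distinct)
    have "count_list w i = (if i \<in> set w then 1 else 0)"
      using d by (induction w) auto
    then show ?thesis using True that by (simp add: tens_E_diag)
  qed (auto simp: tens_E_diag minor_def)
  ultimately show ?thesis
    unfolding hw_vector_def by blast
qed

text \<open>\<open>a k\<close> is the coefficient of the k-th fundamental weight, the weight of
  \<open>minor k\<close>. Natural coefficients serve to form products of minors, complex ones to
  vary the weight in polynomial arguments.\<close>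

definition dom_weight :: "nat \<Rightarrow> (nat \<Rightarrow> 'a::comm_monoid_add) \<Rightarrow> nat \<Rightarrow> 'a" where
  "dom_weight n a i = (\<Sum>k = i..n. a k)"

lemma ex_hw_vector:
  fixes a :: "nat \<Rightarrow> nat"
  shows "\<exists>d f. hw_vector n (dom_weight n (\<lambda>i. of_nat (a i))) d f"
proof -
  \<comment> \<open>One minor is multiplied on at a time: the outer induction runs over the
    different minors, the inner one over the multiplicity of one of them.\<close>
  have step: "\<exists>d f. hw_vector n (\<lambda>i. \<Sum>k\<in>A. if i \<le> k then of_nat (a k) else 0) d f" if "finite A" for A
    using that
  proof (induction A rule: finite_induct)
    case empty
    show ?case using hw_vector_const by auto
  next
    case (insert k A)
    have "\<exists>d f. hw_vector n (\<lambda>i. (if i \<le> k then of_nat m else 0) + (\<Sum>k\<in>A. if i \<le> k then of_nat (a k) else 0)) d f" for m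
    proof (induction m)
      case 0
      show ?case using insert.IH by (simp only: of_nat_0 if_cancel add_0_left)
    next
      case (Suc m)
      then obtain d f where "hw_vector n (\<lambda>i. (if i \<le> k then of_nat m else 0) + (\<Sum>k\<in>A. if i \<le> k then of_nat (a k) else 0)) d f"
        by blast
      from hw_vector_cat_prod[OF hw_vector_minor this, of k] show ?case
        by (intro exI[of _ "k + d"] exI[of _ "cat_prod k (minor k) f"])
          (simp add: hw_vector_def)
    qed
    from this[of "a k"] show ?case using insert by simp
  qed
  obtain d f where *: "hw_vector n (\<lambda>i. \<Sum>k\<in>{..n}. if i \<le> k then of_nat (a k) else 0) d f"
    using step[of "{..n}"] by auto
  have "(\<lambda>i. \<Sum>k\<in>{..n}. if i \<le> k then of_nat (a k) else 0) = dom_weight n (\<lambda>i. of_nat (a i) :: complex)"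
    by (auto simp: fun_eq_iff dom_weight_def sum.inter_filter[symmetric] intro!: sum.cong)
  with * show ?thesis by auto
qed

definition word_act :: "(nat \<times> nat) list \<Rightarrow> (nat list \<Rightarrow> complex) \<Rightarrow> nat list \<Rightarrow> complex" where
  "word_act xs f = foldr (\<lambda>(i, j). tens_E i j) xs f"

text \<open>A matrix coefficient: act on a highest weight tensor \<open>f\<close>, read off the
  value at a word \<open>w\<close> in its support and divide by \<open>f w\<close>.\<close>

lemma ex_hw_functional:
  fixes a :: "nat \<Rightarrow> nat"
  shows "\<exists>phi. hw_functional n (dom_weight n (\<lambda>i. of_nat (a i))) phi"
proof -
  obtain d f where f: "hw_vector n (dom_weight n (\<lambda>i. of_nat (a i))) d f"
    using ex_hw_vector by blast
  then obtain w where w: "f w \<noteq> 0" by (auto simp: hw_vector_def fun_eq_iff)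
  define g where "g xs = word_act xs f w / f w" for xs
  define phi where "phi p = (\<Sum>u\<in>Poly_Mapping.keys p. Poly_Mapping.lookup p u * g (letters u))" for p :: "(nat \<times> nat) ncpoly"
  have add: "phi (p + q) = phi p + phi q" for p q
    unfolding phi_def by (rule sum_keys_add) (simp_all add: algebra_simps)
  have phi_single: "phi (Poly_Mapping.single u c) = c * g (letters u)" for u c
    by (simp add: phi_def)
  have diff: "phi (p - q) = phi p - phi q" for p q
    using add[of "p - q" q] by simp
  have zero: "phi 0 = 0" by (simp add: phi_def)
  have tens0: "tens_E i j (\<lambda>_. 0) = (\<lambda>_. 0)" for i j by (simp add: tens_E_def fun_eq_iff)
  have act0: "word_act xs (\<lambda>_. 0) = (\<lambda>_. 0)" for xs
    by (induction xs) (auto simp: word_act_def tens0)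
  have act_smult: "word_act xs (\<lambda>w. c * h w) w = c * word_act xs h w" for xs c h w
    by (induction xs arbitrary: w) (auto simp: word_act_def tens_E_def sum_distrib_left intro!: sum.cong)
  have act_diff: "word_act xs (\<lambda>w. h w - h' w) w = word_act xs h w - word_act xs h' w" for xs h h' w
    by (induction xs arbitrary: w) (auto simp: word_act_def tens_E_def sum_subtractf[symmetric] intro!: sum.cong)
  have act_append: "word_act (xs @ ys) h = word_act xs (word_act ys h)" for xs ys h
    by (simp add: word_act_def)
  have act1: "word_act [(i, j)] h = tens_E i j h" for i j h by (simp add: word_act_def)
  have gen: "phi (p * nc_gen (i, j)) = c * phi p"
    if "\<And>xs. g (xs @ [(i, j)]) = c * g xs" for p i j c
    by (induction p rule: poly_mapping_induct)
      (simp_all add: nc_gen_def mult_single phi_single plus_fmon_def that add algebra_simps)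
  show ?thesis
  proof (intro exI, unfold_locales)
    show "phi (p + q) = phi p + phi q" for p q by (rule add)
    show "phi (nc_const c * p) = c * phi p" for c p
      by (induction p rule: poly_mapping_induct)
        (simp_all add: nc_const_def mult_single phi_single add algebra_simps)
    show "phi 1 = 1"
      using w by (simp add: phi_single zero_fmon_def g_def word_act_def flip: single_one)
    show "phi (p * nc_gen (i, j)) = 0" if "1 \<le> i" "i < j" "j \<le> n" for i j p
    proof -
      have "tens_E i j f = (\<lambda>_. 0)" using f that by (auto simp: hw_vector_def)
      then show ?thesis using gen[of i j 0 p] by (simp add: g_def act_append act1 act0)
    qed
    show "phi (p * nc_gen (i, i)) = dom_weight n (\<lambda>i. of_nat (a i)) i * phi p" if "1 \<le> i" "i \<le> n" for i p
    proof -
      have "tens_E i i f = (\<lambda>w. dom_weight n (\<lambda>i. of_nat (a i)) i * f w)"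
        using f that by (auto simp: hw_vector_def)
      then show ?thesis
        using gen[of i i "dom_weight n (\<lambda>i. of_nat (a i)) i" p] by (simp add: g_def act_append act1 act_smult)
    qed
    show "phi (p * gl_rel i j k l * q) = 0" for p i j k l q
    proof (induction p rule: poly_mapping_induct)
      case (single u c)
      show ?case
      proof (induction q rule: poly_mapping_induct)
        case (single v e)
        define h where "h = word_act (letters v) f"
        have "tens_E i j (tens_E k l h) = (\<lambda>w. tens_E k l (tens_E i j h) w - (if i = l then tens_E k j h w else 0) + (if j = k then tens_E i l h w else 0))"
          using tens_E_commutator[of i j k l h] by (auto simp: fun_eq_iff algebra_simps)
        have "g (letters u @ (i, j) # (k, l) # letters v) - g (letters u @ (k, l) # (i, j) # letters v)
          = word_act (letters u) (\<lambda>w. tens_E i j (tens_E k l h) w - tens_E k l (tens_E i j h) w) w / f w"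
          unfolding act_diff by (simp add: diff_divide_distrib g_def h_def word_act_def)
        also have "\<dots> = word_act (letters u) (\<lambda>w. (if j = k then tens_E i l h w else 0) - (if i = l then tens_E k j h w else 0)) w / f w"
          by (simp add: tens_E_commutator)
        also have "\<dots> = (if j = k then g (letters u @ (i, l) # letters v) else 0) - (if i = l then g (letters u @ (k, j) # letters v) else 0)"
          unfolding act_diff using act0[of "letters u"] by (auto simp: diff_divide_distrib g_def h_def word_act_def)
        finally have g: "g (letters u @ (i, j) # (k, l) # letters v)
          = g (letters u @ (k, l) # (i, j) # letters v)
            + ((if j = k then g (letters u @ (i, l) # letters v) else 0) - (if i = l then g (letters u @ (k, j) # letters v) else 0))"
          by (simp add: algebra_simps)
        let ?s = "\<lambda>xs. Poly_Mapping.single (Word (letters u @ xs @ letters v)) (c * e)"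
        have "Poly_Mapping.single u c * gl_rel i j k l * Poly_Mapping.single v e
          = ?s [(i, j), (k, l)] - ?s [(k, l), (i, j)]
            - ((if j = k then ?s [(i, l)] else 0) - (if i = l then ?s [(k, j)] else 0))"
          by (simp add: gl_rel_def gl_comm_def nc_gen_def left_diff_distrib right_diff_distrib mult_single plus_fmon_def)
        then show ?case
          by (simp only: diff phi_single zero if_distrib[of phi] fmon.sel append_Cons append_Nil g)
            (simp add: algebra_simps)
      qed (simp add: distrib_left add)
    qed (simp add: distrib_right add)
  qed
qed

section \<open>The free algebra modulo the defining relations\<close>

abbreviation gl_free :: "nat \<Rightarrow> (nat \<times> nat) ncpoly set" where
  "gl_free n \<equiv> carrier (free_alg (gl_gens n))"

lemma gl_free_0 [simp]: "0 \<in> gl_free n" and gl_free_1 [simp]: "1 \<in> gl_free n"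
  using ring.ring_simprules(2,6)[OF ring_free_alg, of "gl_gens n"] by simp_all

lemma gl_free_add [intro]: "p \<in> gl_free n \<Longrightarrow> q \<in> gl_free n \<Longrightarrow> p + q \<in> gl_free n"
  using ring.ring_simprules(1)[OF ring_free_alg, of p "gl_gens n" q] by simp

lemma gl_free_mult [intro]: "p \<in> gl_free n \<Longrightarrow> q \<in> gl_free n \<Longrightarrow> p * q \<in> gl_free n"
  using ring.ring_simprules(5)[OF ring_free_alg, of p "gl_gens n" q] by simp

lemma gl_free_uminus [intro]: "p \<in> gl_free n \<Longrightarrow> - p \<in> gl_free n"
  by (simp add: free_alg_def)

lemma gl_free_diff [intro]: "p \<in> gl_free n \<Longrightarrow> q \<in> gl_free n \<Longrightarrow> p - q \<in> gl_free n"
  using gl_free_add[of p n "- q"] gl_free_uminus[of q n] by simp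

lemma gl_free_sum [intro]: "(\<And>a. a \<in> A \<Longrightarrow> f a \<in> gl_free n) \<Longrightarrow> sum f A \<in> gl_free n"
  by (induction A rule: infinite_finite_induct) auto

lemma gl_free_prod_list [intro]: "(\<And>x. x \<in> set xs \<Longrightarrow> x \<in> gl_free n) \<Longrightarrow> prod_list xs \<in> gl_free n"
  by (induction xs) auto

lemma gl_free_power [intro]: "p \<in> gl_free n \<Longrightarrow> p ^ k \<in> gl_free n"
  by (induction k) auto

lemma gl_free_gen [simp]: "nc_gen (i, j) \<in> gl_free n" if "i \<in> {1..n}" "j \<in> {1..n}"
  using that by (auto simp: free_alg_def nc_gen_def gl_gens_def)

lemma gl_free_const [simp]: "nc_const c \<in> gl_free n"
  by (auto simp: free_alg_def nc_const_def zero_fmon_def)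

lemma gl_free_a_inv: "a_inv (free_alg (gl_gens n)) p = - p" if "p \<in> gl_free n"
proof -
  interpret ring "free_alg (gl_gens n)" by (rule ring_free_alg)
  show ?thesis using minus_equality[of "- p" p] that gl_free_uminus[OF that] by simp
qed

lemma gl_ideal_0 [simp]: "0 \<in> gl_ideal n"
  using additive_subgroup.zero_closed[OF ideal.axioms(1)[OF ideal_gl_ideal], of n] by simp

lemma gl_ideal_add [intro]: "x \<in> gl_ideal n \<Longrightarrow> y \<in> gl_ideal n \<Longrightarrow> x + y \<in> gl_ideal n"
  using additive_subgroup.a_closed[OF ideal.axioms(1)[OF ideal_gl_ideal], of x n y] by simp

lemma gl_ideal_mult_left [intro]: "x \<in> gl_ideal n \<Longrightarrow> p \<in> gl_free n \<Longrightarrow> p * x \<in> gl_ideal n"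
  using ideal.I_l_closed[OF ideal_gl_ideal, of x n p] by simp

lemma gl_ideal_mult_right [intro]: "x \<in> gl_ideal n \<Longrightarrow> p \<in> gl_free n \<Longrightarrow> x * p \<in> gl_ideal n"
  using ideal.I_r_closed[OF ideal_gl_ideal, of x n p] by simp

lemma gl_ideal_uminus [intro]: "x \<in> gl_ideal n \<Longrightarrow> - x \<in> gl_ideal n"
  using gl_ideal_mult_left[of x n "- 1"] gl_free_uminus[OF gl_free_1] by simp

lemma gl_ideal_diff [intro]: "x \<in> gl_ideal n \<Longrightarrow> y \<in> gl_ideal n \<Longrightarrow> x - y \<in> gl_ideal n"
  using gl_ideal_add[of x n "- y"] gl_ideal_uminus[of y n] by simp

lemma gl_ideal_sum [intro]: "(\<And>a. a \<in> A \<Longrightarrow> f a \<in> gl_ideal n) \<Longrightarrow> sum f A \<in> gl_ideal n"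
  by (induction A rule: infinite_finite_induct) auto

lemma gl_rels_free: "gl_rels n \<subseteq> gl_free n"
  unfolding gl_rels_def
  by (clarify, intro gl_free_diff gl_free_mult) simp_all

lemma gl_rels_eq:
  "gl_rels n = {gl_rel i j k l | i j k l. i \<in> {1..n} \<and> j \<in> {1..n} \<and> k \<in> {1..n} \<and> l \<in> {1..n}}"
  by (simp add: gl_rels_def gl_rel_def gl_comm_def)

lemma gl_rel_ideal:
  assumes "i \<in> {1..n}" "j \<in> {1..n}" "k \<in> {1..n}" "l \<in> {1..n}"
  shows "gl_rel i j k l \<in> gl_ideal n"
proof -
  have "gl_rels n \<subseteq> gl_ideal n"
    unfolding gl_ideal_def by (rule ring.genideal_self[OF ring_free_alg gl_rels_free])
  then show ?thesis using assms unfolding gl_rels_eq by blast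
qed

text \<open>Calculations use representatives modulo the ideal, since noncommutative polynomials form
  a type of class ring, whereas \<open>U_gl\<close> is a ring with an explicit carrier.\<close>

definition gl_cong :: "nat \<Rightarrow> (nat \<times> nat) ncpoly \<Rightarrow> (nat \<times> nat) ncpoly \<Rightarrow> bool" where
  "gl_cong n p q \<longleftrightarrow> p - q \<in> gl_ideal n"

lemma gl_cong_refl [simp]: "gl_cong n p p"
  by (simp add: gl_cong_def)

lemma gl_cong_sym: "gl_cong n p q \<Longrightarrow> gl_cong n q p"
  unfolding gl_cong_def using gl_ideal_uminus by fastforce

lemma gl_cong_trans [trans]: "gl_cong n p q \<Longrightarrow> gl_cong n q r \<Longrightarrow> gl_cong n p r"
  unfolding gl_cong_def using gl_ideal_add[of "p - q" n "q - r"] by simp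

lemma gl_cong_add: "gl_cong n p q \<Longrightarrow> gl_cong n p' q' \<Longrightarrow> gl_cong n (p + p') (q + q')"
  unfolding gl_cong_def using gl_ideal_add[of "p - q" n "p' - q'"] by (simp add: algebra_simps)

lemma gl_cong_diff: "gl_cong n p q \<Longrightarrow> gl_cong n p' q' \<Longrightarrow> gl_cong n (p - p') (q - q')"
  unfolding gl_cong_def using gl_ideal_diff[of "p - q" n "p' - q'"] by (simp add: algebra_simps)

lemma gl_cong_sum: "(\<And>a. a \<in> A \<Longrightarrow> gl_cong n (f a) (g a)) \<Longrightarrow> gl_cong n (sum f A) (sum g A)"
  unfolding gl_cong_def by (simp add: gl_ideal_sum flip: sum_subtractf)

lemma gl_cong_mult_left: "gl_cong n p q \<Longrightarrow> u \<in> gl_free n \<Longrightarrow> gl_cong n (u * p) (u * q)"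
  unfolding gl_cong_def by (simp add: gl_ideal_mult_left flip: right_diff_distrib)

lemma gl_cong_mult_right: "gl_cong n p q \<Longrightarrow> u \<in> gl_free n \<Longrightarrow> gl_cong n (p * u) (q * u)"
  unfolding gl_cong_def by (simp add: gl_ideal_mult_right flip: left_diff_distrib)

lemma gl_cong_commutator:
  assumes "i \<in> {1..n}" "j \<in> {1..n}" "k \<in> {1..n}" "l \<in> {1..n}"
  shows "gl_cong n (nc_gen (i, j) * nc_gen (k, l)) (nc_gen (k, l) * nc_gen (i, j) + gl_comm i j k l)"
  using gl_rel_ideal[OF assms] by (simp add: gl_cong_def gl_rel_def algebra_simps)

section \<open>Powers of the matrix of generators\<close>

primrec E_pow :: "nat \<Rightarrow> nat \<Rightarrow> nat \<Rightarrow> nat \<Rightarrow> (nat \<times> nat) ncpoly" where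
  "E_pow n 0 i j = (if i = j then 1 else 0)"
| "E_pow n (Suc m) i j = (\<Sum>k = 1..n. E_pow n m i k * nc_gen (k, j))"

definition casR :: "nat \<Rightarrow> nat \<Rightarrow> (nat \<times> nat) ncpoly" where
  "casR n m = (\<Sum>i = 1..n. E_pow n m i i)"

lemma E_pow_free [simp]: "i \<in> {1..n} \<Longrightarrow> j \<in> {1..n} \<Longrightarrow> E_pow n m i j \<in> gl_free n"
  by (induction m arbitrary: j) (auto intro!: gl_free_sum gl_free_mult)

lemma casR_free [simp]: "casR n m \<in> gl_free n"
  unfolding casR_def by (intro gl_free_sum) simp

text \<open>Under commutators with generators, the entries of E^m behave like those of E. In the
  induction step the commutators with (E^m)_ck and with E_kd both produce (E^m)_cb E_ad, with
  opposite signs.\<close>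

lemma E_pow_commutator:
  assumes "a \<in> {1..n}" "b \<in> {1..n}" "c \<in> {1..n}" "d \<in> {1..n}"
  shows "gl_cong n (nc_gen (a, b) * E_pow n m c d)
    (E_pow n m c d * nc_gen (a, b)
      + ((if b = c then E_pow n m a d else 0) - (if a = d then E_pow n m c b else 0)))"
  using assms(4)
proof (induction m arbitrary: d)
  case 0
  show ?case by simp
next
  case (Suc m)
  let ?g = "nc_gen (a, b)" and ?X = "E_pow n m"
  have X: "?X c k \<in> gl_free n" if "k \<in> {1..n}" for k using that assms by simp
  have "gl_cong n (\<Sum>k = 1..n. ?g * ?X c k * nc_gen (k, d))
      (\<Sum>k = 1..n. (?X c k * ?g + ((if b = c then ?X a k else 0) - (if a = k then ?X c b else 0))) * nc_gen (k, d))"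
    by (intro gl_cong_sum gl_cong_mult_right Suc.IH) (use assms Suc.prems in auto)
  also have "\<dots> = (\<Sum>k = 1..n. ?X c k * (?g * nc_gen (k, d))) +
     ((if b = c then E_pow n (Suc m) a d else 0) - ?X c b * nc_gen (a, d))"
  proof -
    have "(\<Sum>k = 1..n. (if a = k then ?X c b else 0) * nc_gen (k, d)) = (\<Sum>k = 1..n. if a = k then ?X c b * nc_gen (a, d) else 0)"
      by (intro sum.cong) auto
    also have "\<dots> = ?X c b * nc_gen (a, d)" using assms by simp
    finally show ?thesis
      by (auto simp: distrib_right left_diff_distrib sum.distrib sum_subtractf mult.assoc)
  qed
  also have "gl_cong n \<dots> ((\<Sum>k = 1..n. ?X c k * (nc_gen (k, d) * ?g + gl_comm a b k d)) +
     ((if b = c then E_pow n (Suc m) a d else 0) - ?X c b * nc_gen (a, d)))"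
    by (intro gl_cong_add gl_cong_sum gl_cong_mult_left gl_cong_refl gl_cong_commutator) (use assms Suc.prems X in auto)
  also have "(\<Sum>k = 1..n. ?X c k * (nc_gen (k, d) * ?g + gl_comm a b k d))
     = E_pow n (Suc m) c d * ?g + (?X c b * nc_gen (a, d) - (if a = d then E_pow n (Suc m) c b else 0))"
  proof -
    have "(\<Sum>k = 1..n. ?X c k * (if b = k then nc_gen (a, d) else 0)) = (\<Sum>k = 1..n. if b = k then ?X c b * nc_gen (a, d) else 0)"
      by (intro sum.cong) auto
    also have "\<dots> = ?X c b * nc_gen (a, d)" using assms by simp
    finally show ?thesis
      by (auto simp: gl_comm_def distrib_left right_diff_distrib sum.distrib sum_subtractf sum_distrib_right mult.assoc)
  qed
  finally show ?case by (simp add: sum_distrib_left mult.assoc algebra_simps)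
qed

context hw_functional
begin

lemma phi_0 [simp]: "phi 0 = 0"
  using phi_add[of 0 0] by simp

lemma phi_diff: "phi (p - q) = phi p - phi q"
  using phi_add[of "p - q" q] by simp

lemma phi_sum: "phi (sum f A) = (\<Sum>a\<in>A. phi (f a))"
  by (induction A rule: infinite_finite_induct) (simp_all add: phi_add)

text \<open>\<open>phi_rel\<close> speaks of the generators of the ideal. The elements of the free
  algebra that \<open>phi\<close> kills between any two factors form an ideal containing them, so
  minimality of the generated ideal applies.\<close>

lemma phi_gl_ideal: "phi (p * x * q) = 0" if "x \<in> gl_ideal n"
proof -
  interpret R: ring "free_alg (gl_gens n)" by (rule ring_free_alg)
  let ?J = "{x \<in> gl_free n. \<forall>p q. phi (p * x * q) = 0}"
  have "ideal ?J (free_alg (gl_gens n))"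
  proof (rule idealI[OF ring_free_alg])
    show "subgroup ?J (add_monoid (free_alg (gl_gens n)))"
    proof (rule R.add.subgroupI)
      show "?J \<noteq> {}" by (auto intro: exI[of _ 0])
      fix a assume "a \<in> ?J"
      then show "\<ominus>\<^bsub>free_alg (gl_gens n)\<^esub> a \<in> ?J"
        using phi_diff[of 0] by (auto simp: gl_free_a_inv)
    qed (auto simp: distrib_left distrib_right phi_add)
    fix a x assume "a \<in> ?J" "x \<in> gl_free n"
    then show "monoid.mult (free_alg (gl_gens n)) x a \<in> ?J" "monoid.mult (free_alg (gl_gens n)) a x \<in> ?J"
      by (auto simp flip: mult.assoc) (simp add: mult.assoc)
  qed
  moreover have "gl_rels n \<subseteq> ?J"
  proof
    fix x assume x: "x \<in> gl_rels n"
    then obtain i j k l where "x = gl_rel i j k l" unfolding gl_rels_eq by blast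
    then show "x \<in> ?J" using x gl_rels_free phi_rel by blast
  qed
  ultimately have "gl_ideal n \<subseteq> ?J"
    unfolding gl_ideal_def by (rule R.genideal_minimal)
  then show ?thesis using that by blast
qed

lemma phi_cong: "gl_cong n p q \<Longrightarrow> phi (u * p * v) = phi (u * q * v)"
  using phi_gl_ideal[of "p - q" u v] by (simp add: gl_cong_def right_diff_distrib left_diff_distrib phi_diff)

lemma phi_cong': "gl_cong n p q \<Longrightarrow> phi p = phi q"
  using phi_cong[of p q 1 1] by simp

end

section \<open>Eigenvalues of the Casimir elements\<close>

text \<open>The scalar by which (E^m)_ii acts on a highest weight vector. In the sum of (E^m)_ik
  E_ki over k, the terms with k < i vanish, k = i gives lam_i, and each of the n - i values k > i
  contributes, through a commutator, the difference of the i-th and k-th scalars.\<close>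

primrec cas_y :: "nat \<Rightarrow> (nat \<Rightarrow> complex) \<Rightarrow> nat \<Rightarrow> nat \<Rightarrow> complex" where
  "cas_y n lam 0 i = 1"
| "cas_y n lam (Suc m) i = (lam i + of_nat (n - i)) * cas_y n lam m i - (\<Sum>k\<in>{i<..n}. cas_y n lam m k)"

definition cas_val :: "nat \<Rightarrow> (nat \<Rightarrow> complex) \<Rightarrow> nat \<Rightarrow> complex" where
  "cas_val n lam m = (\<Sum>i = 1..n. cas_y n lam m i)"

context hw_functional
begin

lemma phi_E_pow:
  assumes "1 \<le> i" "i \<le> j" "j \<le> n"
  shows "phi (p * E_pow n m i j) = (if i = j then cas_y n lam m i * phi p else 0)"
  using assms
proof (induction m arbitrary: p i j)
  case 0
  then show ?case by simp
next
  case (Suc m)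
  let ?X = "E_pow n m"
  \<comment> \<open>Moving E_kj to the left puts (E^m)_ik at the right end, where it kills the
    highest weight vector by induction, as i < k. Only the commutator is left.\<close>
  have gt: "phi (p * (?X i k * nc_gen (k, j))) = (if i = j then cas_y n lam m i * phi p - cas_y n lam m k * phi p else 0)"
    if k: "k \<in> {j<..n}" for k
  proof -
    have "gl_cong n (nc_gen (k, j) * ?X i k) (?X i k * nc_gen (k, j) + ((if j = i then ?X k k else 0) - ?X i j))"
      using E_pow_commutator[of k n j i k m] k Suc.prems by simp
    from phi_cong[OF this, of p 1]
    have "phi (p * (?X i k * nc_gen (k, j))) = phi (p * nc_gen (k, j) * ?X i k) - (if j = i then phi (p * ?X k k) else 0) + phi (p * ?X i j)"
      by (auto simp: distrib_left right_diff_distrib phi_add phi_diff mult.assoc)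
    then show ?thesis using k Suc.prems by (simp add: Suc.IH)
  qed
  have lt: "phi (p * (?X i k * nc_gen (k, j))) = 0" if "k \<in> {1..<j}" for k
    using phi_upper[of k j "p * ?X i k"] that Suc.prems by (simp add: mult.assoc)
  have eq: "phi (p * (?X i j * nc_gen (j, j))) = (if i = j then lam i * cas_y n lam m i * phi p else 0)"
    using phi_diag[of j "p * ?X i j"] Suc.prems by (simp add: mult.assoc Suc.IH)
  have split: "{1..n} = {1..<j} \<union> ({j} \<union> {j<..n})" using Suc.prems by auto
  have "phi (p * E_pow n (Suc m) i j) = (\<Sum>k = 1..n. phi (p * (?X i k * nc_gen (k, j))))"
    by (simp add: sum_distrib_left phi_sum)
  also have "\<dots> = (\<Sum>k\<in>{1..<j}. phi (p * (?X i k * nc_gen (k, j)))) + (phi (p * (?X i j * nc_gen (j, j)))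
      + (\<Sum>k\<in>{j<..n}. phi (p * (?X i k * nc_gen (k, j)))))"
    unfolding split by (subst sum.union_disjoint; (subst sum.union_disjoint)?) auto
  also have "\<dots> = (if i = j then cas_y n lam (Suc m) i * phi p else 0)"
    using Suc.prems by (simp add: lt eq gt sum_subtractf flip: sum_distrib_right) (simp add: algebra_simps)
  finally show ?case .
qed

lemma phi_casR: "phi (p * casR n m) = cas_val n lam m * phi p"
  by (simp add: casR_def cas_val_def sum_distrib_left sum_distrib_right phi_sum phi_E_pow)

lemma phi_casR_power: "phi (p * casR n m ^ k) = cas_val n lam m ^ k * phi p"
  by (induction k arbitrary: p) (simp_all add: phi_casR power_Suc2 del: power_Suc flip: mult.assoc)

end

text \<open>Serves both alphabets: polynomials in the C_m are evaluated at Casimir eigenvalues,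
  polynomials in the S_m at complete homogeneous values.\<close>

definition ev :: "complex \<Rightarrow> (nat \<Rightarrow> complex) \<Rightarrow> gl_poly \<Rightarrow> complex" where
  "ev z s p = (\<Sum>\<mu>\<in>Poly_Mapping.keys p. poly (Poly_Mapping.lookup p \<mu>) z *
     (\<Prod>i\<in>Poly_Mapping.keys \<mu>. s (i + 1) ^ Poly_Mapping.lookup \<mu> i))"

definition cas_mon :: "nat \<Rightarrow> (nat \<Rightarrow>\<^sub>0 nat) \<Rightarrow> (nat \<times> nat) ncpoly" where
  "cas_mon n \<mu> = prod_list (map (\<lambda>i. casR n (i + 1) ^ Poly_Mapping.lookup \<mu> i) (sorted_list_of_set (Poly_Mapping.keys \<mu>)))"

definition csR :: "nat \<Rightarrow> gl_poly \<Rightarrow> (nat \<times> nat) ncpoly" where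
  "csR n p = (\<Sum>\<mu>\<in>Poly_Mapping.keys p. nc_const (poly (Poly_Mapping.lookup p \<mu>) (of_nat n)) * cas_mon n \<mu>)"

lemma cas_mon_free [simp]: "cas_mon n \<mu> \<in> gl_free n"
  unfolding cas_mon_def by (rule gl_free_prod_list) (auto intro!: gl_free_power simp del: One_nat_def)

lemma csR_free [simp]: "csR n p \<in> gl_free n"
  unfolding csR_def by (intro gl_free_sum gl_free_mult) simp_all

definition wR :: "nat \<Rightarrow> nat \<Rightarrow> (nat \<Rightarrow> nat) \<Rightarrow> (nat \<times> nat) ncpoly" where
  "wR n m \<alpha> = (\<Sum>i\<in>{1..m} \<rightarrow>\<^sub>E {1..n}. prod_list (map (\<lambda>k. nc_gen (i k, i (\<alpha> k))) [1..<Suc m]))"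

lemma wR_free: "\<alpha> permutes {1..m} \<Longrightarrow> wR n m \<alpha> \<in> gl_free n"
  unfolding wR_def
proof (intro gl_free_sum gl_free_prod_list)
  fix i x assume a: "\<alpha> permutes {1..m}" and i: "i \<in> {1..m} \<rightarrow>\<^sub>E {1..n}"
    and x: "x \<in> set (map (\<lambda>k. nc_gen (i k, i (\<alpha> k))) [1..<Suc m])"
  from x obtain k where "k \<in> set [1..<Suc m]" and xk: "x = nc_gen (i k, i (\<alpha> k))" by auto
  then have k: "k \<in> {1..m}" by (simp only: set_upt) auto
  moreover have "\<alpha> k \<in> {1..m}" using permutes_in_image[OF a] k by simp
  ultimately show "x \<in> gl_free n" unfolding xk using i by (auto simp: PiE_iff simp del: atLeastAtMost_iff)
qed

lemma (in hw_functional) phi_csR: "phi (csR n p) = ev (of_nat n) (cas_val n lam) p"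
proof -
  have list: "phi (u * prod_list (map (\<lambda>i. casR n (f i) ^ e i) xs)) = prod_list (map (\<lambda>i. cas_val n lam (f i) ^ e i) xs) * phi u" for u f e and xs :: "nat list"
    by (induction xs arbitrary: u) (simp_all add: phi_casR_power flip: mult.assoc)
  have "phi (nc_const c * cas_mon n \<mu>) = c * (\<Prod>i\<in>Poly_Mapping.keys \<mu>. cas_val n lam (i + 1) ^ Poly_Mapping.lookup \<mu> i)" for c \<mu>
  proof -
    have "phi (nc_const c) = c" using phi_const[of c 1] by (simp add: phi_1)
    moreover have "prod_list (map f (sorted_list_of_set (Poly_Mapping.keys \<mu>))) = prod f (Poly_Mapping.keys \<mu>)" for f :: "nat \<Rightarrow> complex"
      by (subst prod.distinct_set_conv_list[symmetric]) simp_all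
    ultimately show ?thesis by (simp add: cas_mon_def list)
  qed
  then show ?thesis by (simp add: csR_def ev_def phi_sum)
qed

section \<open>Passing from the quotient ring to representatives\<close>

lemma U_class_hom: "U_class n \<in> ring_hom (free_alg (gl_gens n)) (U_gl n)"
  using ideal.rcos_ring_hom[OF ideal_gl_ideal, of n] unfolding U_gl_def by (simp add: U_class_def[abs_def])

lemma U_class_mult: "p \<in> gl_free n \<Longrightarrow> q \<in> gl_free n \<Longrightarrow> U_class n (p * q) = monoid.mult (U_gl n) (U_class n p) (U_class n q)"
  using ring_hom_mult[OF U_class_hom, of p n q] by simp

lemma U_class_add: "p \<in> gl_free n \<Longrightarrow> q \<in> gl_free n \<Longrightarrow> U_class n (p + q) = add (U_gl n) (U_class n p) (U_class n q)"
  using ring_hom_add[OF U_class_hom, of p n q] by simp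

lemma U_class_1: "U_class n 1 = one (U_gl n)"
  using ring_hom_one[OF U_class_hom, of n] by simp

lemma U_class_carrier: "p \<in> gl_free n \<Longrightarrow> U_class n p \<in> carrier (U_gl n)"
  using ring_hom_closed[OF U_class_hom] .

lemma U_class_0: "U_class n 0 = ring.zero (U_gl n)"
  using ring_hom_zero[OF U_class_hom ring_free_alg ring_U_gl, of n] by simp

lemma U_class_sum:
  assumes "finite A" "\<And>a. a \<in> A \<Longrightarrow> f a \<in> gl_free n"
  shows "U_class n (sum f A) = finsum (U_gl n) (\<lambda>a. U_class n (f a)) A"
  using assms
proof (induction A rule: finite_induct)
  case empty
  interpret ring "U_gl n" by (rule ring_U_gl)
  show ?case by (simp add: U_class_0)
next
  case (insert a A)
  interpret ring "U_gl n" by (rule ring_U_gl)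
  have "(\<lambda>a. U_class n (f a)) \<in> A \<rightarrow> carrier (U_gl n)" using insert by (auto intro: U_class_carrier)
  then show ?case using insert by (simp add: finsum_insert U_class_add U_class_carrier gl_free_sum)
qed

lemma finsum_eq_U_class:
  assumes "finite A" "\<And>a. a \<in> A \<Longrightarrow> f a \<in> gl_free n" "\<And>a. a \<in> A \<Longrightarrow> g a = U_class n (f a)"
  shows "finsum (U_gl n) g A = U_class n (sum f A)"
proof -
  interpret ring "U_gl n" by (rule ring_U_gl)
  have "finsum (U_gl n) g A = finsum (U_gl n) (\<lambda>a. U_class n (f a)) A"
    by (rule finsum_cong') (use assms in \<open>auto intro: U_class_carrier\<close>)
  then show ?thesis using U_class_sum[of A f n] assms by simp
qed

lemma list_mult_U_class:
  "(\<And>x. x \<in> set xs \<Longrightarrow> x \<in> gl_free n) \<Longrightarrow> list_mult (U_gl n) (map (U_class n) xs) = U_class n (prod_list xs)"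
  by (induction xs) (auto simp: list_mult_def U_class_1 U_class_mult gl_free_prod_list)

lemma U_class_power: "p \<in> gl_free n \<Longrightarrow> U_class n p [^]\<^bsub>U_gl n\<^esub> k = U_class n (p ^ k)"
proof (induction k)
  case 0
  then show ?case by (simp add: U_class_1 nat_pow_def)
next
  case (Suc k)
  then show ?case by (simp add: nat_pow_def U_class_mult gl_free_power power_Suc2 del: power_Suc)
qed

lemma gl_E_power_eq: "i \<in> {1..n} \<Longrightarrow> j \<in> {1..n} \<Longrightarrow> gl_E_power n m i j = U_class n (E_pow n m i j)"
proof (induction m arbitrary: j)
  case 0
  then show ?case by (simp add: U_class_1 U_class_0)
next
  case (Suc m)
  show ?case unfolding gl_E_power.simps E_pow.simps
    by (rule finsum_eq_U_class) (use Suc in \<open>auto simp: gl_E_def U_class_mult\<close>)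
qed

lemma casimir_eq: "casimir n m = U_class n (casR n m)"
  unfolding casimir_def casR_def by (rule finsum_eq_U_class) (auto simp: gl_E_power_eq)

lemma casimir_subst_eq: "casimir_subst n p = U_class n (csR n p)"
  unfolding casimir_subst_def csR_def
proof (rule finsum_eq_U_class)
  fix \<mu>
  have "map (\<lambda>i. casimir n (i + 1) [^]\<^bsub>U_gl n\<^esub> Poly_Mapping.lookup \<mu> i) (sorted_list_of_set (Poly_Mapping.keys \<mu>))
    = map (U_class n) (map (\<lambda>i. casR n (i + 1) ^ Poly_Mapping.lookup \<mu> i) (sorted_list_of_set (Poly_Mapping.keys \<mu>)))"
    by (simp add: casimir_eq U_class_power)
  then have "list_mult (U_gl n) (map (\<lambda>i. casimir n (i + 1) [^]\<^bsub>U_gl n\<^esub> Poly_Mapping.lookup \<mu> i) (sorted_list_of_set (Poly_Mapping.keys \<mu>)))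
    = U_class n (cas_mon n \<mu>)"
    unfolding cas_mon_def by (simp only:) (rule list_mult_U_class, auto intro!: gl_free_power simp del: One_nat_def)
  then show "monoid.mult (U_gl n) (U_scalar n (poly (Poly_Mapping.lookup p \<mu>) (of_nat n)))
      (list_mult (U_gl n) (map (\<lambda>i. casimir n (i + 1) [^]\<^bsub>U_gl n\<^esub> Poly_Mapping.lookup \<mu> i) (sorted_list_of_set (Poly_Mapping.keys \<mu>))))
    = U_class n (nc_const (poly (Poly_Mapping.lookup p \<mu>) (of_nat n)) * cas_mon n \<mu>)"
    by (simp add: U_scalar_def U_class_mult)
qed auto

lemma w_glN_eq:
  assumes "\<alpha> permutes {1..m}"
  shows "w_glN n m \<alpha> = U_class n (wR n m \<alpha>)"
  unfolding w_glN_def wR_def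
proof (rule finsum_eq_U_class)
  show "finite ({1..m} \<rightarrow>\<^sub>E {1..n})" by (rule finite_PiE) auto
  fix i assume i: "i \<in> {1..m} \<rightarrow>\<^sub>E {1..n}"
  have k: "nc_gen (i k, i (\<alpha> k)) \<in> gl_free n" if "k \<in> {1..m}" for k
  proof -
    have "\<alpha> k \<in> {1..m}" using permutes_in_image[OF assms] that by simp
    then show ?thesis using i that by (intro gl_free_gen) (auto simp: PiE_iff simp del: atLeastAtMost_iff)
  qed
  then show "prod_list (map (\<lambda>k. nc_gen (i k, i (\<alpha> k))) [1..<Suc m]) \<in> gl_free n"
    by (intro gl_free_prod_list) auto
  have "list_mult (U_gl n) (map (U_class n) (map (\<lambda>k. nc_gen (i k, i (\<alpha> k))) [1..<Suc m]))
      = U_class n (prod_list (map (\<lambda>k. nc_gen (i k, i (\<alpha> k))) [1..<Suc m]))"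
    by (rule list_mult_U_class) (use k in auto)
  then show "list_mult (U_gl n) (map (\<lambda>k. gl_E n (i k) (i (\<alpha> k))) [1..<Suc m])
      = U_class n (prod_list (map (\<lambda>k. nc_gen (i k, i (\<alpha> k))) [1..<Suc m]))"
    by (simp add: gl_E_def comp_def)
qed

lemma U_class_eq_iff:
  assumes "p \<in> gl_free n" "q \<in> gl_free n"
  shows "U_class n p = U_class n q \<longleftrightarrow> gl_cong n p q"
proof -
  interpret ring "free_alg (gl_gens n)" by (rule ring_free_alg)
  have "p \<ominus>\<^bsub>free_alg (gl_gens n)\<^esub> q = p - q"
    using assms by (simp add: a_minus_def gl_free_a_inv)
  then show ?thesis
    using quotient_eq_iff_same_a_r_cos[OF ideal_gl_ideal assms] by (simp add: U_class_def gl_cong_def)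
qed

lemma nc_const_add: "nc_const (a + b) = nc_const a + nc_const b"
  by (simp add: nc_const_def single_add)

lemma nc_const_mult: "nc_const (a * b) = nc_const a * nc_const b"
  by (simp add: nc_const_def mult_single)

lemma nc_const_0 [simp]: "nc_const 0 = 0" by (simp add: nc_const_def)

lemma nc_const_of_nat: "nc_const (of_nat k) = of_nat k"
  by (simp add: nc_const_def)

text \<open>Isolates the index attached to the label \<open>a\<close>, so that a Kronecker delta in
  it can be summed out or two matrix entries sharing it can be multiplied.\<close>

lemma sum_PiE_split:
  fixes F :: "('a \<Rightarrow> 'b) \<Rightarrow> 'c::comm_monoid_add"
  assumes "a \<in> L"
  shows "(\<Sum>i\<in>L \<rightarrow>\<^sub>E S. F i) = (\<Sum>i\<in>(L - {a}) \<rightarrow>\<^sub>E S. \<Sum>x\<in>S. F (i(a := x)))"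
proof -
  let ?L = "L - {a}"
  have L: "L = insert a ?L" using assms by auto
  have inj: "inj_on (\<lambda>(y, g). g(a := y)) (S \<times> (?L \<rightarrow>\<^sub>E S))"
    by (rule inj_combinator) simp
  have "(\<Sum>i\<in>L \<rightarrow>\<^sub>E S. F i) = (\<Sum>(x, i)\<in>S \<times> (?L \<rightarrow>\<^sub>E S). F (i(a := x)))"
    by (subst L, subst PiE_insert_eq, subst sum.reindex[OF inj]) (simp add: case_prod_unfold)
  also have "\<dots> = (\<Sum>x\<in>S. \<Sum>i\<in>?L \<rightarrow>\<^sub>E S. F (i(a := x)))"
    by (simp add: sum.cartesian_product)
  also have "\<dots> = (\<Sum>i\<in>?L \<rightarrow>\<^sub>E S. \<Sum>x\<in>S. F (i(a := x)))" by (rule sum.swap)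
  finally show ?thesis .
qed

section \<open>The symmetrized products\<close>

definition E_shift :: "nat \<Rightarrow> nat \<Rightarrow> complex \<Rightarrow> (nat \<times> nat) ncpoly" where
  "E_shift i j c = nc_gen (i, j) - (if i = j then nc_const c else 0)"

text \<open>The labels form a list rather than the numbers 1, ..., m: the factors do not commute, so
  their order matters, and when one is dropped the others must keep their labels and shifts.\<close>

definition sym_prod :: "nat \<Rightarrow> nat list \<Rightarrow> (nat \<Rightarrow> complex) \<Rightarrow> (nat \<times> nat) ncpoly" where
  "sym_prod n ls c = (\<Sum>i\<in>set ls \<rightarrow>\<^sub>E {1..n}. \<Sum>\<alpha> | \<alpha> permutes set ls.
     prod_list (map (\<lambda>l. E_shift (i l) (i (\<alpha> l)) (c l)) ls))"

lemma nc_const_commute: "nc_const c * x = x * nc_const c"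
  by (induction x rule: poly_mapping_induct)
    (simp_all add: nc_const_def mult_single distrib_left distrib_right mult.commute)

text \<open>The source of the factor m + nu. The two factors at \<open>l\<close> differ by a
  constant times a Kronecker delta, and summing that delta removes the label.\<close>

lemma sym_prod_shift:
  assumes "distinct (u @ l # w)"
  shows "sym_prod n (u @ l # w) (c(l := a)) = sym_prod n (u @ l # w) (c(l := b))
    + nc_const ((b - a) * of_nat (n + length (u @ w))) * sym_prod n (u @ w) c"
proof -
  define S where "S = set (u @ w)"
  have l: "l \<notin> S" and set: "set (u @ l # w) = insert l S" and fin: "finite S"
    using assms by (auto simp: S_def)
  have card: "card S = length (u @ w)" unfolding S_def using assms by (intro distinct_card) auto
  define P where "P i \<alpha> xs = prod_list (map (\<lambda>x. E_shift (i x) (i (\<alpha> x)) (c x)) xs)" for i \<alpha> :: "nat \<Rightarrow> nat" and xs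
  define Q where "Q i \<alpha> = P i \<alpha> u * P i \<alpha> w" for i \<alpha>
  have diff: "prod_list (map (\<lambda>x. E_shift (i x) (i (\<alpha> x)) ((c(l := a)) x)) (u @ l # w))
      - prod_list (map (\<lambda>x. E_shift (i x) (i (\<alpha> x)) ((c(l := b)) x)) (u @ l # w))
    = (if i l = i (\<alpha> l) then nc_const (b - a) * Q i \<alpha> else 0)" for i \<alpha>
  proof -
    have "prod_list (map (\<lambda>x. E_shift (i x) (i (\<alpha> x)) ((c(l := a)) x)) (u @ l # w))
      = P i \<alpha> u * E_shift (i l) (i (\<alpha> l)) a * P i \<alpha> w" for a
    proof -
      have "map (\<lambda>x. E_shift (i x) (i (\<alpha> x)) ((c(l := a)) x)) xs = map (\<lambda>x. E_shift (i x) (i (\<alpha> x)) (c x)) xs"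
        if "l \<notin> set xs" for xs using that by auto
      note this[of u] this[of w]
      with assms show ?thesis by (simp add: P_def mult.assoc del: map_eq_conv fun_upd_apply) simp
    qed
    then have "prod_list (map (\<lambda>x. E_shift (i x) (i (\<alpha> x)) ((c(l := a)) x)) (u @ l # w))
        - prod_list (map (\<lambda>x. E_shift (i x) (i (\<alpha> x)) ((c(l := b)) x)) (u @ l # w))
      = P i \<alpha> u * (E_shift (i l) (i (\<alpha> l)) a - E_shift (i l) (i (\<alpha> l)) b) * P i \<alpha> w"
      by (simp add: left_diff_distrib right_diff_distrib)
    also have "E_shift (i l) (i (\<alpha> l)) a - E_shift (i l) (i (\<alpha> l)) b = (if i l = i (\<alpha> l) then nc_const (b - a) else 0)"
      by (simp add: E_shift_def nc_const_def single_diff)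
    also have "P i \<alpha> u * (if i l = i (\<alpha> l) then nc_const (b - a) else 0) * P i \<alpha> w = (if i l = i (\<alpha> l) then nc_const (b - a) * Q i \<alpha> else 0)"
      by (simp add: Q_def nc_const_commute mult.assoc)
    finally show ?thesis .
  qed
  \<comment> \<open>The composite of beta with the transposition (l s) sends l to s, and the
    preimage of s under beta to l. Once the indices at l and s are equal, the other factors cannot
    tell it from beta.\<close>
  have Q_upd: "Q (i(l := x)) (Transposition.transpose l s \<circ> \<beta>) = Q i \<beta>"
    if "\<beta> permutes S" "(i(l := x)) l = (i(l := x)) s" for i x s \<beta>
  proof -
    have "(i(l := x)) y = i y \<and> (i(l := x)) ((Transposition.transpose l s \<circ> \<beta>) y) = i (\<beta> y)" if "y \<in> S" for y
    proof -
      have "\<beta> y \<in> S" using permutes_in_image[OF \<open>\<beta> permutes S\<close>] that by simp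
      then have "\<beta> y \<noteq> l" using l by auto
      then show ?thesis using that l \<open>(i(l := x)) l = (i(l := x)) s\<close>
        by (auto simp: Transposition.transpose_def)
    qed
    then have "P (i(l := x)) (Transposition.transpose l s \<circ> \<beta>) xs = P i \<beta> xs" if "set xs \<subseteq> S" for xs
      unfolding P_def using that by (intro arg_cong[of _ _ prod_list] map_cong) (auto simp: subset_iff)
    then show ?thesis unfolding Q_def S_def by simp
  qed
  have "sym_prod n (u @ l # w) (c(l := a)) - sym_prod n (u @ l # w) (c(l := b))
    = (\<Sum>i\<in>insert l S \<rightarrow>\<^sub>E {1..n}. \<Sum>\<alpha> | \<alpha> permutes insert l S. if i l = i (\<alpha> l) then nc_const (b - a) * Q i \<alpha> else 0)"
    unfolding sym_prod_def set sum_subtractf[symmetric] diff ..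
  also have "\<dots> = (\<Sum>i\<in>insert l S \<rightarrow>\<^sub>E {1..n}. \<Sum>s\<in>insert l S. \<Sum>\<beta> | \<beta> permutes S.
     if i l = i s then nc_const (b - a) * Q i (Transposition.transpose l s \<circ> \<beta>) else 0)"
    using l fin by (intro sum.cong refl, subst sum_over_permutations_insert)
      (auto simp: permutes_not_in intro!: sum.cong)
  also have "\<dots> = (\<Sum>i\<in>S \<rightarrow>\<^sub>E {1..n}. \<Sum>x = 1..n. \<Sum>s\<in>insert l S. \<Sum>\<beta> | \<beta> permutes S.
     if x = (i(l := x)) s then nc_const (b - a) * Q i \<beta> else 0)"
  proof -
    have S: "insert l S - {l} = S" using l by auto
    have eq: "(if (i(l := x)) l = (i(l := x)) s then nc_const (b - a) * Q (i(l := x)) (Transposition.transpose l s \<circ> \<beta>) else 0)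
      = (if x = (i(l := x)) s then nc_const (b - a) * Q i \<beta> else 0)" if "\<beta> \<in> {\<beta>. \<beta> permutes S}" for i x s \<beta>
      using Q_upd[of \<beta> i x s] that by (cases "x = (i(l := x)) s") (simp_all del: fun_upd_apply add: fun_upd_same)
    show ?thesis
      by (subst sum_PiE_split[of l "insert l S"], simp, unfold S, intro sum.cong refl, erule eq)
  qed
  \<comment> \<open>For s = l the condition holds for every x, which gives n; each s in
    \<open>S\<close> forces x = i s, which gives 1.\<close>
  also have "\<dots> = (\<Sum>i\<in>S \<rightarrow>\<^sub>E {1..n}. of_nat (n + card S) * (\<Sum>\<beta> | \<beta> permutes S. nc_const (b - a) * Q i \<beta>))"
  proof (rule sum.cong[OF refl])
    fix i assume i: "i \<in> S \<rightarrow>\<^sub>E {1..n}"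
    define R where "R = (\<Sum>\<beta> | \<beta> permutes S. nc_const (b - a) * Q i \<beta>)"
    have "(\<Sum>x = 1..n. \<Sum>s\<in>insert l S. \<Sum>\<beta> | \<beta> permutes S. if x = (i(l := x)) s then nc_const (b - a) * Q i \<beta> else 0)
       = (\<Sum>x = 1..n. R + (\<Sum>s\<in>S. if x = i s then R else 0))"
    proof (rule sum.cong[OF refl])
      fix x
      have "(\<Sum>\<beta> | \<beta> permutes S. if x = (i(l := x)) s then nc_const (b - a) * Q i \<beta> else 0) = (if x = (i(l := x)) s then R else 0)" for s
        by (simp add: R_def)
      then show "(\<Sum>s\<in>insert l S. \<Sum>\<beta> | \<beta> permutes S. if x = (i(l := x)) s then nc_const (b - a) * Q i \<beta> else 0) = R + (\<Sum>s\<in>S. if x = i s then R else 0)"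
        using l fin by (simp del: fun_upd_apply) (auto intro!: sum.cong)
    qed
    also have "\<dots> = of_nat n * R + (\<Sum>s\<in>S. \<Sum>x = 1..n. if x = i s then R else 0)"
      by (simp add: sum.distrib sum.swap[of _ S])
    also have "(\<Sum>s\<in>S. \<Sum>x = 1..n. if x = i s then R else 0) = (\<Sum>s\<in>S. R)"
    proof (rule sum.cong[OF refl])
      fix s assume "s \<in> S"
      then have "i s \<in> {1..n}" using i by (auto simp: PiE_iff)
      then show "(\<Sum>x = 1..n. if x = i s then R else 0) = R" by simp
    qed
    finally show "(\<Sum>x = 1..n. \<Sum>s\<in>insert l S. \<Sum>\<beta> | \<beta> permutes S. if x = (i(l := x)) s then nc_const (b - a) * Q i \<beta> else 0)
      = of_nat (n + card S) * R"
      by (simp add: distrib_right)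
  qed
  also have "\<dots> = nc_const ((b - a) * of_nat (n + length (u @ w))) * sym_prod n (u @ w) c"
  proof -
    have "prod_list (map (\<lambda>x. E_shift (i x) (i (\<beta> x)) (c x)) (u @ w)) = Q i \<beta>" for i \<beta>
      by (simp add: Q_def P_def)
    then have "sym_prod n (u @ w) c = (\<Sum>i\<in>S \<rightarrow>\<^sub>E {1..n}. \<Sum>\<beta> | \<beta> permutes S. Q i \<beta>)"
      unfolding sym_prod_def S_def by simp
    moreover have "(nc_const ((b - a) * of_nat (n + card S)) :: (nat \<times> nat) ncpoly) = of_nat (n + card S) * nc_const (b - a)"
      by (simp only: nc_const_mult nc_const_of_nat mult.commute[of "b - a"])
    ultimately show ?thesis
      unfolding card[symmetric] by (simp only: sum_distrib_left mult.assoc)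
  qed
  finally show ?thesis by (simp add: algebra_simps)
qed

fun shifted_prod :: "nat \<Rightarrow> nat list \<Rightarrow> nat list \<Rightarrow> (nat \<times> nat) ncpoly" where
  "shifted_prod k (x # xs) (y # ys) = E_shift x y (of_nat k) * shifted_prod (Suc k) xs ys"
| "shifted_prod k _ _ = 1"

fun shifted_val :: "(nat \<Rightarrow> complex) \<Rightarrow> nat \<Rightarrow> nat list \<Rightarrow> complex" where
  "shifted_val lam k [] = 1"
| "shifted_val lam k (x # xs) = (lam x - of_nat k) * shifted_val lam (Suc k) xs"

lemma shifted_prod_append:
  "length xs = length ys \<Longrightarrow> shifted_prod k (xs @ us) (ys @ vs) = shifted_prod k xs ys * shifted_prod (k + length xs) us vs"
  by (induction xs ys arbitrary: k rule: list_induct2) (simp_all add: mult.assoc)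

lemma shifted_val_append:
  "shifted_val lam k (xs @ us) = shifted_val lam k xs * shifted_val lam (k + length xs) us"
  by (induction xs arbitrary: k) (simp_all add: mult.assoc)

text \<open>The reason for the increasing shifts: they make a product summed over all column
  permutations symmetric in the rows as well.\<close>

lemma E_shift_swap:
  "(E_shift x p (of_nat k) * E_shift y q (of_nat (Suc k)) + E_shift x q (of_nat k) * E_shift y p (of_nat (Suc k)))
    - (E_shift y p (of_nat k) * E_shift x q (of_nat (Suc k)) + E_shift y q (of_nat k) * E_shift x p (of_nat (Suc k)))
    = gl_rel x p y q + gl_rel x q y p"
proof -
  have c: "nc_const (of_nat (Suc k)) = 1 + nc_const (of_nat k)"
    unfolding nc_const_of_nat by simp
  have comm: "nc_const a * nc_gen z = nc_gen z * nc_const a" for a z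
    by (rule nc_const_commute)
  show ?thesis unfolding E_shift_def c gl_rel_def gl_comm_def
    by (cases "x = p"; cases "x = q"; cases "y = p"; cases "y = q")
      (simp_all only: if_True if_False simp_thms diff_0_right, simp_all add: algebra_simps comm)
qed

text \<open>Rows and columns are separated: the columns run through all arrangements of one index
  tuple and stay symmetrized while the rows \<open>xs\<close> are reordered.\<close>

definition row_sum :: "nat list \<Rightarrow> nat list \<Rightarrow> (nat \<Rightarrow> nat) \<Rightarrow> (nat \<times> nat) ncpoly" where
  "row_sum xs ls j = (\<Sum>\<alpha> | \<alpha> permutes set ls. shifted_prod 0 xs (map (j \<circ> \<alpha>) ls))"

lemma list_mset_eq_induct:
  fixes R :: "'a list \<Rightarrow> 'a list \<Rightarrow> bool"
  assumes "mset xs = mset ys" and refl: "\<And>xs. R xs xs"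
    and trans: "\<And>xs ys zs. R xs ys \<Longrightarrow> R ys zs \<Longrightarrow> R xs zs"
    and swap: "\<And>u x y w. R (u @ x # y # w) (u @ y # x # w)"
  shows "R xs ys"
proof -
  have move: "R (v @ u @ x # w) (v @ x # u @ w)" for u v x w
  proof (induction u arbitrary: w rule: rev_induct)
    case (snoc y u)
    show ?case using trans[OF swap[of "v @ u" y x w]] snoc.IH[of "y # w"] by simp
  qed (simp add: refl)
  have move': "R (v @ x # u @ w) (v @ u @ x # w)" for u v x w
  proof (induction u arbitrary: v)
    case (Cons y u)
    show ?case using trans[OF swap[of v x y "u @ w"]] Cons.IH[of "v @ [y]"] by simp
  qed (simp add: refl)
  have "R (v @ xs) (v @ ys)" for v
    using assms(1)
  proof (induction xs arbitrary: v ys)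
    case Nil
    then show ?case by (simp add: refl)
  next
    case (Cons x xs)
    then have "x \<in> set ys" by (metis list.set_intros(1) mset_eq_setD)
    then obtain u w where ys: "ys = u @ x # w" by (meson split_list)
    have "R ((v @ [x]) @ xs) ((v @ [x]) @ u @ w)" using Cons by (intro Cons.IH) (simp add: ys)
    then show ?case using trans[OF _ move'[of v x u w]] ys by simp
  qed
  from this[of "[]"] show ?thesis by simp
qed

context hw_functional
begin

lemma phi_const_right: "phi (p * nc_const c) = c * phi p"
  using phi_const[of c p] by (simp add: nc_const_commute)

text \<open>Pairing alpha with its composite with the transposition of two neighbouring labels gives
  both column orders at the two places, as \<open>E_shift_swap\<close> requires. Each row sum is
  then counted twice, which is harmless over the complex numbers.\<close>

lemma phi_row_sum_swap:
  assumes ls: "distinct ls" "length ls = length (u @ x # y # w)"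
  shows "phi (row_sum (u @ x # y # w) ls j) = phi (row_sum (u @ y # x # w) ls j)"
proof -
  define k where "k = length u"
  define lu lw where "lu = take k ls" and "lw = drop (Suc (Suc k)) ls"
  obtain l l' where split: "ls = lu @ l # l' # lw" and len: "length lu = length u"
  proof -
    have k: "Suc k < length ls" using ls by (simp add: k_def)
    then have "ls = lu @ ls ! k # ls ! Suc k # lw"
      unfolding lu_def lw_def by (metis Cons_nth_drop_Suc Suc_lessD append_take_drop_id)
    then show ?thesis using that k by (auto simp: lu_def k_def)
  qed
  define \<tau> where "\<tau> = Transposition.transpose l l'"
  have tau: "\<tau> permutes set ls" unfolding \<tau>_def split by (rule permutes_swap_id) auto
  have map1: "map (j \<circ> \<alpha>) ls = map (j \<circ> \<alpha>) lu @ j (\<alpha> l) # j (\<alpha> l') # map (j \<circ> \<alpha>) lw" for \<alpha>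
    by (simp add: split)
  have map2: "map (j \<circ> (\<alpha> \<circ> \<tau>)) ls = map (j \<circ> \<alpha>) lu @ j (\<alpha> l') # j (\<alpha> l) # map (j \<circ> \<alpha>) lw" for \<alpha>
    using ls(1) unfolding split \<tau>_def by (auto simp: Transposition.transpose_def)
  have double: "row_sum xs ls j + row_sum xs ls j = (\<Sum>\<alpha> | \<alpha> permutes set ls.
      shifted_prod 0 xs (map (j \<circ> \<alpha>) ls) + shifted_prod 0 xs (map (j \<circ> (\<alpha> \<circ> \<tau>)) ls))" for xs
  proof -
    have "row_sum xs ls j = (\<Sum>\<alpha> | \<alpha> permutes set ls. shifted_prod 0 xs (map (j \<circ> (\<alpha> \<circ> \<tau>)) ls))"
      unfolding row_sum_def by (rule sum_permutations_compose_right[OF tau])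
    then show ?thesis by (simp add: sum.distrib row_sum_def)
  qed
  have "phi (row_sum (u @ x # y # w) ls j + row_sum (u @ x # y # w) ls j)
      - phi (row_sum (u @ y # x # w) ls j + row_sum (u @ y # x # w) ls j) = 0"
    unfolding double phi_diff[symmetric] sum_subtractf[symmetric] phi_sum
  proof (rule sum.neutral, rule ballI)
    fix \<alpha>
    let ?P = "shifted_prod 0 u (map (j \<circ> \<alpha>) lu)" and ?Q = "shifted_prod (Suc (Suc (length u))) w (map (j \<circ> \<alpha>) lw)"
    let ?p = "j (\<alpha> l)" and ?q = "j (\<alpha> l')" and ?k = "length u"
    let ?S = "\<lambda>x y. E_shift x ?p (of_nat ?k) * E_shift y ?q (of_nat (Suc ?k)) + E_shift x ?q (of_nat ?k) * E_shift y ?p (of_nat (Suc ?k))"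
    have "shifted_prod 0 (u @ x # y # w) (map (j \<circ> \<alpha>) ls) + shifted_prod 0 (u @ x # y # w) (map (j \<circ> (\<alpha> \<circ> \<tau>)) ls)
       = ?P * ?S x y * ?Q" for x y
      unfolding map1[of \<alpha>] map2[of \<alpha>] using len by (simp add: shifted_prod_append distrib_left distrib_right mult.assoc del: of_nat_Suc)
    then have "phi (shifted_prod 0 (u @ x # y # w) (map (j \<circ> \<alpha>) ls) + shifted_prod 0 (u @ x # y # w) (map (j \<circ> (\<alpha> \<circ> \<tau>)) ls)
       - (shifted_prod 0 (u @ y # x # w) (map (j \<circ> \<alpha>) ls) + shifted_prod 0 (u @ y # x # w) (map (j \<circ> (\<alpha> \<circ> \<tau>)) ls)))
      = phi (?P * (?S x y - ?S y x) * ?Q)"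
      by (simp only: left_diff_distrib right_diff_distrib)
    also have "\<dots> = phi (?P * (gl_rel x ?p y ?q + gl_rel x ?q y ?p) * ?Q)"
      by (simp only: E_shift_swap)
    also have "\<dots> = 0" by (simp add: distrib_left distrib_right phi_add phi_rel)
    finally show "phi (shifted_prod 0 (u @ x # y # w) (map (j \<circ> \<alpha>) ls) + shifted_prod 0 (u @ x # y # w) (map (j \<circ> (\<alpha> \<circ> \<tau>)) ls)
       - (shifted_prod 0 (u @ y # x # w) (map (j \<circ> \<alpha>) ls) + shifted_prod 0 (u @ y # x # w) (map (j \<circ> (\<alpha> \<circ> \<tau>)) ls))) = 0" .
  qed
  then show ?thesis by (simp add: phi_add)
qed

lemma phi_row_sum_mset:
  assumes "mset xs = mset ys" "distinct ls" "length ls = length xs"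
  shows "phi (row_sum xs ls j) = phi (row_sum ys ls j)"
proof -
  have "length xs = length ls \<longrightarrow> length ys = length ls \<and> phi (row_sum xs ls j) = phi (row_sum ys ls j)"
    using assms(1) by (rule list_mset_eq_induct) (use phi_row_sum_swap[OF assms(2)] in auto)
  then show ?thesis using assms by simp
qed

text \<open>With decreasing rows the last row index x is the smallest. The last column y is one of
  the same indices, so x <= y: either E_xy raises and kills the highest weight vector, or x = y and
  the factor acts by a scalar. The preceding factor is then the last one.\<close>

lemma phi_shifted_prod:
  assumes "mset xs = mset ys" "set xs \<subseteq> {1..n}" "sorted_wrt (\<ge>) xs"
  shows "phi (p * shifted_prod k xs ys) = (if xs = ys then shifted_val lam k xs * phi p else 0)"
  using assms
proof (induction xs arbitrary: ys p rule: rev_induct)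
  case Nil
  then show ?case by simp
next
  case (snoc x xs)
  then obtain ys' y where ys: "ys = ys' @ [y]" by (cases ys rule: rev_cases) auto
  have len: "length xs = length ys'" using snoc.prems(1) mset_eq_length ys by fastforce
  have "y \<in> set (xs @ [x])" using snoc.prems(1) ys by (metis in_set_conv_decomp mset_eq_setD)
  then have y: "x \<le> y" "y \<in> {1..n}" "x \<in> {1..n}" using snoc.prems(2,3) by (auto simp: sorted_wrt_append)
  have "phi (p * shifted_prod k (xs @ [x]) ys) = phi (p * shifted_prod k xs ys' * E_shift x y (of_nat (k + length xs)))"
    unfolding ys shifted_prod_append[OF len] by (simp add: mult.assoc)
  also have "\<dots> = (if x = y then (lam x - of_nat (k + length xs)) * phi (p * shifted_prod k xs ys') else 0)"
    using y phi_upper[of x y] phi_diag[of x]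
    by (auto simp: E_shift_def right_diff_distrib phi_diff phi_const_right left_diff_distrib simp del: of_nat_add)
  also have "\<dots> = (if xs @ [x] = ys then shifted_val lam k (xs @ [x]) * phi p else 0)"
  proof (cases "x = y")
    case True
    then have "phi (p * shifted_prod k xs ys') = (if xs = ys' then shifted_val lam k xs * phi p else 0)"
      using snoc.prems ys by (intro snoc.IH) (auto simp: sorted_wrt_append)
    then show ?thesis using True ys by (simp add: shifted_val_append)
  qed (use ys in simp)
  finally show ?case .
qed

end

definition dec_lists :: "nat \<Rightarrow> nat \<Rightarrow> nat \<Rightarrow> nat list set" where
  "dec_lists r n m = {xs. length xs = m \<and> set xs \<subseteq> {r..n} \<and> sorted_wrt (\<ge>) xs}"

lemma finite_dec_lists [simp]: "finite (dec_lists r n m)"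
  by (rule finite_subset[OF _ finite_lists_length_eq[of "{r..n}" m]]) (auto simp: dec_lists_def)

text \<open>Shifted complete homogeneous polynomials. The head of the list has the smallest index,
  hence stands last in a decreasing tuple and carries the largest shift \<open>k\<close>.\<close>

fun shifted_h :: "complex list \<Rightarrow> nat \<Rightarrow> complex" where
  "shifted_h xs 0 = 1"
| "shifted_h [] (Suc k) = 0"
| "shifted_h (x # xs) (Suc k) = (x - of_nat k) * shifted_h (x # xs) k + shifted_h xs (Suc k)"

lemma dec_lists_Suc:
  assumes "r \<le> n"
  shows "dec_lists r n (Suc m) = (\<lambda>xs. xs @ [r]) ` dec_lists r n m \<union> dec_lists (Suc r) n (Suc m)"
proof (intro equalityI subsetI)
  fix xs assume xs: "xs \<in> dec_lists r n (Suc m)"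
  then obtain ys y where ys: "xs = ys @ [y]" by (cases xs rule: rev_cases) (auto simp: dec_lists_def)
  show "xs \<in> (\<lambda>xs. xs @ [r]) ` dec_lists r n m \<union> dec_lists (Suc r) n (Suc m)"
  proof (cases "y = r")
    case True
    then show ?thesis using xs ys by (auto simp: dec_lists_def sorted_wrt_append)
  next
    case False
    then have "Suc r \<le> y" using xs ys by (auto simp: dec_lists_def)
    then have "xs \<in> dec_lists (Suc r) n (Suc m)" using xs ys
      by (force simp: dec_lists_def sorted_wrt_append subset_iff)
    then show ?thesis by simp
  qed
next
  fix xs assume "xs \<in> (\<lambda>xs. xs @ [r]) ` dec_lists r n m \<union> dec_lists (Suc r) n (Suc m)"
  then show "xs \<in> dec_lists r n (Suc m)"
    using assms by (force simp: dec_lists_def sorted_wrt_append subset_iff)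
qed

lemma sum_dec_lists:
  "(\<Sum>xs\<in>dec_lists r n m. shifted_val lam 0 xs) = shifted_h (map lam [r..<Suc n]) m"
proof (induction "Suc n - r" arbitrary: r m)
  case 0
  then have r: "n < r" by simp
  then have "dec_lists r n m = (if m = 0 then {[]} else {})" by (auto simp: dec_lists_def)
  then show ?case using r by (cases m) auto
next
  case (Suc d)
  then have r: "r \<le> n" by simp
  have l: "[r..<Suc n] = r # [Suc r..<Suc n]" using r by (simp add: upt_rec)
  show ?case
  proof (induction m)
    case 0
    have "dec_lists r n 0 = {[]}" by (auto simp: dec_lists_def)
    then show ?case by simp
  next
    case (Suc m)
    have "(\<Sum>xs\<in>dec_lists r n (Suc m). shifted_val lam 0 xs)
      = (\<Sum>xs\<in>(\<lambda>xs. xs @ [r]) ` dec_lists r n m. shifted_val lam 0 xs) + (\<Sum>xs\<in>dec_lists (Suc r) n (Suc m). shifted_val lam 0 xs)"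
      unfolding dec_lists_Suc[OF r] by (rule sum.union_disjoint) (simp, simp, auto simp: dec_lists_def)
    also have "(\<Sum>xs\<in>(\<lambda>xs. xs @ [r]) ` dec_lists r n m. shifted_val lam 0 xs) = (\<Sum>xs\<in>dec_lists r n m. (lam r - of_nat m) * shifted_val lam 0 xs)"
      by (subst sum.reindex) (auto simp: inj_on_def shifted_val_append dec_lists_def intro!: sum.cong)
    also have "\<dots> = (lam r - of_nat m) * shifted_h (map lam [r..<Suc n]) m"
      by (simp only: Suc.IH flip: sum_distrib_left)
    also have "(\<Sum>xs\<in>dec_lists (Suc r) n (Suc m). shifted_val lam 0 xs) = shifted_h (map lam [Suc r..<Suc n]) (Suc m)"
      by (rule Suc.hyps) (use Suc.hyps(2) in simp)
    finally show ?case unfolding l by simp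
  qed
qed

context hw_functional
begin

lemma shifted_prod_map:
  "shifted_prod k (map f ls) (map g ls) = prod_list (map (\<lambda>p. E_shift (f (ls ! p)) (g (ls ! p)) (of_nat (k + p))) [0..<length ls])"
proof (induction ls arbitrary: k)
  case (Cons l ls)
  show ?case by (simp add: Cons upt_conv_Cons map_Suc_upt[symmetric] comp_def add_ac del: upt_Suc map_Suc_upt)
qed simp

text \<open>Once the rows are sorted, a term survives only if its columns are sorted as well, and it
  is then a product of scalars.\<close>

lemma phi_sym_prod_standard:
  assumes ls: "distinct ls" and c: "\<And>p. p < length ls \<Longrightarrow> c (ls ! p) = of_nat p"
  shows "phi (sym_prod n ls c) = fact (length ls) * shifted_h (map lam [1..<Suc n]) (length ls)"
proof -
  define S where "S = set ls"
  define sd where "sd i = rev (sort (map i ls))" for i :: "nat \<Rightarrow> nat"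
  have fin: "finite S" "finite {\<alpha>. \<alpha> permutes S}" by (auto simp: S_def finite_permutations)
  have "prod_list (map (\<lambda>l. E_shift (i l) (i (\<alpha> l)) (c l)) ls) = shifted_prod 0 (map i ls) (map (i \<circ> \<alpha>) ls)" for i \<alpha>
  proof -
    have "map (\<lambda>l. E_shift (i l) (i (\<alpha> l)) (c l)) ls = map (\<lambda>p. E_shift (i (ls ! p)) ((i \<circ> \<alpha>) (ls ! p)) (of_nat (0 + p))) [0..<length ls]"
      by (rule nth_equalityI) (simp_all add: c)
    then show ?thesis by (simp only: shifted_prod_map)
  qed
  then have "phi (sym_prod n ls c) = (\<Sum>i\<in>S \<rightarrow>\<^sub>E {1..n}. phi (row_sum (map i ls) ls i))"
    by (simp add: sym_prod_def row_sum_def phi_sum S_def)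
  also have "\<dots> = (\<Sum>i\<in>S \<rightarrow>\<^sub>E {1..n}. phi (row_sum (sd i) ls i))"
    by (intro sum.cong refl phi_row_sum_mset) (use ls in \<open>simp_all add: sd_def\<close>)
  also have "\<dots> = (\<Sum>i\<in>S \<rightarrow>\<^sub>E {1..n}. \<Sum>\<alpha> | \<alpha> permutes S.
      if map (i \<circ> \<alpha>) ls \<in> dec_lists 1 n (length ls) then shifted_val lam 0 (map (i \<circ> \<alpha>) ls) else 0)"
    unfolding row_sum_def phi_sum S_def[symmetric]
  proof (intro sum.cong refl)
    fix i \<alpha> assume i: "i \<in> S \<rightarrow>\<^sub>E {1..n}" and "\<alpha> \<in> {\<alpha>. \<alpha> permutes S}"
    then have al: "\<alpha> permutes S" by simp
    have ms: "mset (map (i \<circ> \<alpha>) ls) = mset (map i ls)"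
    proof -
      have "mset (map \<alpha> ls) = mset ls"
      proof (subst set_eq_iff_mset_eq_distinct[symmetric])
        show "distinct (map \<alpha> ls)" using ls inj_on_subset[OF permutes_inj[OF al] subset_UNIV] by (simp add: distinct_map)
        show "set (map \<alpha> ls) = set ls" using permutes_image[OF al] by (simp add: S_def)
      qed (rule ls)
      then have "image_mset i (mset (map \<alpha> ls)) = image_mset i (mset ls)" by simp
      then show ?thesis by (simp add: multiset.map_comp)
    qed
    have dec: "sorted_wrt (\<ge>) (sd i)" by (simp add: sd_def sorted_wrt_rev)
    have eq: "sd i = xs \<longleftrightarrow> sorted_wrt (\<ge>) xs" if "mset xs = mset (map i ls)" for xs
    proof
      assume "sorted_wrt (\<ge>) xs"
      then have "sorted (rev xs)" by (simp add: sorted_wrt_rev)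
      moreover have "mset (rev xs) = mset (map i ls)" using that by simp
      ultimately have "sort (map i ls) = rev xs" by (metis properties_for_sort)
      then show "sd i = xs" by (simp add: sd_def)
    qed (use dec in auto)
    have rng: "set (map i ls) \<subseteq> {1..n}" using i by (auto simp: S_def PiE_iff)
    then have rng2: "set (map (i \<circ> \<alpha>) ls) \<subseteq> {1..n}" using mset_eq_setD[OF ms] by simp
    have "phi (1 * shifted_prod 0 (sd i) (map (i \<circ> \<alpha>) ls)) = (if sd i = map (i \<circ> \<alpha>) ls then shifted_val lam 0 (sd i) * phi 1 else 0)"
      by (rule phi_shifted_prod) (use ms rng dec in \<open>simp_all add: sd_def\<close>)
    also have "\<dots> = (if map (i \<circ> \<alpha>) ls \<in> dec_lists 1 n (length ls) then shifted_val lam 0 (map (i \<circ> \<alpha>) ls) else 0)"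
      using eq[OF ms] rng2 by (auto simp: dec_lists_def phi_1)
    finally show "phi (shifted_prod 0 (sd i) (map (i \<circ> \<alpha>) ls)) = \<dots>" by simp
  qed
  also have "\<dots> = (\<Sum>\<alpha> | \<alpha> permutes S. \<Sum>i\<in>S \<rightarrow>\<^sub>E {1..n}.
      if map (i \<circ> \<alpha>) ls \<in> dec_lists 1 n (length ls) then shifted_val lam 0 (map (i \<circ> \<alpha>) ls) else 0)"
    by (rule sum.swap)
  \<comment> \<open>Composition with alpha permutes the index tuples, so every alpha contributes the
    same sum; this is where m! comes from.\<close>
  also have "\<dots> = (\<Sum>\<alpha> | \<alpha> permutes S. \<Sum>i\<in>S \<rightarrow>\<^sub>E {1..n}.
      if map i ls \<in> dec_lists 1 n (length ls) then shifted_val lam 0 (map i ls) else 0)"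
  proof (rule sum.cong[OF refl])
    fix \<alpha> assume "\<alpha> \<in> {\<alpha>. \<alpha> permutes S}"
    then have al: "\<alpha> permutes S" by simp
    have closed: "i \<circ> \<beta> \<in> S \<rightarrow>\<^sub>E {1..n}" if "i \<in> S \<rightarrow>\<^sub>E {1..n}" "\<beta> permutes S" for i \<beta>
    proof (rule PiE_I)
      fix x
      show "x \<in> S \<Longrightarrow> (i \<circ> \<beta>) x \<in> {1..n}"
        using that permutes_in_image[OF that(2), of x] by (auto simp: PiE_iff simp del: atLeastAtMost_iff)
      show "x \<notin> S \<Longrightarrow> (i \<circ> \<beta>) x = undefined"
        using that permutes_not_in[OF that(2), of x] by (auto simp: PiE_iff extensional_def)
    qed
    show "(\<Sum>i\<in>S \<rightarrow>\<^sub>E {1..n}. if map (i \<circ> \<alpha>) ls \<in> dec_lists 1 n (length ls) then shifted_val lam 0 (map (i \<circ> \<alpha>) ls) else 0)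
      = (\<Sum>i\<in>S \<rightarrow>\<^sub>E {1..n}. if map i ls \<in> dec_lists 1 n (length ls) then shifted_val lam 0 (map i ls) else 0)"
      by (rule sum.reindex_bij_witness[where i = "\<lambda>i. i \<circ> inv_into UNIV \<alpha>" and j = "\<lambda>i. i \<circ> \<alpha>"])
        (use closed al permutes_inv[OF al] permutes_inv_o[OF al] in \<open>auto simp del: map_map simp: comp_assoc\<close>)
  qed
  also have "\<dots> = fact (length ls) * (\<Sum>i\<in>S \<rightarrow>\<^sub>E {1..n}.
      if map i ls \<in> dec_lists 1 n (length ls) then shifted_val lam 0 (map i ls) else 0)"
    using card_permutations[of S "length ls"] distinct_card[OF ls] by (simp add: S_def)
  also have "(\<Sum>i\<in>S \<rightarrow>\<^sub>E {1..n}. if map i ls \<in> dec_lists 1 n (length ls) then shifted_val lam 0 (map i ls) else 0)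
     = (\<Sum>i\<in>{i \<in> S \<rightarrow>\<^sub>E {1..n}. map i ls \<in> dec_lists 1 n (length ls)}. shifted_val lam 0 (map i ls))"
    using fin by (intro sum.inter_filter[symmetric] finite_PiE) auto
  also have "\<dots> = (\<Sum>xs\<in>dec_lists 1 n (length ls). shifted_val lam 0 xs)"
  proof (rule sum.reindex_bij_betw, rule bij_betwI')
    fix i j assume ij: "i \<in> {i \<in> S \<rightarrow>\<^sub>E {1..n}. map i ls \<in> dec_lists 1 n (length ls)}" "j \<in> {i \<in> S \<rightarrow>\<^sub>E {1..n}. map i ls \<in> dec_lists 1 n (length ls)}"
    show "(map i ls = map j ls) = (i = j)"
    proof
      assume "map i ls = map j ls"
      then show "i = j" using ij by (intro PiE_ext[of i S "\<lambda>_. {1..n}" j]) (auto simp: S_def)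
    qed simp
  next
    fix xs assume xs: "xs \<in> dec_lists 1 n (length ls)"
    define i where "i x = (if x \<in> S then xs ! (THE p. p < length ls \<and> ls ! p = x) else undefined)" for x
    have nth: "i (ls ! p) = xs ! p" if "p < length ls" for p
    proof -
      have "(THE q. q < length ls \<and> ls ! q = ls ! p) = p"
        using that ls by (intro the_equality) (auto simp: nth_eq_iff_index_eq)
      then show ?thesis using that by (simp add: i_def S_def)
    qed
    have m: "map i ls = xs" using xs nth by (intro nth_equalityI) (auto simp: dec_lists_def)
    have "set (map i ls) \<subseteq> {1..n}" unfolding m using xs by (simp add: dec_lists_def)
    then have "i \<in> S \<rightarrow>\<^sub>E {1..n}" by (auto simp: PiE_iff extensional_def S_def i_def[of "_ :: nat"])
    then show "\<exists>i\<in>{i \<in> S \<rightarrow>\<^sub>E {1..n}. map i ls \<in> dec_lists 1 n (length ls)}. xs = map i ls"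
      using m xs by (intro bexI[of _ i]) auto
  qed simp
  finally show ?thesis by (simp add: sum_dec_lists)
qed

end

section \<open>From standard shifts to arbitrary ones\<close>

fun shift_op :: "complex list \<Rightarrow> complex fps \<Rightarrow> complex" where
  "shift_op [] G = fps_nth G 0"
| "shift_op (c # cs) G = shift_op cs (fps_deriv G - fps_const c * G)"

lemma shift_op_add: "shift_op cs (G + H) = shift_op cs G + shift_op cs H"
proof (induction cs arbitrary: G H)
  case (Cons c cs)
  have "fps_deriv (G + H) - fps_const c * (G + H) = (fps_deriv G - fps_const c * G) + (fps_deriv H - fps_const c * H)"
    by (simp add: algebra_simps)
  then show ?case by (simp only: shift_op.simps Cons)
qed simp

lemma shift_op_smult: "shift_op cs (fps_const a * G) = a * shift_op cs G"
proof (induction cs arbitrary: G)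
  case (Cons c cs)
  have "fps_deriv (fps_const a * G) - fps_const c * (fps_const a * G) = fps_const a * (fps_deriv G - fps_const c * G)"
    by (simp add: algebra_simps)
  then show ?case by (simp only: shift_op.simps Cons)
qed simp

text \<open>The counterpart of \<open>sym_prod_shift\<close> for the functional. The two rules
  differ by the factor n + length, which the factorial in \<open>phi_sym_prod\<close>
  absorbs.\<close>

lemma shift_op_shift: "shift_op (u @ a # w) G = shift_op (u @ b # w) G + (b - a) * shift_op (u @ w) G"
proof (induction u arbitrary: G)
  case Nil
  have "fps_deriv G - fps_const a * G = (fps_deriv G - fps_const b * G) + fps_const (b - a) * G"
    by (simp add: algebra_simps flip: fps_const_sub)
  then show ?case by (simp only: append_Nil shift_op.simps shift_op_add shift_op_smult)
qed simp

text \<open>For u = e^t - 1 the operator d/dt - k sends e^(kt) P(u) to e^((k+1)t) P'(u). Falling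
  factorials in d/dt thus become powers of d/du, which explains the substitution in
  \<open>avg_series\<close>.\<close>

lemma shift_op_falling:
  "shift_op (map of_nat [k..<k + m]) (fps_exp (of_nat k) * (P oo (fps_exp 1 - 1))) = fps_nth ((fps_deriv ^^ m) P) 0"
proof (induction m arbitrary: k P)
  case 0
  show ?case by simp
next
  case (Suc m)
  let ?u = "fps_exp 1 - 1 :: complex fps"
  have "fps_deriv (fps_exp (of_nat k) * (P oo ?u)) - fps_const (of_nat k) * (fps_exp (of_nat k) * (P oo ?u))
      = fps_exp (of_nat k) * fps_exp 1 * (fps_deriv P oo ?u)"
    by (simp add: fps_compose_deriv algebra_simps)
  also have "\<dots> = fps_exp (of_nat (Suc k)) * (fps_deriv P oo ?u)"
    by (simp add: fps_exp_add_mult mult.commute[of "fps_exp 1"])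
  finally show ?case
    using Suc.IH[of "Suc k" "fps_deriv P"]
    by (simp add: upt_conv_Cons funpow_Suc_right del: upt_Suc funpow.simps of_nat_Suc)
qed

text \<open>Up to the factor \<open>(m + \<nu>)!\<close>, the value on a symmetrized product with shifts \<open>c\<^sub>1, \<dots>, c\<^sub>m\<close> is a
  linear functional of the polynomial \<open>(X - c\<^sub>1) \<cdots> (X - c\<^sub>m)\<close>: here \<open>X\<close> acts as \<open>d/dt\<close> on the
  series \<open>avg_series\<close>, followed by evaluation at 0.\<close>

definition avg_series :: "nat \<Rightarrow> (nat \<Rightarrow> complex) \<Rightarrow> complex fps" where
  "avg_series n lam = Abs_fps (\<lambda>k. shifted_h (map lam [1..<Suc n]) k / fact (k + n - 1)) oo (fps_exp 1 - 1)"

lemma fps_nth_deriv_0: "fps_nth ((fps_deriv ^^ m) P) 0 = fact m * fps_nth P m" for P :: "complex fps"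
  using fps_0th_higher_deriv[of m P] by simp

text \<open>Both sides obey the same rule when one shift is changed, and they agree for the shifts
  0, ..., m - 1. The outer induction takes care of the shorter product in that rule.\<close>

lemma (in hw_functional) phi_sym_prod:
  assumes "n \<ge> 1" "distinct ls"
  shows "phi (sym_prod n ls c) = fact (length ls + n - 1) * shift_op (map c ls) (avg_series n lam)"
  using assms(2)
proof (induction "length ls" arbitrary: ls c rule: less_induct)
  case less
  \<comment> \<open>In the inner induction the shifts on \<open>w\<close> are already standard; a
    step replaces the shift of the last label of the remaining prefix by the position of that
    label.\<close>
  have "\<forall>c :: nat \<Rightarrow> complex. (\<forall>p<length w. c (w ! p) = of_nat (length u + p)) \<longrightarrow>
     phi (sym_prod n ls c) = fact (length ls + n - 1) * shift_op (map c ls) (avg_series n lam)"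
    if "ls = u @ w" for u w
    using that
  proof (induction u arbitrary: w rule: rev_induct)
    case Nil
    show ?case
    proof (intro allI impI)
      fix c :: "nat \<Rightarrow> complex" assume c: "\<forall>p<length w. c (w ! p) = of_nat (length ([] :: nat list) + p)"
      have "map c ls = map of_nat [0..<0 + length ls]"
        using c Nil by (intro nth_equalityI) auto
      then have "shift_op (map c ls) (avg_series n lam) = fact (length ls) * (shifted_h (map lam [1..<Suc n]) (length ls) / fact (length ls + n - 1))"
        using shift_op_falling[of 0 "length ls" "Abs_fps (\<lambda>k. shifted_h (map lam [1..<Suc n]) k / fact (k + n - 1))"]
        by (simp add: avg_series_def fps_nth_deriv_0 del: upt_Suc)
      then show "phi (sym_prod n ls c) = fact (length ls + n - 1) * shift_op (map c ls) (avg_series n lam)"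
        using phi_sym_prod_standard[OF less.prems, of c] c Nil by simp
    qed
  next
    case (snoc l u)
    show ?case
    proof (intro allI impI)
      fix c :: "nat \<Rightarrow> complex" assume c: "\<forall>p<length w. c (w ! p) = of_nat (length (u @ [l]) + p)"
      let ?k = "of_nat (length u) :: complex" and ?G = "avg_series n lam"
      have ls: "ls = u @ l # w" using snoc.prems by simp
      have d: "distinct (u @ l # w)" using less.prems ls by simp
      have c': "(c(l := ?k)) ((l # w) ! p) = of_nat (length u + p)" if "p < length (l # w)" for p
        using c d that by (cases p) auto
      have m: "map (c(l := x)) (u @ l # w) = map c u @ x # map c w" for x
        using d by auto
      have m': "map (c(l := x)) (u @ w) = map c u @ map c w" for x
        using d by auto
      have "phi (sym_prod n ls c) = phi (sym_prod n (u @ l # w) (c(l := c l)))" by (simp add: ls)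
      also have "\<dots> = phi (sym_prod n ls (c(l := ?k))) + (?k - c l) * of_nat (n + length (u @ w)) * phi (sym_prod n (u @ w) c)"
        unfolding sym_prod_shift[OF d, of n c "c l" ?k] by (simp add: ls phi_add phi_const)
      also have "phi (sym_prod n ls (c(l := ?k))) = fact (length ls + n - 1) * shift_op (map c u @ ?k # map c w) ?G"
      proof -
        have "phi (sym_prod n ls (c(l := ?k))) = fact (length ls + n - 1) * shift_op (map (c(l := ?k)) ls) ?G"
          by (rule snoc.IH[of "l # w", THEN spec, THEN mp]) (use ls c' in blast)+
        then show ?thesis using m[of ?k] by (simp only: ls)
      qed
      also have "phi (sym_prod n (u @ w) c) = fact (length (u @ w) + n - 1) * shift_op (map c u @ map c w) ?G"
        using less.hyps[of "u @ w" c] d ls by auto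
      \<comment> \<open>n + length (u @ w) is exactly the quotient of the two factorials, so the
        normalization by (m + n - 1)! makes the two rules agree.\<close>
      also have "(?k - c l) * of_nat (n + length (u @ w)) * (fact (length (u @ w) + n - 1) * shift_op (map c u @ map c w) ?G)
          = fact (length ls + n - 1) * ((?k - c l) * shift_op (map c u @ map c w) ?G)"
      proof -
        have "length ls + n - 1 = Suc (length (u @ w) + n - 1)" "n + length (u @ w) = Suc (length (u @ w) + n - 1)"
          using assms(1) ls by simp_all
        then show ?thesis by (simp only: fact_Suc) simp
      qed
      also have "fact (length ls + n - 1) * shift_op (map c u @ ?k # map c w) ?G + fact (length ls + n - 1) * ((?k - c l) * shift_op (map c u @ map c w) ?G)
        = fact (length ls + n - 1) * shift_op (map c ls) ?G"
        using shift_op_shift[of "map c u" "c l" "map c w" ?G ?k] by (simp add: ls distrib_left)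
      finally show "phi (sym_prod n ls c) = fact (length ls + n - 1) * shift_op (map c ls) ?G" .
    qed
  qed
  from this[of ls "[]"] show ?case by simp
qed

lemma shift_op_zeros: "shift_op (map (\<lambda>_. 0) ls) G = fact (length ls) * fps_nth G (length ls)"
proof -
  have "shift_op (map (\<lambda>_. 0) ls) G = fps_nth ((fps_deriv ^^ length ls) G) 0"
    by (induction ls arbitrary: G) (simp_all add: funpow_Suc_right del: funpow.simps)
  then show ?thesis by (simp add: fps_nth_deriv_0)
qed

lemma (in hw_functional) phi_sum_wR:
  assumes "n \<ge> 1"
  shows "phi (\<Sum>\<alpha> | \<alpha> permutes {1..m}. wR n m \<alpha>) = fact m * fact (m + n - 1) * fps_nth (avg_series n lam) m"
proof -
  have set: "set [1..<Suc m] = {1..m}" by auto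
  have "(\<Sum>\<alpha> | \<alpha> permutes {1..m}. wR n m \<alpha>) = sym_prod n [1..<Suc m] (\<lambda>_. 0)"
    unfolding sym_prod_def wR_def set E_shift_def by (subst sum.swap) (simp cong: if_cong)
  then show ?thesis
    using phi_sym_prod[OF assms, of "[1..<Suc m]" "\<lambda>_. 0"] by (simp add: shift_op_zeros del: upt_Suc)
qed

section \<open>Complete homogeneous polynomials and divided differences of the exponential\<close>

fun complete_h :: "complex list \<Rightarrow> nat \<Rightarrow> complex" where
  "complete_h xs 0 = 1"
| "complete_h [] (Suc k) = 0"
| "complete_h (x # xs) (Suc k) = x * complete_h (x # xs) k + complete_h xs (Suc k)"

text \<open>The divided difference of \<open>x \<mapsto> exp (x t)\<close> at the nodes \<open>xs\<close>, as a series in \<open>t\<close>.\<close>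

definition exp_dd :: "complex list \<Rightarrow> complex fps" where
  "exp_dd xs = fps_X ^ (length xs - 1) * Abs_fps (\<lambda>k. complete_h xs k / fact (k + (length xs - 1)))"

text \<open>For nonempty \<open>xs\<close>, the divided difference of the function sending x to (1 +
  u)^x at the nodes \<open>rho_shift xs\<close>, as a series in u;
  \<open>shifted_dd_compose_exp\<close> expresses this through u = e^t - 1.\<close>

definition shifted_dd :: "complex list \<Rightarrow> complex fps" where
  "shifted_dd xs = fps_X ^ (length xs - 1) * Abs_fps (\<lambda>k. shifted_h xs k / fact (k + (length xs - 1)))"

text \<open>Identities between divided differences are proved by this uniqueness: induction over the
  nodes makes the inhomogeneous terms equal.\<close>

lemma fps_linear_ODE_unique:
  fixes f g h :: "complex fps"
  assumes "fps_deriv f = fps_const c * f + h" "fps_deriv g = fps_const c * g + h"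
    and "fps_nth f 0 = fps_nth g 0"
  shows "f = g"
proof -
  have d: "fps_deriv (f - g) = fps_const c * (f - g)"
    using assms(1,2) by (simp add: algebra_simps)
  have "fps_nth (f - g) m = 0" for m
  proof (induction m)
    case (Suc m)
    have "of_nat (Suc m) * fps_nth (f - g) (Suc m) = c * fps_nth (f - g) m"
      using arg_cong[OF d, of "\<lambda>F. fps_nth F m"] by (simp add: algebra_simps)
    with Suc have "of_nat (Suc m) * fps_nth (f - g) (Suc m) = 0" by (simp only: mult_zero_right)
    then show ?case by (simp only: mult_eq_0_iff of_nat_eq_0_iff) simp
  qed (use assms(3) in simp)
  then show ?thesis by (simp add: fps_eq_iff)
qed

lemma fps_nth_X_power_mult_fact:
  "fps_nth (fps_X ^ d * Abs_fps (\<lambda>k. a k / fact (k + d))) m = (if m < d then 0 else a (m - d) / fact m)"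
  for a :: "nat \<Rightarrow> complex"
  by (simp add: fps_X_power_mult_nth)

lemma exp_dd_nth: "fps_nth (exp_dd xs) m = (if m < length xs - 1 then 0 else complete_h xs (m - (length xs - 1)) / fact m)"
  unfolding exp_dd_def by (rule fps_nth_X_power_mult_fact)

lemma shifted_dd_nth: "fps_nth (shifted_dd xs) m = (if m < length xs - 1 then 0 else shifted_h xs (m - (length xs - 1)) / fact m)"
  unfolding shifted_dd_def by (rule fps_nth_X_power_mult_fact)

lemma fps_nth_dd_0: "fps_nth (exp_dd xs) 0 = (if length xs \<le> 1 then 1 else 0)"
    "fps_nth (shifted_dd xs) 0 = (if length xs \<le> 1 then 1 else 0)"
  by (auto simp: exp_dd_nth shifted_dd_nth)

text \<open>d/dt multiplies e^(xt) by x, and the divided difference of x g(x) at several nodes is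
  the first node times that of g, plus the divided difference of g at the remaining nodes.\<close>

lemma exp_dd_deriv:
  "fps_deriv (exp_dd (x # xs)) = fps_const x * exp_dd (x # xs) + (if xs = [] then 0 else exp_dd xs)"
proof (rule fps_ext)
  fix m
  have f: "(of_nat (Suc m) :: complex) * (a / fact (Suc m)) = a / fact m" for a
    by (simp add: field_simps del: of_nat_Suc)
  show "fps_nth (fps_deriv (exp_dd (x # xs))) m = fps_nth (fps_const x * exp_dd (x # xs) + (if xs = [] then 0 else exp_dd xs)) m"
  proof (cases xs)
    case Nil
    then show ?thesis using f[of "x * complete_h [x] m"] by (simp add: exp_dd_nth del: of_nat_Suc fact_Suc)
  next
    case (Cons y ys)
    define d where "d = length ys"
    have len: "length xs = Suc d" by (simp add: Cons d_def)
    \<comment> \<open>The series for \<open>x # xs\<close> starts in degree d + 1, the one for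
      \<open>xs\<close> in degree d; the case m = d compares their leading coefficients.\<close>
    consider "m < d" | "m = d" | k where "m = Suc (d + k)"
      by (metis add_Suc_right less_iff_Suc_add linorder_cases)
    then show ?thesis
    proof cases
      case 2
      then show ?thesis using f[of 1] by (simp add: exp_dd_nth Cons d_def[symmetric] del: of_nat_Suc fact_Suc)
    next
      case (3 k)
      have "of_nat (Suc m) * fps_nth (exp_dd (x # xs)) (Suc m) = complete_h (x # xs) (Suc k) / fact m"
        unfolding f[symmetric] using 3 len by (simp add: exp_dd_nth del: complete_h.simps of_nat_Suc fact_Suc)
      moreover have "fps_nth (exp_dd (x # xs)) m = complete_h (x # xs) k / fact m"
        using 3 len by (simp add: exp_dd_nth)
      moreover have "fps_nth (exp_dd xs) m = complete_h xs (Suc k) / fact m"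
        using 3 len by (simp add: exp_dd_nth del: complete_h.simps)
      ultimately show ?thesis using 3 len Cons
        by (simp add: add_divide_distrib[symmetric] del: fact_Suc of_nat_Suc)
    qed (simp add: exp_dd_nth Cons d_def[symmetric])
  qed
qed

text \<open>The same rule for (1 + u) d/du, which multiplies (1 + u)^y by y; the first node is y = x
  + length xs.\<close>

lemma shifted_dd_deriv:
  "(1 + fps_X) * fps_deriv (shifted_dd (x # xs))
    = fps_const (x + of_nat (length xs)) * shifted_dd (x # xs) + (if xs = [] then 0 else shifted_dd xs)"
proof (rule fps_ext)
  fix m
  have f: "(of_nat (Suc m) :: complex) * (a / fact (Suc m)) = a / fact m" for a
    by (simp add: field_simps del: of_nat_Suc)
  have l: "fps_nth ((1 + fps_X) * fps_deriv F) m = of_nat (Suc m) * fps_nth F (Suc m) + of_nat m * fps_nth F m" for F :: "complex fps"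
    by (cases m) (simp_all add: distrib_right)
  show "fps_nth ((1 + fps_X) * fps_deriv (shifted_dd (x # xs))) m
    = fps_nth (fps_const (x + of_nat (length xs)) * shifted_dd (x # xs) + (if xs = [] then 0 else shifted_dd xs)) m"
  proof (cases xs)
    case Nil
    then show ?thesis unfolding l using f[of "(x - of_nat m) * shifted_h [x] m"]
      by (simp add: shifted_dd_nth del: of_nat_Suc fact_Suc) (simp add: left_diff_distrib diff_divide_distrib)
  next
    case (Cons y ys)
    define d where "d = length ys"
    have len: "length xs = Suc d" by (simp add: Cons d_def)
    consider "m < d" | "m = d" | k where "m = Suc (d + k)"
      by (metis add_Suc_right less_iff_Suc_add linorder_cases)
    then show ?thesis
    proof cases
      case (3 k)
      have "of_nat (Suc m) * fps_nth (shifted_dd (x # xs)) (Suc m) = shifted_h (x # xs) (Suc k) / fact m"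
        unfolding f[symmetric] using 3 len by (simp add: shifted_dd_nth del: shifted_h.simps of_nat_Suc fact_Suc)
      moreover have "fps_nth (shifted_dd (x # xs)) m = shifted_h (x # xs) k / fact m"
        using 3 len by (simp add: shifted_dd_nth)
      moreover have "fps_nth (shifted_dd xs) m = shifted_h xs (Suc k) / fact m"
        using 3 len by (simp add: shifted_dd_nth del: shifted_h.simps)
      ultimately show ?thesis unfolding l using 3 len Cons
        by (simp add: add_divide_distrib[symmetric] del: fact_Suc of_nat_Suc) (simp add: algebra_simps)
    next
      case 2
      then show ?thesis unfolding l using f[of 1]
        by (simp add: shifted_dd_nth Cons d_def[symmetric] del: of_nat_Suc fact_Suc)
    qed (simp add: l shifted_dd_nth Cons d_def[symmetric])
  qed
qed

text \<open>At the i-th of N entries the rest of the list has length N - i, so the weights lam_i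
  become lam_i + N - i.\<close>

fun rho_shift :: "complex list \<Rightarrow> complex list" where
  "rho_shift [] = []"
| "rho_shift (x # xs) = (x + of_nat (length xs)) # rho_shift xs"

lemma length_rho_shift [simp]: "length (rho_shift xs) = length xs"
  by (induction xs) simp_all

lemma rho_shift_eq_Nil [simp]: "rho_shift xs = [] \<longleftrightarrow> xs = []"
  by (cases xs) simp_all

lemma shifted_dd_compose_exp:
  "xs \<noteq> [] \<Longrightarrow> shifted_dd xs oo (fps_exp 1 - 1) = exp_dd (rho_shift xs)"
proof (induction xs)
  case (Cons x xs)
  let ?u = "fps_exp 1 - 1 :: complex fps"
  have u: "fps_nth ?u 0 = 0" by simp
  show ?case
  proof (rule fps_linear_ODE_unique)
    have "fps_deriv (shifted_dd (x # xs) oo ?u) = (fps_deriv (shifted_dd (x # xs)) oo ?u) * fps_exp 1"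
      by (simp add: fps_compose_deriv)
    also have "\<dots> = ((1 + fps_X) * fps_deriv (shifted_dd (x # xs))) oo ?u"
      by (simp add: fps_compose_mult_distrib[OF u] fps_compose_add_distrib mult.commute)
    also have "\<dots> = fps_const (x + of_nat (length xs)) * (shifted_dd (x # xs) oo ?u) + (if xs = [] then 0 else exp_dd (rho_shift xs))"
      unfolding shifted_dd_deriv using Cons.IH
      by (simp add: fps_compose_mult_distrib[OF u] fps_compose_add_distrib)
    finally show "fps_deriv (shifted_dd (x # xs) oo ?u) = \<dots>" .
    show "fps_deriv (exp_dd (rho_shift (x # xs))) = fps_const (x + of_nat (length xs)) * exp_dd (rho_shift (x # xs))
        + (if xs = [] then 0 else exp_dd (rho_shift xs))"
      by (simp add: exp_dd_deriv)
  qed (simp add: fps_nth_dd_0)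
qed simp

lemma exp_dd_shift: "xs \<noteq> [] \<Longrightarrow> exp_dd (map (\<lambda>x. x + s) xs) = fps_exp s * exp_dd xs"
proof (induction xs)
  case (Cons x xs)
  show ?case
  proof (rule fps_linear_ODE_unique)
    show "fps_deriv (exp_dd (map (\<lambda>x. x + s) (x # xs))) = fps_const (x + s) * exp_dd (map (\<lambda>x. x + s) (x # xs))
        + (if xs = [] then 0 else exp_dd (map (\<lambda>x. x + s) xs))"
      by (simp add: exp_dd_deriv)
    show "fps_deriv (fps_exp s * exp_dd (x # xs)) = fps_const (x + s) * (fps_exp s * exp_dd (x # xs))
        + (if xs = [] then 0 else exp_dd (map (\<lambda>x. x + s) xs))"
      using Cons.IH by (simp add: exp_dd_deriv algebra_simps flip: fps_const_add)
  qed (simp add: fps_nth_dd_0)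
qed simp

section \<open>Harish-Chandra coordinates and the power of the hyperbolic sine\<close>

text \<open>The x_i of the Harish-Chandra isomorphism: the numbers lam_i + n - i moved by -(n -
  1)/2, which makes them symmetric about 0 for the weight 0.\<close>

definition hc_list :: "nat \<Rightarrow> (nat \<Rightarrow> complex) \<Rightarrow> complex list" where
  "hc_list n lam = map (\<lambda>i. lam i + of_nat (n + 1) / 2 - of_nat i) [1..<Suc n]"

lemma length_hc_list [simp]: "length (hc_list n lam) = n"
  by (simp add: hc_list_def)

lemma rho_shift_nth: "p < length xs \<Longrightarrow> rho_shift xs ! p = xs ! p + of_nat (length xs - 1 - p)"
  by (induction xs arbitrary: p) (auto simp: nth_Cons split: nat.split)

lemma rho_shift_hc_list:
  "rho_shift (map lam [1..<Suc n]) = map (\<lambda>x. x + of_nat (n - 1) / 2) (hc_list n lam)"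
proof (rule nth_equalityI)
  fix p assume "p < length (rho_shift (map lam [1..<Suc n]))"
  then have p: "p < n" by (simp del: upt_Suc)
  then have "of_nat (n - 1 - p) = of_nat n - 1 - (of_nat p :: complex)" "of_nat (n - 1) = (of_nat n - 1 :: complex)"
    by (simp_all add: of_nat_diff)
  then show "rho_shift (map lam [1..<Suc n]) ! p = map (\<lambda>x. x + of_nat (n - 1) / 2) (hc_list n lam) ! p"
    using p by (simp add: rho_shift_nth hc_list_def field_simps del: upt_Suc)
qed (simp add: hc_list_def)

lemma sinh_series_eq: "fps_X * sinh_series = fps_exp (1/2) - fps_exp (- (1/2))"
proof -
  let ?D = "fps_exp (1/2) - fps_exp (- (1/2)) :: complex fps"
  have "?D = fps_X * fps_shift 1 ?D"
  proof (rule fps_ext)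
    fix m
    show "fps_nth ?D m = fps_nth (fps_X * fps_shift 1 ?D) m" by (cases m) simp_all
  qed
  then show ?thesis unfolding sinh_series_def
    by (metis fps_X_neq_zero nonzero_mult_div_cancel_left)
qed

lemma sinh_series_nth_0: "fps_nth sinh_series 0 = 1"
  using arg_cong[OF sinh_series_eq, of "\<lambda>F. fps_nth F 1"] by simp

text \<open>Passing from the nodes lam_i + n - i to the centred x_i costs e^((n-1)t/2), and the same
  factor splits off from (e^t - 1)^(n-1), leaving (e^(t/2) - e^(-t/2))^(n-1). The power t^(n-1)
  contained in the latter cancels against the order of vanishing of the divided difference.\<close>

lemma avg_series_eq:
  assumes "n \<ge> 1"
  shows "avg_series n lam = Abs_fps (\<lambda>k. complete_h (hc_list n lam) k / fact (k + (n - 1))) * inverse (sinh_series ^ (n - 1))"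
proof -
  let ?u = "fps_exp 1 - 1 :: complex fps"
  let ?h = "Abs_fps (\<lambda>k. complete_h (hc_list n lam) k / fact (k + (n - 1)))"
  let ?l = "map lam [1..<Suc n]"
  let ?s = "fps_exp (of_nat (n - 1) / 2) :: complex fps"
  have u: "fps_nth ?u 0 = 0" by simp
  have ne: "?l \<noteq> []" "hc_list n lam \<noteq> []" using assms by (simp_all add: hc_list_def del: upt_Suc)
  have "?u ^ (n - 1) * avg_series n lam = shifted_dd ?l oo ?u"
    using assms by (simp add: shifted_dd_def avg_series_def fps_compose_mult_distrib[OF u] fps_compose_power[OF u, symmetric] del: upt_Suc)
  also have "\<dots> = ?s * (fps_X ^ (n - 1) * ?h)"
    unfolding shifted_dd_compose_exp[OF ne(1)] rho_shift_hc_list exp_dd_shift[OF ne(2)]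
    by (simp add: exp_dd_def)
  finally have 1: "?u ^ (n - 1) * avg_series n lam = ?s * (fps_X ^ (n - 1) * ?h)" .
  have "?u = fps_exp (1/2) * (fps_X * sinh_series)"
    unfolding sinh_series_eq by (simp add: right_diff_distrib flip: fps_exp_add_mult)
  then have "?u ^ (n - 1) = ?s * (fps_X ^ (n - 1) * sinh_series ^ (n - 1))"
    by (simp add: power_mult_distrib fps_exp_power_mult)
  with 1 have "(?s * fps_X ^ (n - 1)) * (sinh_series ^ (n - 1) * avg_series n lam) = (?s * fps_X ^ (n - 1)) * ?h"
    by (simp add: mult_ac)
  moreover have "fps_nth ?s 0 = 1" by simp
  then have "?s \<noteq> 0" by (metis fps_zero_nth zero_neq_one)
  ultimately have eq: "sinh_series ^ (n - 1) * avg_series n lam = ?h"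
    by simp
  have "fps_nth (sinh_series ^ (n - 1)) 0 \<noteq> 0" by (simp add: sinh_series_nth_0)
  then have "inverse (sinh_series ^ (n - 1)) * sinh_series ^ (n - 1) = 1" by (rule inverse_mult_eq_1)
  then have "avg_series n lam = inverse (sinh_series ^ (n - 1)) * (sinh_series ^ (n - 1) * avg_series n lam)"
    by (simp flip: mult.assoc)
  then show ?thesis unfolding eq by (simp add: mult.commute)
qed

section \<open>Evaluation of universal polynomials\<close>

text \<open>Coefficients are specialized in two ways: polynomials in N at a number, and universal
  polynomials by \<open>ev\<close>.\<close>

locale fps_ring_hom =
  fixes H :: "'a::comm_ring_1 \<Rightarrow> 'b::comm_ring_1"
  assumes H_add: "H (a + b) = H a + H b" and H_mult: "H (a * b) = H a * H b" and H_1: "H 1 = 1"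
begin

definition fmap :: "'a fps \<Rightarrow> 'b fps" where
  "fmap f = Abs_fps (\<lambda>k. H (fps_nth f k))"

lemma H_0: "H 0 = 0"
  using H_add[of 0 0] by simp

lemma H_diff: "H (a - b) = H a - H b"
  using H_add[of "a - b" b] by simp

lemma H_uminus: "H (- b) = - H b"
  using H_diff[of 0 b] by (simp add: H_0)

lemma H_sum: "H (sum f A) = (\<Sum>a\<in>A. H (f a))"
  by (induction A rule: infinite_finite_induct) (simp_all add: H_add H_0)

lemma H_prod: "H (prod f A) = (\<Prod>a\<in>A. H (f a))"
  by (induction A rule: infinite_finite_induct) (simp_all add: H_mult H_1)

lemma H_power: "H (a ^ k) = H a ^ k"
  by (induction k) (simp_all add: H_mult H_1)

lemma fmap_nth [simp]: "fps_nth (fmap f) k = H (fps_nth f k)"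
  by (simp add: fmap_def)

lemma fmap_1: "fmap 1 = 1"
  by (simp add: fps_eq_iff H_1 H_0)

lemma fmap_X: "fmap fps_X = fps_X"
  by (simp add: fps_eq_iff H_1 H_0 fps_X_def)

lemma fmap_const: "fmap (fps_const c) = fps_const (H c)"
  by (simp add: fps_eq_iff H_0)

lemma fmap_diff: "fmap (f - g) = fmap f - fmap g"
  by (simp add: fps_eq_iff H_diff)

lemma fmap_mult: "fmap (f * g) = fmap f * fmap g"
  by (simp add: fps_eq_iff fps_mult_nth H_sum H_mult)

lemma fmap_power: "fmap (f ^ k) = fmap f ^ k"
  by (induction k) (simp_all add: fmap_1 fmap_mult)

lemma fmap_compose: "fmap (f oo g) = fmap f oo fmap g"
  by (simp add: fps_eq_iff fps_compose_nth H_sum H_mult flip: fmap_power)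

end

lemma fmap_right_inverse:
  fixes H :: "'a::comm_ring_1 \<Rightarrow> 'b::field"
  assumes "fps_ring_hom H" "fps_nth f 0 = 1"
  shows "fps_ring_hom.fmap H (fps_right_inverse f 1) = inverse (fps_ring_hom.fmap H f)"
proof -
  interpret fps_ring_hom H by (rule assms)
  have "f * fps_right_inverse f 1 = 1" using assms(2) by (intro fps_right_inverse) simp
  then have "fmap f * fmap (fps_right_inverse f 1) = 1"
    by (simp only: fmap_1 flip: fmap_mult)
  then show ?thesis by (metis fps_inverse_unique)
qed

lemma poly_hom: "fps_ring_hom (\<lambda>p. poly p z)" for z :: complex
  by unfold_locales simp_all

lemma poly_binomial_eval: "poly (poly_binomial a k) z = poly a z gchoose k"
  by (simp add: poly_binomial_def gbinomial_prod_rev poly_prod atLeast0LessThan)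

lemma fmap_formal_power:
  "fps_ring_hom.fmap (\<lambda>p. poly p z) (fps_formal_power f a)
    = fps_binomial (poly a z) oo (fps_ring_hom.fmap (\<lambda>p. poly p z) f - 1)"
proof -
  interpret fps_ring_hom "\<lambda>p. poly p z" by (rule poly_hom)
  have "fmap (Abs_fps (poly_binomial a)) = fps_binomial (poly a z)"
    by (simp add: fps_eq_iff poly_binomial_eval)
  then show ?thesis
    by (simp add: fps_formal_power_def fmap_compose fmap_diff fmap_1)
qed

text \<open>At N = n this turns the formal powers with exponents N and -nu into ordinary
  powers.\<close>

lemma fps_binomial_compose_of_nat:
  fixes f :: "complex fps"
  assumes "fps_nth f 0 = 1"
  shows "fps_binomial (of_nat k) oo (f - 1) = f ^ k"
    and "fps_binomial (- of_nat k) oo (f - 1) = inverse (f ^ k)"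
proof -
  have 0: "fps_nth (f - 1) 0 = 0" using assms by simp
  show 1: "fps_binomial (of_nat k) oo (f - 1) = f ^ k"
    by (simp add: fps_binomial_of_nat fps_compose_power[OF 0, symmetric] fps_compose_add_distrib assms)
  have "fps_binomial (- of_nat k) * fps_binomial (of_nat k) = (1 :: complex fps)"
    by (simp flip: fps_binomial_add_mult)
  then have "(fps_binomial (- of_nat k) oo (f - 1)) * (fps_binomial (of_nat k) oo (f - 1)) = 1"
    unfolding fps_compose_mult_distrib[OF 0, symmetric] by simp
  then have "f ^ k * (fps_binomial (- of_nat k) oo (f - 1)) = 1" by (simp add: 1 mult.commute)
  then show "fps_binomial (- of_nat k) oo (f - 1) = inverse (f ^ k)"
    by (metis fps_inverse_unique)
qed

lemma sinh_power_eval: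
  assumes "n \<ge> 1"
  shows "poly (fps_nth sinh_power j) (of_nat n) = fps_nth (inverse (sinh_series ^ (n - 1))) j"
proof -
  interpret fps_ring_hom "\<lambda>p. poly p (of_nat n :: complex)" by (rule poly_hom)
  have 1: "fmap (Abs_fps (\<lambda>n. [:fps_nth sinh_series n:])) = sinh_series"
    by (simp add: fps_eq_iff)
  have 2: "poly (- nu) (of_nat n) = - of_nat (n - 1)"
    using assms by (simp add: nu_def formal_N_def of_nat_diff)
  have "fmap sinh_power = inverse (sinh_series ^ (n - 1))"
    unfolding sinh_power_def fmap_formal_power 1 2
    by (rule fps_binomial_compose_of_nat(2)[OF sinh_series_nth_0])
  then show ?thesis by (metis fmap_nth)
qed

lemma fact_ratio_eval:
  assumes "n \<ge> 1" "k \<le> m"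
  shows "poly (fact_ratio m k) (of_nat n) = fact (m + n - 1) / fact (k + n - 1)"
  using assms(2)
proof (induction m rule: dec_induct)
  case base
  show ?case by (simp add: fact_ratio_def)
next
  case (step m)
  have "{k<..Suc m} = insert (Suc m) {k<..m}" using step by auto
  then have "fact_ratio (Suc m) k = (of_nat (Suc m) + nu) * fact_ratio m k"
    by (simp add: fact_ratio_def del: of_nat_Suc)
  moreover have "Suc m + n - 1 = Suc (m + n - 1)" using assms by simp
  then have "fact (Suc m + n - 1) = (of_nat (m + n) :: complex) * fact (m + n - 1)"
    using assms by (simp only: fact_Suc) simp
  moreover have "poly (of_nat (Suc m) + nu) (of_nat n) = (of_nat (m + n) :: complex)"
    by (simp add: nu_def formal_N_def)
  ultimately show ?case using step.IH by simp
qed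

lemma ev_hom: "fps_ring_hom (ev z s)"
proof -
  define mon where "mon \<mu> = (\<Prod>i\<in>Poly_Mapping.keys \<mu>. s (i + 1) ^ Poly_Mapping.lookup \<mu> i)" for \<mu>
  have ev: "ev z s p = (\<Sum>\<mu>\<in>Poly_Mapping.keys p. poly (Poly_Mapping.lookup p \<mu>) z * mon \<mu>)" for p
    by (simp add: ev_def mon_def)
  have add: "ev z s (p + q) = ev z s p + ev z s q" for p q
    unfolding ev by (rule sum_keys_add) (simp_all add: distrib_right)
  have single: "ev z s (Poly_Mapping.single \<mu> c) = poly c z * mon \<mu>" for \<mu> c
    by (simp add: ev)
  have mon: "mon (\<mu> + \<kappa>) = mon \<mu> * mon \<kappa>" for \<mu> \<kappa>
  proof -
    let ?A = "Poly_Mapping.keys \<mu> \<union> Poly_Mapping.keys \<kappa>"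
    have sup: "mon \<mu>' = (\<Prod>i\<in>?A. s (i + 1) ^ Poly_Mapping.lookup \<mu>' i)" if "Poly_Mapping.keys \<mu>' \<subseteq> ?A" for \<mu>'
      unfolding mon_def using that by (intro prod.mono_neutral_left) (auto simp: in_keys_iff)
    show ?thesis
      using Poly_Mapping.keys_add[of \<mu> \<kappa>]
      by (simp add: sup lookup_add power_add prod.distrib)
  qed
  have "ev z s (p * q) = ev z s p * ev z s q" for p q
  proof (induction p rule: poly_mapping_induct)
    case (single \<mu> c)
    show ?case
      by (induction q rule: poly_mapping_induct)
        (simp_all add: mult_single \<open>\<And>\<mu> c. ev z s (Poly_Mapping.single \<mu> c) = poly c z * mon \<mu>\<close> mon add ring_distribs mult_ac)
  qed (simp add: add distrib_right)
  moreover have "ev z s 1 = 1"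
    by (simp add: single mon_def flip: single_one)
  ultimately show ?thesis by unfold_locales (simp_all add: add)
qed

lemma ev_coef: "ev z s (coef c) = poly c z"
  by (simp add: ev_def coef_def)

lemma ev_schur_S: "ev z s (schur_S k) = (if k = 0 then 1 else s k)"
  using fps_ring_hom.H_1[OF ev_hom, of z s] by (auto simp: schur_S_def indet_def ev_def)

lemma ev_schur_subst: "ev z s (schur_subst p) = ev z (\<lambda>m. ev z s (schur_C m)) p"
proof -
  interpret fps_ring_hom "ev z s" by (rule ev_hom)
  show ?thesis
    unfolding schur_subst_def H_sum H_mult H_prod H_power ev_coef by (simp add: ev_def)
qed

lemma fmap_fps_coef:
  "fps_ring_hom.fmap (ev z s) (fps_coef f) = fps_ring_hom.fmap (\<lambda>p. poly p z) f"
  by (simp add: fps_eq_iff fps_ring_hom.fmap_nth[OF ev_hom] fps_ring_hom.fmap_nth[OF poly_hom] fps_coef_def ev_coef)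

lemma fmap_one_minus: "fps_ring_hom.fmap (\<lambda>p. poly p z) (one_minus a) = 1 - fps_const (poly a z) * fps_X"
proof -
  interpret fps_ring_hom "\<lambda>p. poly p z" by (rule poly_hom)
  show ?thesis by (simp add: one_minus_def fmap_diff fmap_mult fmap_1 fmap_const fmap_X)
qed

section \<open>The Schur substitution at a highest weight\<close>

definition num_S :: "(nat \<Rightarrow> complex) \<Rightarrow> complex \<Rightarrow> complex fps" where
  "num_S s a = Abs_fps (\<lambda>k. if k = 0 then 1 else s k) oo (fps_X * inverse (1 - fps_const a * fps_X))"

lemma fmap_S_series: "fps_ring_hom.fmap (ev z s) (S_series a) = num_S s (poly a z)"
proof -
  interpret fps_ring_hom "ev z s" by (rule ev_hom)
  interpret P: fps_ring_hom "\<lambda>p. poly p z" by (rule poly_hom)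
  have "fmap (Abs_fps schur_S) = Abs_fps (\<lambda>k. if k = 0 then 1 else s k)"
    by (simp add: fps_eq_iff ev_schur_S)
  moreover have "fps_nth (one_minus a) 0 = 1" by (simp add: one_minus_def)
  ultimately show ?thesis
    by (simp add: S_series_def num_S_def fmap_compose fmap_fps_coef P.fmap_mult P.fmap_X
        fmap_right_inverse[OF poly_hom] fmap_one_minus)
qed

lemma fmap_schur_series:
  fixes n :: nat
  defines "a \<equiv> (of_nat n + 1) / 2" and "b \<equiv> (of_nat n - 1) / 2"
  shows "fps_ring_hom.fmap (ev (of_nat n) s) schur_series
    = ((1 - fps_const a * fps_X) * inverse (1 - fps_const b * fps_X)) ^ n * (num_S s b * inverse (num_S s a))"
proof -
  interpret fps_ring_hom "ev (of_nat n) s" by (rule ev_hom)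
  interpret P: fps_ring_hom "\<lambda>p. poly p (of_nat n :: complex)" by (rule poly_hom)
  define A B where "A = smult (1/2) (formal_N + 1)" and "B = smult (1/2) (formal_N - 1)"
  have AB: "poly A (of_nat n) = a" "poly B (of_nat n) = b"
    by (simp_all add: A_def B_def a_def b_def formal_N_def)
  let ?f = "one_minus A * fps_right_inverse (one_minus B) 1"
  have o: "fps_nth (one_minus B) 0 = 1" by (simp add: one_minus_def)
  have f: "P.fmap ?f = (1 - fps_const a * fps_X) * inverse (1 - fps_const b * fps_X)"
    by (simp add: P.fmap_mult fmap_right_inverse[OF poly_hom o] fmap_one_minus AB)
  have f0: "fps_nth (P.fmap ?f) 0 = 1" unfolding f by simp
  have N: "poly formal_N (of_nat n) = (of_nat n :: complex)" by (simp add: formal_N_def)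
  have "P.fmap (fps_formal_power ?f formal_N) = (P.fmap ?f) ^ n"
    unfolding fmap_formal_power N by (rule fps_binomial_compose_of_nat(1)[OF f0])
  then show ?thesis
    unfolding schur_series_def Let_def A_def[symmetric] B_def[symmetric]
    by (simp add: fmap_mult fmap_fps_coef f fmap_right_inverse[OF ev_hom] fmap_S_series AB)
qed

definition root_prod :: "complex \<Rightarrow> complex list \<Rightarrow> complex fps" where
  "root_prod a xs = prod_list (map (\<lambda>x. 1 - fps_const (a + x) * fps_X) xs)"

lemma root_prod_nth_0 [simp]: "fps_nth (root_prod a xs) 0 = 1"
  by (induction xs) (simp_all add: root_prod_def)

lemma complete_h_generating: "Abs_fps (complete_h xs) * root_prod 0 xs = 1"
proof (induction xs)
  case Nil
  have "complete_h [] k = (if k = 0 then 1 else 0)" for k by (cases k) simp_all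
  then show ?case by (simp add: root_prod_def fps_eq_iff)
next
  case (Cons x xs)
  have "Abs_fps (complete_h (x # xs)) * (1 - fps_const x * fps_X) = Abs_fps (complete_h xs)"
  proof (rule fps_ext)
    fix k
    show "fps_nth (Abs_fps (complete_h (x # xs)) * (1 - fps_const x * fps_X)) k = fps_nth (Abs_fps (complete_h xs)) k"
      by (cases k) (simp_all add: right_diff_distrib mult.left_commute[of _ "fps_const x"])
  qed
  then show ?case using Cons by (simp add: root_prod_def flip: mult.assoc)
qed

text \<open>Putting v/(1 - av) for v in the generating series of the h_k turns each factor 1/(1 -
  xv) into (1 - av)/(1 - (a + x)v).\<close>

lemma num_S_complete_h:
  "num_S (complete_h xs) a * root_prod a xs = (1 - fps_const a * fps_X) ^ length xs"
proof -
  let ?d = "1 - fps_const a * fps_X"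
  let ?u = "fps_X * inverse ?d"
  have u: "fps_nth ?u 0 = 0" by simp
  have d: "fps_nth ?d 0 \<noteq> 0" by simp
  have inv: "inverse ?d * ?d = 1" using d by (rule inverse_mult_eq_1)
  have 1: "(root_prod 0 xs oo ?u) * ?d ^ length xs = root_prod a xs"
  proof (induction xs)
    case (Cons x xs)
    have "((1 - fps_const x * fps_X) oo ?u) * ?d = ?d - fps_const x * fps_X * (inverse ?d * ?d)"
      by (simp add: fps_compose_sub_distrib fps_compose_mult_distrib[OF u] left_diff_distrib mult.assoc)
    also have "\<dots> = 1 - fps_const (a + x) * fps_X"
      unfolding inv by (simp add: algebra_simps flip: fps_const_add)
    finally have "((1 - fps_const x * fps_X) oo ?u) * ?d = 1 - fps_const (a + x) * fps_X" .
    moreover have "(root_prod 0 (x # xs) oo ?u) * ?d ^ length (x # xs)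
      = (((1 - fps_const x * fps_X) oo ?u) * ?d) * ((root_prod 0 xs oo ?u) * ?d ^ length xs)"
    proof -
      have "root_prod 0 (x # xs) = (1 - fps_const x * fps_X) * root_prod 0 xs" by (simp add: root_prod_def)
      then have "root_prod 0 (x # xs) oo ?u = ((1 - fps_const x * fps_X) oo ?u) * (root_prod 0 xs oo ?u)"
        by (simp only: fps_compose_mult_distrib[OF u])
      then show ?thesis by (simp only: length_Cons power_Suc mult_ac)
    qed
    moreover have "root_prod a (x # xs) = (1 - fps_const (a + x) * fps_X) * root_prod a xs"
      by (simp add: root_prod_def)
    ultimately show ?case using Cons by (simp only:)
  qed (simp add: root_prod_def)
  have 2: "num_S (complete_h xs) a * (root_prod 0 xs oo ?u) = 1"
  proof -
    have "(\<lambda>k. if k = 0 then 1 else complete_h xs k) = complete_h xs" by auto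
    then show ?thesis
      by (simp add: num_S_def complete_h_generating flip: fps_compose_mult_distrib[OF u])
  qed
  show ?thesis unfolding 1[symmetric] mult.assoc[symmetric] 2 by simp
qed

text \<open>The Perelomov-Popov formula. The recursion for \<open>cas_y\<close> says (1 - l_r v) Z_r
  = (1 - (l_r + 1) v) Z_(r+1) for the partial sums Z, and the product telescopes. The value of
  \<open>cas_val\<close> at m = 0 is n, which accounts for the term -Nv.\<close>

lemma cas_val_generating:
  "root_prod (of_nat n / 2 - 1 / 2) (hc_list n lam) * (1 - fps_X * Abs_fps (cas_val n lam))
    = root_prod (of_nat n / 2 + 1 / 2) (hc_list n lam)"
proof -
  define Y where "Y i = Abs_fps (\<lambda>m. cas_y n lam m i)" for i
  define Z where "Z r = 1 - fps_X * (\<Sum>k\<in>{r..n}. Y k)" for r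
  define l where "l i = lam i + of_nat (n - i)" for i
  have Y: "(1 - fps_const (l i) * fps_X) * Y i = 1 - fps_X * (\<Sum>k\<in>{i<..n}. Y k)" for i
  proof (rule fps_ext)
    fix m
    show "fps_nth ((1 - fps_const (l i) * fps_X) * Y i) m = fps_nth (1 - fps_X * (\<Sum>k\<in>{i<..n}. Y k)) m"
      by (cases m) (simp_all add: left_diff_distrib mult.assoc fps_sum_nth Y_def l_def)
  qed
  have Z: "(1 - fps_const (l r) * fps_X) * Z r = (1 - fps_const (l r + 1) * fps_X) * Z (Suc r)" if "r \<le> n" for r
  proof -
    have "{r..n} = insert r {Suc r..n}" "{r<..n} = {Suc r..n}" using that by auto
    then have "Z r = Z (Suc r) - fps_X * Y r" "(1 - fps_const (l r) * fps_X) * Y r = Z (Suc r)"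
      using Y[of r] by (simp_all add: Z_def algebra_simps)
    then have "(1 - fps_const (l r) * fps_X) * Z r = (1 - fps_const (l r) * fps_X) * Z (Suc r) - fps_X * Z (Suc r)"
      by (simp add: right_diff_distrib mult.left_commute[of _ fps_X])
    then show ?thesis by (simp add: algebra_simps flip: fps_const_add)
  qed
  have "prod_list (map (\<lambda>i. 1 - fps_const (l i) * fps_X) [r..<Suc n]) * Z r = prod_list (map (\<lambda>i. 1 - fps_const (l i + 1) * fps_X) [r..<Suc n])" for r
  proof (induction "Suc n - r" arbitrary: r)
    case 0
    then show ?case by (simp add: Z_def)
  next
    case (Suc d)
    then have r: "r \<le> n" by simp
    have up: "[r..<Suc n] = r # [Suc r..<Suc n]" using r by (simp add: upt_rec)
    have IH: "prod_list (map (\<lambda>i. 1 - fps_const (l i) * fps_X) [Suc r..<Suc n]) * Z (Suc r) = prod_list (map (\<lambda>i. 1 - fps_const (l i + 1) * fps_X) [Suc r..<Suc n])"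
      by (rule Suc.hyps) (use Suc.hyps(2) in simp)
    have "prod_list (map (\<lambda>i. 1 - fps_const (l i) * fps_X) [r..<Suc n]) * Z r
      = prod_list (map (\<lambda>i. 1 - fps_const (l i) * fps_X) [Suc r..<Suc n]) * ((1 - fps_const (l r) * fps_X) * Z r)"
      unfolding up by (simp add: mult_ac del: upt_Suc)
    also have "\<dots> = (1 - fps_const (l r + 1) * fps_X) * (prod_list (map (\<lambda>i. 1 - fps_const (l i) * fps_X) [Suc r..<Suc n]) * Z (Suc r))"
      unfolding Z[OF r] by (simp add: mult_ac del: upt_Suc)
    finally show ?case unfolding IH up by simp
  qed
  from this[of 1] have main: "prod_list (map (\<lambda>i. 1 - fps_const (l i) * fps_X) [1..<Suc n]) * Z 1 = prod_list (map (\<lambda>i. 1 - fps_const (l i + 1) * fps_X) [1..<Suc n])" .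
  have hc: "root_prod (of_nat n / 2 + c) (hc_list n lam) = prod_list (map (\<lambda>i. 1 - fps_const (l i + (c + 1/2)) * fps_X) [1..<Suc n])" for c
    unfolding root_prod_def hc_list_def map_map
  proof (intro arg_cong[of _ _ prod_list] map_cong refl)
    fix i assume "i \<in> set [1..<Suc n]"
    then have "i \<le> n" by auto
    then have "of_nat n / 2 + c + (lam i + of_nat (n + 1) / 2 - of_nat i) = l i + (c + 1/2)"
      by (simp add: l_def of_nat_diff field_simps)
    then show "((\<lambda>x. 1 - fps_const (of_nat n / 2 + c + x) * fps_X) \<circ> (\<lambda>i. lam i + of_nat (n + 1) / 2 - of_nat i)) i
      = 1 - fps_const (l i + (c + 1/2)) * fps_X" by (simp only: comp_apply)
  qed
  have "Z 1 = 1 - fps_X * Abs_fps (cas_val n lam)"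
    by (simp add: Z_def Y_def cas_val_def fps_eq_iff fps_sum_nth)
  then show ?thesis using main hc[of "-1/2"] hc[of "1/2"] by (simp del: upt_Suc)
qed

text \<open>With A = 1 - av and B = 1 - bv, the quotient of the two S-series contributes (B/A)^n by
  \<open>num_S_complete_h\<close> and cancels the power in front. What remains is the Harish-Chandra
  product, the generating series of the Casimir eigenvalues.\<close>

lemma ev_schur_C:
  assumes "m \<ge> 1"
  shows "ev (of_nat n) (complete_h (hc_list n lam)) (schur_C m) = cas_val n lam m"
proof -
  let ?s = "complete_h (hc_list n lam)"
  interpret fps_ring_hom "ev (of_nat n) ?s" by (rule ev_hom)
  define a b :: complex where "a = (of_nat n + 1) / 2" and "b = (of_nat n - 1) / 2"
  let ?A = "1 - fps_const a * fps_X" and ?B = "1 - fps_const b * fps_X"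
  let ?RA = "root_prod a (hc_list n lam)" and ?RB = "root_prod b (hc_list n lam)"
  let ?SA = "num_S ?s a" and ?SB = "num_S ?s b"
  have Sa: "?SA * ?RA = ?A ^ n" and Sb: "?SB * ?RB = ?B ^ n"
    using num_S_complete_h[of "hc_list n lam"] by simp_all
  have nz: "fps_nth ?A 0 \<noteq> 0" "fps_nth ?B 0 \<noteq> 0" "fps_nth ?RA 0 \<noteq> 0" "fps_nth ?RB 0 \<noteq> 0" "fps_nth ?SA 0 \<noteq> 0"
    by (simp_all add: num_S_def)
  have c: "?RB * (1 - fps_X * Abs_fps (cas_val n lam)) = ?RA"
    using cas_val_generating[of n lam] by (simp add: a_def b_def diff_divide_distrib add_divide_distrib)
  have "fmap schur_series = (?A * inverse ?B) ^ n * (?SB * inverse ?SA)"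
    unfolding a_def b_def by (rule fmap_schur_series)
  then have "fmap schur_series * (?B ^ n * ?SA) = ?A ^ n * ?SB * ((inverse ?B * ?B) ^ n * (inverse ?SA * ?SA))"
    by (simp add: power_mult_distrib mult_ac)
  also have "\<dots> = ?A ^ n * ?SB"
    using nz by (simp add: inverse_mult_eq_1 del: fps_sub_nth)
  finally have "fmap schur_series * (?B ^ n * ?SA) * (?RA * ?RB) = ?A ^ n * ?SB * (?RA * ?RB)" by simp
  then have "fmap schur_series * ?B ^ n * ?A ^ n * ?RB = ?A ^ n * ?B ^ n * ?RA"
    unfolding Sa[symmetric] Sb[symmetric] by (simp add: mult_ac)
  then have "(?A ^ n * ?B ^ n * ?RB) * fmap schur_series = (?A ^ n * ?B ^ n * ?RB) * (1 - fps_X * Abs_fps (cas_val n lam))"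
    unfolding c[symmetric] by (simp add: mult_ac)
  moreover have "?A ^ n * ?B ^ n * ?RB \<noteq> 0"
  proof -
    have "fps_nth (?A ^ n * ?B ^ n * ?RB) 0 = 1" by (simp add: fps_nth_power_0)
    then show ?thesis by (metis fps_zero_nth zero_neq_one)
  qed
  ultimately have "fmap schur_series = 1 - fps_X * Abs_fps (cas_val n lam)"
    using mult_left_cancel by blast
  then have "fps_nth (fmap schur_series) (m + 1) = - cas_val n lam m" by simp
  then show ?thesis by (simp add: schur_C_def H_uminus)
qed

section \<open>Existence of the universal weight system\<close>

lemma casR_central_gen:
  assumes "a \<in> {1..n}" "b \<in> {1..n}"
  shows "gl_cong n (nc_gen (a, b) * casR n r) (casR n r * nc_gen (a, b))"
proof -
  have "gl_cong n (\<Sum>i = 1..n. nc_gen (a, b) * E_pow n r i i)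
     (\<Sum>i = 1..n. E_pow n r i i * nc_gen (a, b)
       + ((if b = i then E_pow n r a i else 0) - (if a = i then E_pow n r i b else 0)))"
    by (intro gl_cong_sum E_pow_commutator) (use assms in auto)
  also have "\<dots> = (\<Sum>i = 1..n. E_pow n r i i * nc_gen (a, b)) + (E_pow n r a b - E_pow n r a b)"
    using assms by (simp add: sum.distrib sum_subtractf)
  finally show ?thesis by (simp add: casR_def sum_distrib_left sum_distrib_right)
qed

definition casR_comm :: "nat \<Rightarrow> nat \<Rightarrow> (nat \<times> nat) ncpoly \<Rightarrow> bool" where
  "casR_comm n r x \<longleftrightarrow> x \<in> gl_free n \<and> gl_cong n (x * casR n r) (casR n r * x)"

lemma casR_comm_mult: "casR_comm n r x \<Longrightarrow> casR_comm n r y \<Longrightarrow> casR_comm n r (x * y)"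
  unfolding casR_comm_def
  using gl_cong_mult_left[of n "y * casR n r" "casR n r * y" x]
    gl_cong_mult_right[of n "x * casR n r" "casR n r * x" y]
  by (auto simp: mult.assoc intro: gl_cong_trans)

lemma casR_comm_1 [simp]: "casR_comm n r 1"
  by (simp add: casR_comm_def)

lemma casR_comm_power: "casR_comm n r x \<Longrightarrow> casR_comm n r (x ^ k)"
  by (induction k) (auto intro: casR_comm_mult)

lemma casR_comm_sum: "(\<And>a. a \<in> A \<Longrightarrow> casR_comm n r (f a)) \<Longrightarrow> casR_comm n r (sum f A)"
  by (auto simp: casR_comm_def sum_distrib_left sum_distrib_right intro: gl_cong_sum)

lemma casR_comm_prod_list: "(\<And>x. x \<in> set xs \<Longrightarrow> casR_comm n r x) \<Longrightarrow> casR_comm n r (prod_list xs)"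
  by (induction xs) (auto intro: casR_comm_mult)

lemma casR_comm_casR: "casR_comm n r (casR n m)"
proof -
  have "casR_comm n r (E_pow n m i j)" if "i \<in> {1..n}" "j \<in> {1..n}" for i j
    using that(2)
  proof (induction m arbitrary: j)
    case 0
    then show ?case by (simp add: casR_comm_def)
  next
    case (Suc m)
    then show ?case
      by (auto intro!: casR_comm_sum casR_comm_mult simp: casR_central_gen casR_comm_def[of n r "nc_gen _"])
  qed
  then show ?thesis unfolding casR_def by (intro casR_comm_sum) simp
qed

lemma prod_list_map_superset:
  fixes f :: "nat \<Rightarrow> 'a::monoid_mult"
  assumes "A \<subseteq> {..<M}" "\<And>i. i \<notin> A \<Longrightarrow> f i = 1"
  shows "prod_list (map f (sorted_list_of_set A)) = prod_list (map f [0..<M])"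
proof -
  have fin: "finite A" using assms(1) finite_subset by blast
  have "sorted_list_of_set A = filter (\<lambda>i. i \<in> A) [0..<M]"
    by (rule sorted_distinct_set_unique) (use fin assms(1) in \<open>auto simp: sorted_wrt_filter\<close>)
  moreover have "prod_list (map f (filter (\<lambda>i. i \<in> A) xs)) = prod_list (map f xs)" for xs
    by (induction xs) (auto simp: assms(2))
  ultimately show ?thesis by simp
qed

text \<open>The monomial is an ordered product, so the new factor appears in the middle; Casimir
  elements commute modulo the ideal, which carries it to the end.\<close>

lemma cas_mon_add_single:
  "gl_cong n (cas_mon n (\<mu> + Poly_Mapping.single i 1)) (cas_mon n \<mu> * casR n (i + 1))"
proof -
  define M where "M = Suc (Max (insert i (Poly_Mapping.keys \<mu>)))"
  have M: "insert i (Poly_Mapping.keys \<mu>) \<subseteq> {..<M}"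
    unfolding M_def by (auto simp: less_Suc_eq_le)
  let ?f = "\<lambda>\<mu> i. casR n (i + 1) ^ Poly_Mapping.lookup \<mu> i"
  have eq: "cas_mon n \<mu>' = prod_list (map (?f \<mu>') [0..<M])" if "Poly_Mapping.keys \<mu>' \<subseteq> {..<M}" for \<mu>'
    unfolding cas_mon_def by (rule prod_list_map_superset[OF that]) (simp add: in_keys_iff)
  have split: "[0..<M] = [0..<i] @ i # [Suc i..<M]"
  proof -
    have "i < M" using M by auto
    then show ?thesis by (metis upt_add_eq_append upt_conv_Cons le_add_diff_inverse less_imp_le zero_le)
  qed
  let ?A = "prod_list (map (?f \<mu>) [0..<i])" and ?B = "prod_list (map (?f \<mu>) [Suc i..<M])"
  have k: "Poly_Mapping.keys (\<mu> + Poly_Mapping.single i 1) \<subseteq> {..<M}"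
    using Poly_Mapping.keys_add[of \<mu> "Poly_Mapping.single i 1"] M by auto
  have A: "map (?f (\<mu> + Poly_Mapping.single i 1)) [0..<i] = map (?f \<mu>) [0..<i]"
    and B: "map (?f (\<mu> + Poly_Mapping.single i 1)) [Suc i..<M] = map (?f \<mu>) [Suc i..<M]"
    by (auto simp: lookup_add lookup_single)
  have "cas_mon n (\<mu> + Poly_Mapping.single i 1) = ?A * ?f \<mu> i * (casR n (i + 1) * ?B)"
    unfolding eq[OF k] split
    by (simp only: map_append list.map prod_list.append prod_list.Cons A B)
      (simp add: lookup_add lookup_single power_Suc2 mult.assoc del: power_Suc)
  moreover have "cas_mon n \<mu> = ?A * ?f \<mu> i * ?B"
    using M by (subst eq) (simp_all add: split mult.assoc)
  moreover have "casR_comm n (i + 1) ?B"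
    by (rule casR_comm_prod_list) (auto intro!: casR_comm_power casR_comm_casR simp del: One_nat_def)
  then have "gl_cong n (?A * ?f \<mu> i * (casR n (i + 1) * ?B)) (?A * ?f \<mu> i * (?B * casR n (i + 1)))"
    by (intro gl_cong_mult_left gl_cong_sym[of n "?B * casR n (i + 1)"])
      (auto simp: casR_comm_def intro!: gl_free_mult gl_free_prod_list gl_free_power simp del: One_nat_def)
  ultimately show ?thesis by (simp add: mult.assoc)
qed

lemma csR_add: "csR n (p + q) = csR n p + csR n q"
  unfolding csR_def by (rule sum_keys_add) (simp_all add: nc_const_add distrib_right)

lemma csR_single: "csR n (Poly_Mapping.single \<mu> c) = nc_const (poly c (of_nat n)) * cas_mon n \<mu>"
  by (simp add: csR_def)

lemma csR_mult_indet:
  assumes "1 \<le> r"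
  shows "gl_cong n (csR n (p * indet r)) (csR n p * casR n r)"
proof (induction p rule: poly_mapping_induct)
  case (single \<mu> c)
  show ?case
    using cas_mon_add_single[of n \<mu> "r - 1"] assms
    by (simp add: indet_def mult_single csR_single mult.assoc gl_cong_mult_left)
next
  case (add p q)
  then show ?case by (simp add: distrib_right csR_add gl_cong_add)
qed

lemma csR_formal_N: "csR n (coef formal_N * p) = of_nat n * csR n p"
  by (induction p rule: poly_mapping_induct)
    (simp_all add: coef_def mult_single csR_single formal_N_def distrib_left csR_add nc_const_mult
      nc_const_of_nat mult.assoc)

text \<open>A single polynomial has to serve all n at once; this uniformity is what universality
  means.\<close>

definition cas_rep :: "(nat \<Rightarrow> (nat \<times> nat) ncpoly) \<Rightarrow> bool" where
  "cas_rep X \<longleftrightarrow> (\<exists>p. \<forall>n\<ge>1. gl_cong n (X n) (csR n p))"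

lemma cas_rep_1: "cas_rep (\<lambda>n. 1)"
proof -
  have "csR n 1 = 1" for n
    unfolding single_one[symmetric] csR_single by (simp add: cas_mon_def nc_const_def)
  then show ?thesis unfolding cas_rep_def by (metis gl_cong_refl)
qed

lemma cas_rep_add: "cas_rep X \<Longrightarrow> cas_rep Y \<Longrightarrow> cas_rep (\<lambda>n. X n + Y n)"
  unfolding cas_rep_def by (metis csR_add gl_cong_add)

lemma cas_rep_diff: "cas_rep X \<Longrightarrow> cas_rep Y \<Longrightarrow> cas_rep (\<lambda>n. X n - Y n)"
proof -
  have "csR n (p - q) = csR n p - csR n q" for n p q
    using csR_add[of n "p - q" q] by simp
  then show "cas_rep X \<Longrightarrow> cas_rep Y \<Longrightarrow> cas_rep (\<lambda>n. X n - Y n)"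
    unfolding cas_rep_def by (metis gl_cong_diff)
qed

lemma cas_rep_cong: "(\<And>n. n \<ge> 1 \<Longrightarrow> gl_cong n (X n) (Y n)) \<Longrightarrow> cas_rep Y \<Longrightarrow> cas_rep X"
  unfolding cas_rep_def by (metis gl_cong_trans)

lemma cas_rep_of_nat: "cas_rep X \<Longrightarrow> cas_rep (\<lambda>n. of_nat n * X n)"
proof -
  assume "cas_rep X"
  then obtain p where p: "\<And>n. n \<ge> 1 \<Longrightarrow> gl_cong n (X n) (csR n p)" unfolding cas_rep_def by blast
  have "gl_cong n (of_nat n * X n) (csR n (coef formal_N * p))" if "n \<ge> 1" for n
    using gl_cong_mult_left[OF p[OF that] gl_free_const[of "of_nat n"]]
    by (simp add: csR_formal_N nc_const_of_nat)
  then show ?thesis unfolding cas_rep_def by blast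
qed

lemma cas_rep_casR:
  assumes "cas_rep X" "1 \<le> r"
  shows "cas_rep (\<lambda>n. casR n r * X n)"
proof -
  obtain p where p: "\<And>n. n \<ge> 1 \<Longrightarrow> gl_cong n (X n) (csR n p)" using assms unfolding cas_rep_def by blast
  have comm: "casR_comm n r (csR n p)" for n
  proof -
    have "casR_comm n r (nc_const c)" for c
      by (simp add: casR_comm_def nc_const_commute)
    then show ?thesis unfolding csR_def cas_mon_def
      by (intro casR_comm_sum casR_comm_mult casR_comm_prod_list) (auto intro!: casR_comm_power casR_comm_casR simp del: One_nat_def)
  qed
  have "gl_cong n (casR n r * X n) (csR n (p * indet r))" if "n \<ge> 1" for n
  proof -
    have "gl_cong n (casR n r * X n) (casR n r * csR n p)"
      by (intro gl_cong_mult_left p that) simp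
    also have "gl_cong n \<dots> (csR n p * casR n r)"
      using comm by (simp add: casR_comm_def gl_cong_sym)
    also have "gl_cong n \<dots> (csR n (p * indet r))"
      by (rule gl_cong_sym[OF csR_mult_indet[OF assms(2)]])
    finally show ?thesis .
  qed
  then show ?thesis unfolding cas_rep_def by blast
qed

text \<open>A chord diagram in which part of a cycle starting at \<open>a\<close> and ending at \<open>b\<close> has already been
  contracted to the matrix entry \<open>(E\<^sup>r)\<^sub>a\<^sub>b\<close>; labels in \<open>L\<close> that do not occur contribute a factor \<open>N\<close> each.\<close>

definition word_of :: "(nat \<Rightarrow> nat) \<Rightarrow> (nat \<times> nat) list \<Rightarrow> (nat \<times> nat) ncpoly" where
  "word_of i zs = prod_list (map (\<lambda>(c, d). nc_gen (i c, i d)) zs)"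

definition diag_sum :: "nat \<Rightarrow> nat set \<Rightarrow> nat \<Rightarrow> nat \<Rightarrow> nat \<Rightarrow> (nat \<times> nat) list \<Rightarrow> (nat \<times> nat) ncpoly" where
  "diag_sum n L r a b zs = (\<Sum>i\<in>L \<rightarrow>\<^sub>E {1..n}. E_pow n r (i a) (i b) * word_of i zs)"

text \<open>The pairs form the graph of a permutation of some of the labels. The contracted path
  from a to b counts as a pair too, so the condition is imposed on
  \<open>(a, b) # zs\<close>.\<close>

definition diag_ok :: "nat set \<Rightarrow> (nat \<times> nat) list \<Rightarrow> bool" where
  "diag_ok L ps \<longleftrightarrow> finite L \<and> distinct (map fst ps) \<and> distinct (map snd ps)
     \<and> fst ` set ps = snd ` set ps \<and> fst ` set ps \<subseteq> L"

lemma diag_ok_mem: "diag_ok L ps \<Longrightarrow> (c, d) \<in> set ps \<Longrightarrow> c \<in> L \<and> d \<in> L"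
  unfolding diag_ok_def by (metis fst_conv image_eqI snd_conv subsetD)

lemma diag_ok_perm:
  assumes "diag_ok L ps" "mset ps = mset qs"
  shows "diag_ok L qs"
proof -
  have "distinct (map f ps) = distinct (map f qs)" for f :: "nat \<times> nat \<Rightarrow> nat"
    by (rule mset_eq_imp_distinct_iff) (simp add: assms(2))
  moreover have "set ps = set qs" using assms(2) by (rule mset_eq_setD)
  ultimately show ?thesis using assms(1) unfolding diag_ok_def by metis
qed

lemma diag_ok_tail:
  assumes "diag_ok L ((a, a) # ps)"
  shows "diag_ok (L - {a}) ps"
proof -
  have d: "distinct (map fst ((a, a) # ps))" "distinct (map snd ((a, a) # ps))"
    using assms by (simp_all only: diag_ok_def)
  have F: "fst ` set ps = fst ` set ((a, a) # ps) - {a}" and S: "snd ` set ps = snd ` set ((a, a) # ps) - {a}"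
    using d by auto
  have d': "distinct (map fst ps)" "distinct (map snd ps)" using d by auto
  show ?thesis using assms d' unfolding diag_ok_def F S by blast
qed

lemma diag_ok_join:
  assumes "diag_ok L ((a, b) # (b, c) # ps)" "a \<noteq> b"
  shows "diag_ok (L - {b}) ((a, c) # ps)"
proof -
  have d: "distinct (map fst ((a, b) # (b, c) # ps))" "distinct (map snd ((a, b) # (b, c) # ps))"
    using assms by (simp_all only: diag_ok_def)
  have F: "fst ` set ((a, c) # ps) = fst ` set ((a, b) # (b, c) # ps) - {b}"
    using d(1) assms(2) by auto
  have S: "snd ` set ((a, c) # ps) = snd ` set ((a, b) # (b, c) # ps) - {b}"
    using d(2) by auto
  have d': "distinct (map fst ((a, c) # ps))" "distinct (map snd ((a, c) # ps))"
    using d by auto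
  show ?thesis using assms(1) d' unfolding diag_ok_def F S by blast
qed

lemma diag_ok_snd_ex:
  assumes "diag_ok L ps" "(c, d) \<in> set ps"
  shows "\<exists>e. (d, e) \<in> set ps"
proof -
  have "d \<in> snd ` set ps" using assms(2) by force
  then have "d \<in> fst ` set ps" using assms(1) by (simp add: diag_ok_def)
  then show ?thesis by auto
qed

lemma word_of_append: "word_of i (xs @ ys) = word_of i xs * word_of i ys"
  and word_of_Cons: "word_of i ((c, d) # xs) = nc_gen (i c, i d) * word_of i xs"
  and word_of_Nil: "word_of i [] = 1"
  by (simp_all add: word_of_def)

lemma word_of_free:
  assumes "\<And>c d. (c, d) \<in> set zs \<Longrightarrow> i c \<in> {1..n} \<and> i d \<in> {1..n}"
  shows "word_of i zs \<in> gl_free n"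
  unfolding word_of_def by (rule gl_free_prod_list) (use assms in \<open>auto intro!: gl_free_gen\<close>)

lemma word_of_cong: "(\<And>c d. (c, d) \<in> set zs \<Longrightarrow> i c = j c \<and> i d = j d) \<Longrightarrow> word_of i zs = word_of j zs"
  unfolding word_of_def by (intro arg_cong[of _ _ prod_list] map_cong) auto

lemma word_of_map: "word_of i (map (map_prod \<sigma> \<sigma>) zs) = word_of (i \<circ> \<sigma>) zs"
  unfolding word_of_def by (simp add: comp_def case_prod_unfold)

text \<open>Handles one of the two terms of a commutator, whose Kronecker delta identifies the
  indices at \<open>q\<close> and \<open>s\<close>. If q = s, the two chords merge and s stays
  behind as a free label; otherwise s is renamed to q. Renaming may affect the ends of the
  contracted path, hence the hypothesis for all L, a and b.\<close>

lemma cas_rep_contraction: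
  assumes ok: "diag_ok L ((a, b) # u @ (p, q) # (s, t) # w)"
    and IH: "\<And>L a b zs. length zs < length (u @ (p, q) # (s, t) # w) \<Longrightarrow> diag_ok L ((a, b) # zs)
      \<Longrightarrow> cas_rep (\<lambda>n. diag_sum n L r a b zs)"
  shows "cas_rep (\<lambda>n. \<Sum>i\<in>L \<rightarrow>\<^sub>E {1..n}. if i q = i s
     then E_pow n r (i a) (i b) * word_of i (u @ (p, t) # w) else 0)"
proof (cases "q = s")
  case True
  have d: "distinct (map fst ((a, b) # u @ (p, q) # (s, t) # w))" "distinct (map snd ((a, b) # u @ (p, q) # (s, t) # w))"
    using ok by (simp_all only: diag_ok_def)
  have F: "fst ` set ((a, b) # u @ (p, t) # w) = fst ` set ((a, b) # u @ (p, q) # (s, t) # w) - {s}"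
    using d(1) by auto
  have S: "snd ` set ((a, b) # u @ (p, t) # w) = snd ` set ((a, b) # u @ (p, q) # (s, t) # w) - {s}"
    using d(2) True by auto
  have d': "distinct (map fst ((a, b) # u @ (p, t) # w))" "distinct (map snd ((a, b) # u @ (p, t) # w))"
    using d by auto
  have "diag_ok L ((a, b) # u @ (p, t) # w)"
    using ok d' unfolding diag_ok_def F S by blast
  from IH[OF _ this] show ?thesis unfolding True by (simp add: diag_sum_def)
next
  case False
  define \<sigma> where "\<sigma> x = (if x = s then q else x)" for x
  have s: "s \<in> L" and q: "q \<in> L - {s}"
    using diag_ok_mem[OF ok, of s t] diag_ok_mem[OF ok, of p q] False by auto
  let ?zs = "u @ (p, t) # w"
  have "(\<Sum>i\<in>L \<rightarrow>\<^sub>E {1..n}. if i q = i s then E_pow n r (i a) (i b) * word_of i ?zs else 0)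
    = diag_sum n (L - {s}) r (\<sigma> a) (\<sigma> b) (map (map_prod \<sigma> \<sigma>) ?zs)" for n
    unfolding diag_sum_def
  proof (subst sum_PiE_split[OF s], rule sum.cong[OF refl])
    fix i assume i: "i \<in> L - {s} \<rightarrow>\<^sub>E {1..n}"
    have iq: "i q \<in> {1..n}" using i q by (auto simp: PiE_iff)
    have upd: "i(s := i q) = i \<circ> \<sigma>" by (auto simp: \<sigma>_def fun_eq_iff)
    have "(\<Sum>x\<in>{1..n}. if (i(s := x)) q = (i(s := x)) s then E_pow n r ((i(s := x)) a) ((i(s := x)) b) * word_of (i(s := x)) ?zs else 0)
      = (\<Sum>x\<in>{1..n}. if i q = x then E_pow n r ((i \<circ> \<sigma>) a) ((i \<circ> \<sigma>) b) * word_of (i \<circ> \<sigma>) ?zs else 0)"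
      using False upd by (intro sum.cong) (auto simp: \<sigma>_def)
    also have "\<dots> = E_pow n r (i (\<sigma> a)) (i (\<sigma> b)) * word_of i (map (map_prod \<sigma> \<sigma>) ?zs)"
      using iq unfolding word_of_map by simp
    finally show "(\<Sum>x\<in>{1..n}. if (i(s := x)) q = (i(s := x)) s then E_pow n r ((i(s := x)) a) ((i(s := x)) b) * word_of (i(s := x)) ?zs else 0)
      = E_pow n r (i (\<sigma> a)) (i (\<sigma> b)) * word_of i (map (map_prod \<sigma> \<sigma>) ?zs)" .
  qed
  moreover have "cas_rep (\<lambda>n. diag_sum n (L - {s}) r (\<sigma> a) (\<sigma> b) (map (map_prod \<sigma> \<sigma>) ?zs))"
  proof (rule IH)
    let ?ps = "(a, b) # ?zs"
    have dd: "distinct (map fst ((a, b) # u @ (p, q) # (s, t) # w))" "distinct (map snd ((a, b) # u @ (p, q) # (s, t) # w))"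
      using ok by (simp_all only: diag_ok_def)
    have "s \<notin> fst ` set ?ps" using dd(1) by auto
    then have fst: "map fst (map (map_prod \<sigma> \<sigma>) ?ps) = map fst ?ps"
      by (auto simp: \<sigma>_def)
    have F: "fst ` set ?ps = fst ` set ((a, b) # u @ (p, q) # (s, t) # w) - {s}"
      using dd(1) by auto
    have S: "snd ` set ?ps = snd ` set ((a, b) # u @ (p, q) # (s, t) # w) - {q}"
      using dd(2) by auto
    have d: "distinct (map snd ?ps)" using dd(2) by auto
    \<comment> \<open>After the merger q no longer occurs as a second entry, so renaming s to q
      causes no collision.\<close>
    have inj: "inj_on \<sigma> (snd ` set ?ps)" unfolding S by (auto simp: inj_on_def \<sigma>_def)
    have snd: "map snd (map (map_prod \<sigma> \<sigma>) ps) = map \<sigma> (map snd ps)" for ps by simp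
    have d2: "distinct (map snd (map (map_prod \<sigma> \<sigma>) ?ps))"
      unfolding snd using d inj unfolding distinct_map[of \<sigma>] by (simp only: list.set_map)
    have image: "\<sigma> ` (G - {q}) = G - {s}" if "s \<in> G" "q \<in> G" for G
    proof -
      have "\<sigma> ` (G - {q, s}) = (\<lambda>x. x) ` (G - {q, s})" by (rule image_cong) (auto simp: \<sigma>_def)
      moreover have "G - {q} = insert s (G - {q, s})" "\<sigma> s = q" using that False by (auto simp: \<sigma>_def)
      ultimately show ?thesis using that False by auto
    qed
    have "snd ` set (map (map_prod \<sigma> \<sigma>) ?ps) = \<sigma> ` (snd ` set ?ps)"
      using arg_cong[OF snd[of ?ps], of set] by (simp only: list.set_map)
    also have "\<dots> = snd ` set ((a, b) # u @ (p, q) # (s, t) # w) - {s}"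
    proof -
      have "s \<in> fst ` set ((a, b) # u @ (p, q) # (s, t) # w)" "q \<in> snd ` set ((a, b) # u @ (p, q) # (s, t) # w)"
        by auto
      then have "s \<in> snd ` set ((a, b) # u @ (p, q) # (s, t) # w)" "q \<in> snd ` set ((a, b) # u @ (p, q) # (s, t) # w)"
        using ok by (simp_all only: diag_ok_def)
      then show ?thesis unfolding S by (rule image)
    qed
    finally have S': "snd ` set (map (map_prod \<sigma> \<sigma>) ?ps) = snd ` set ((a, b) # u @ (p, q) # (s, t) # w) - {s}" .
    have F': "fst ` set (map (map_prod \<sigma> \<sigma>) ?ps) = fst ` set ?ps"
      using arg_cong[OF fst, of set] by (simp only: list.set_map)
    have d1: "distinct (map fst (map (map_prod \<sigma> \<sigma>) ?ps))" unfolding fst using dd(1) by auto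
    have "diag_ok (L - {s}) (map (map_prod \<sigma> \<sigma>) ?ps)"
      using ok d1 d2 unfolding diag_ok_def F' S' F by blast
    then show "diag_ok (L - {s}) ((\<sigma> a, \<sigma> b) # map (map_prod \<sigma> \<sigma>) ?zs)" by simp
  qed simp
  ultimately show ?thesis by simp
qed

lemma cas_rep_swap:
  assumes ok: "diag_ok L ((a, b) # u @ x # y # w)"
    and IH: "\<And>L a b zs. length zs < length (u @ x # y # w) \<Longrightarrow> diag_ok L ((a, b) # zs)
      \<Longrightarrow> cas_rep (\<lambda>n. diag_sum n L r a b zs)"
    and swapped: "cas_rep (\<lambda>n. diag_sum n L r a b (u @ y # x # w))"
  shows "cas_rep (\<lambda>n. diag_sum n L r a b (u @ x # y # w))"
proof -
  obtain p q s t where xy: "x = (p, q)" "y = (s, t)" by (cases x, cases y)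
  have ok': "diag_ok L ((a, b) # u @ y # x # w)" by (rule diag_ok_perm[OF ok]) simp
  define X1 where "X1 n = (\<Sum>i\<in>L \<rightarrow>\<^sub>E {1..n}. if i q = i s
     then E_pow n r (i a) (i b) * word_of i (u @ (p, t) # w) else 0)" for n
  define X2 where "X2 n = (\<Sum>i\<in>L \<rightarrow>\<^sub>E {1..n}. if i t = i p
     then E_pow n r (i a) (i b) * word_of i (u @ (s, q) # w) else 0)" for n
  have "cas_rep X1"
    unfolding X1_def
  proof (rule cas_rep_contraction[where u = u and p = p and q = q and s = s and t = t and w = w and L = L and r = r])
    show "diag_ok L ((a, b) # u @ (p, q) # (s, t) # w)" using ok by (simp add: xy)
  qed (use IH in \<open>simp add: xy\<close>)
  moreover have "cas_rep X2"
    unfolding X2_def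
  proof (rule cas_rep_contraction[where u = u and p = s and q = t and s = p and t = q and w = w and L = L and r = r])
    show "diag_ok L ((a, b) # u @ (s, t) # (p, q) # w)" using ok' by (simp add: xy)
  qed (use IH in \<open>simp add: xy\<close>)
  ultimately have X: "cas_rep X1" "cas_rep X2" .
  have "gl_cong n (diag_sum n L r a b (u @ x # y # w))
     (diag_sum n L r a b (u @ y # x # w) + (X1 n - X2 n))" for n
  proof -
    have "gl_cong n (E_pow n r (i a) (i b) * word_of i (u @ x # y # w))
       (E_pow n r (i a) (i b) * word_of i (u @ y # x # w) +
        ((if i q = i s then E_pow n r (i a) (i b) * word_of i (u @ (p, t) # w) else 0) -
         (if i t = i p then E_pow n r (i a) (i b) * word_of i (u @ (s, q) # w) else 0)))"
      if i: "i \<in> L \<rightarrow>\<^sub>E {1..n}" for i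
    proof -
      have L: "l \<in> L \<Longrightarrow> i l \<in> {1..n}" for l using i by (auto simp: PiE_iff)
      have ps: "c \<in> L \<and> d \<in> L" if "(c, d) \<in> set ((a, b) # u @ (p, q) # (s, t) # w)" for c d
        using that diag_ok_mem[OF ok, unfolded xy] by blast
      have mem: "i c \<in> {1..n} \<and> i d \<in> {1..n}" if "(c, d) \<in> set ((a, b) # u @ (p, q) # (s, t) # w)" for c d
        using ps[OF that] L by blast
      have "E_pow n r (i a) (i b) \<in> gl_free n" using mem[of a b] by simp
      moreover have "word_of i u \<in> gl_free n" by (rule word_of_free, rule mem) simp
      moreover have "word_of i w \<in> gl_free n" by (rule word_of_free, rule mem) simp
      ultimately have free: "E_pow n r (i a) (i b) * word_of i u \<in> gl_free n" "word_of i w \<in> gl_free n"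
        by auto
      have "gl_cong n (nc_gen (i p, i q) * nc_gen (i s, i t)) (nc_gen (i s, i t) * nc_gen (i p, i q) + gl_comm (i p) (i q) (i s) (i t))"
        by (intro gl_cong_commutator L) (use ps in auto)
      from gl_cong_mult_right[OF gl_cong_mult_left[OF this free(1)] free(2)]
      show ?thesis
        by (auto simp: xy word_of_append word_of_Cons gl_comm_def algebra_simps)
    qed
    then have "gl_cong n (diag_sum n L r a b (u @ x # y # w))
      (\<Sum>i\<in>L \<rightarrow>\<^sub>E {1..n}. E_pow n r (i a) (i b) * word_of i (u @ y # x # w) +
        ((if i q = i s then E_pow n r (i a) (i b) * word_of i (u @ (p, t) # w) else 0) -
         (if i t = i p then E_pow n r (i a) (i b) * word_of i (u @ (s, q) # w) else 0)))"
      unfolding diag_sum_def by (intro gl_cong_sum) auto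
    then show ?thesis
      by (simp add: sum.distrib sum_subtractf diag_sum_def X1_def X2_def)
  qed
  then show ?thesis
    by (rule cas_rep_cong) (intro cas_rep_add cas_rep_diff X swapped)
qed

lemma cas_rep_move_front:
  assumes IH: "\<And>L a b zs. length zs < length (u @ x # w) \<Longrightarrow> diag_ok L ((a, b) # zs)
      \<Longrightarrow> cas_rep (\<lambda>n. diag_sum n L r a b zs)"
    and "diag_ok L ((a, b) # u @ x # w)"
    and "cas_rep (\<lambda>n. diag_sum n L r a b (x # u @ w))"
  shows "cas_rep (\<lambda>n. diag_sum n L r a b (u @ x # w))"
  using assms
proof (induction u arbitrary: w rule: rev_induct)
  case (snoc y u)
  have "cas_rep (\<lambda>n. diag_sum n L r a b (u @ x # y # w))"
  proof (rule snoc.IH)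
    show "cas_rep (\<lambda>n. diag_sum n L r a b zs)" if "length zs < length (u @ x # y # w)" "diag_ok L ((a, b) # zs)" for L a b zs
      using snoc.prems(1)[of zs L a b] that by simp
    show "diag_ok L ((a, b) # u @ x # y # w)" by (rule diag_ok_perm[OF snoc.prems(2)]) simp
    show "cas_rep (\<lambda>n. diag_sum n L r a b (x # u @ y # w))" using snoc.prems(3) by simp
  qed
  then have "cas_rep (\<lambda>n. diag_sum n L r a b (u @ y # x # w))"
    by (rule cas_rep_swap[rotated 2]) (use snoc.prems(1,2) in simp_all)
  then show ?case by simp
qed simp

lemma sum_PiE_const_cas_rep: "finite L \<Longrightarrow> cas_rep (\<lambda>n. \<Sum>i\<in>L \<rightarrow>\<^sub>E {1..n}. 1)"
proof (induction L rule: finite_induct)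
  case empty
  show ?case by (simp add: cas_rep_1)
next
  case (insert a L)
  have "(\<Sum>i\<in>insert a L \<rightarrow>\<^sub>E {1..n}. 1) = of_nat n * (\<Sum>i\<in>L \<rightarrow>\<^sub>E {1..n}. (1 :: (nat \<times> nat) ncpoly))" for n
    using insert by (subst sum_PiE_split[of a]) (simp_all add: mult.commute of_nat_mult[symmetric] del: of_nat_mult)
  then show ?case using cas_rep_of_nat[OF insert.IH] by simp
qed

lemma E_pow_1: "i \<in> {1..n} \<Longrightarrow> E_pow n (Suc 0) i j = nc_gen (i, j)"
  by (simp add: if_distrib[of "\<lambda>x. x * _"] cong: if_cong)

text \<open>Induction on the number of chords outside the contracted path. An open path absorbs the
  chord that starts at its end b, once that chord has been moved to the front, and r grows by one. A
  closed path is a Casimir element, and the next cycle starts with r = 1; thus r stays positive, as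
  it must in the absence of a variable C_0.\<close>

lemma cas_rep_diag_sum:
  "diag_ok L ((a, b) # zs) \<Longrightarrow> 1 \<le> r \<Longrightarrow> cas_rep (\<lambda>n. diag_sum n L r a b zs)"
proof (induction "length zs" arbitrary: L r a b zs rule: less_induct)
  case less
  note ok = less.prems(1)
  show ?case
  proof (cases "a = b")
    case True
    have a: "a \<in> L" using diag_ok_mem[OF ok, of a b] by simp
    have okt: "diag_ok (L - {a}) zs" using ok True diag_ok_tail by simp
    have na: "c \<noteq> a \<and> d \<noteq> a" if "(c, d) \<in> set zs" for c d
      using diag_ok_mem[OF okt that] by simp
    have "diag_sum n L r a b zs = casR n r * (\<Sum>i\<in>(L - {a}) \<rightarrow>\<^sub>E {1..n}. word_of i zs)" for n
    proof -
      have "word_of (i(a := x)) zs = word_of i zs" for i x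
        by (rule word_of_cong) (use na in auto)
      then show ?thesis
        unfolding diag_sum_def True[symmetric]
        by (subst sum_PiE_split[OF a]) (simp add: casR_def sum_distrib_left sum_distrib_right flip: sum.swap[of _ "{Suc 0..n}"])
    qed
    moreover have "cas_rep (\<lambda>n. \<Sum>i\<in>(L - {a}) \<rightarrow>\<^sub>E {1..n}. word_of i zs)"
    proof (cases zs)
      case Nil
      have "finite (L - {a})" using ok by (simp add: diag_ok_def)
      from sum_PiE_const_cas_rep[OF this] show ?thesis unfolding Nil word_of_Nil .
    next
      case (Cons z zs')
      obtain c d where z: "z = (c, d)" by (cases z)
      have ok': "diag_ok (L - {a}) ((c, d) # zs')"
        using okt unfolding z Cons .
      have "cas_rep (\<lambda>n. diag_sum n (L - {a}) 1 c d zs')"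
        by (rule less.hyps) (use Cons ok' in auto)
      moreover have "diag_sum n (L - {a}) 1 c d zs' = (\<Sum>i\<in>(L - {a}) \<rightarrow>\<^sub>E {1..n}. word_of i zs)" for n
        unfolding diag_sum_def
      proof (rule sum.cong[OF refl])
        fix i assume "i \<in> L - {a} \<rightarrow>\<^sub>E {1..n}"
        moreover have "c \<in> L - {a}" using diag_ok_mem[OF ok', of c d] by simp
        ultimately have "i c \<in> {1..n}" by (auto simp: PiE_iff)
        then show "E_pow n 1 (i c) (i d) * word_of i zs' = word_of i zs"
          using E_pow_1[of "i c" n "i d"] by (simp add: Cons z word_of_Cons del: E_pow.simps)
      qed
      ultimately show ?thesis by simp
    qed
    ultimately show ?thesis using cas_rep_casR[OF _ less.prems(2)] by simp
  next
    case False
    obtain c where "(b, c) \<in> set zs"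
      using diag_ok_snd_ex[OF ok, of a b] False by auto
    then obtain u w where zs: "zs = u @ (b, c) # w" by (meson split_list)
    have b: "b \<in> L" using diag_ok_mem[OF ok, of a b] by simp
    have "diag_ok L ((a, b) # (b, c) # u @ w)" by (rule diag_ok_perm[OF ok]) (simp add: zs)
    then have ok': "diag_ok (L - {b}) ((a, c) # u @ w)" using False by (rule diag_ok_join)
    have nb: "x \<noteq> b \<and> y \<noteq> b" if "(x, y) \<in> set (u @ w)" for x y
      using diag_ok_mem[OF ok', of x y] that by auto
    have cb: "c \<noteq> b" using diag_ok_mem[OF ok', of a c] by simp
    have "diag_sum n L r a b ((b, c) # u @ w) = diag_sum n (L - {b}) (Suc r) a c (u @ w)" for n
    proof -
      have "word_of (i(b := x)) (u @ w) = word_of i (u @ w)" for i x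
        by (rule word_of_cong) (use nb in auto)
      then show ?thesis
        unfolding diag_sum_def using False cb
        by (subst sum_PiE_split[OF b]) (simp add: sum_distrib_right word_of_Cons mult.assoc)
    qed
    moreover have "cas_rep (\<lambda>n. diag_sum n (L - {b}) (Suc r) a c (u @ w))"
      by (rule less.hyps) (use ok' in \<open>simp_all add: zs\<close>)
    ultimately have "cas_rep (\<lambda>n. diag_sum n L r a b ((b, c) # u @ w))" by simp
    then show ?thesis
      unfolding zs by (rule cas_rep_move_front[rotated 2]) (use less zs in simp_all)
  qed
qed

lemma cas_rep_wR:
  assumes "1 \<le> m" "\<alpha> permutes {1..m}"
  shows "cas_rep (\<lambda>n. wR n m \<alpha>)"
proof -
  define zs where "zs = map (\<lambda>k. (k, \<alpha> k)) [2..<Suc m]"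
  have l: "[1..<Suc m] = 1 # [2..<Suc m]" using assms(1) by (simp add: upt_rec numeral_2_eq_2)
  have ps: "(1, \<alpha> 1) # zs = map (\<lambda>k. (k, \<alpha> k)) [1..<Suc m]" unfolding zs_def l by simp
  have inj: "inj \<alpha>" and im: "\<alpha> ` {1..m} = {1..m}" using assms(2) permutes_inj permutes_image by blast+
  have set: "set [1..<Suc m] = {1..m}" by auto
  have "diag_ok {1..m} ((1, \<alpha> 1) # zs)"
    unfolding ps diag_ok_def using im inj
    by (simp only: map_map comp_def fst_conv snd_conv list.set_map set image_image)
      (auto simp: distinct_map intro: inj_on_subset)
  then have "cas_rep (\<lambda>n. diag_sum n {1..m} 1 1 (\<alpha> 1) zs)" by (rule cas_rep_diag_sum) simp
  moreover have "diag_sum n {1..m} 1 1 (\<alpha> 1) zs = wR n m \<alpha>" for n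
    unfolding diag_sum_def wR_def
  proof (rule sum.cong[OF refl])
    fix i assume "i \<in> {1..m} \<rightarrow>\<^sub>E {1..n}"
    then have "i 1 \<in> {1..n}" using assms(1) by (auto simp: PiE_iff simp del: One_nat_def)
    then have "E_pow n 1 (i 1) (i (\<alpha> 1)) * word_of i zs = word_of i ((1, \<alpha> 1) # zs)"
      using E_pow_1[of "i 1" n] by (simp add: word_of_Cons del: E_pow.simps)
    also have "\<dots> = prod_list (map (\<lambda>k. nc_gen (i k, i (\<alpha> k))) [1..<Suc m])"
      unfolding ps word_of_def by (simp add: comp_def)
    finally show "E_pow n 1 (i 1) (i (\<alpha> 1)) * word_of i zs = \<dots>" .
  qed
  ultimately show ?thesis by simp
qed

lemma ex_w_gl:
  assumes "1 \<le> m" "\<alpha> permutes {1..m}"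
  shows "\<exists>p. \<forall>n\<ge>1. casimir_subst n p = w_glN n m \<alpha>"
proof -
  obtain p where p: "\<And>n. n \<ge> 1 \<Longrightarrow> gl_cong n (wR n m \<alpha>) (csR n p)"
    using cas_rep_wR[OF assms] unfolding cas_rep_def by blast
  then have "casimir_subst n p = w_glN n m \<alpha>" if "n \<ge> 1" for n
    using that by (simp add: casimir_subst_eq w_glN_eq[OF assms(2)] U_class_eq_iff wR_free[OF assms(2)] gl_cong_sym)
  then show ?thesis by blast
qed

section \<open>Vanishing of universal polynomials\<close>

lemma base_digits_inj:
  fixes a b :: "nat \<Rightarrow> nat"
  assumes "\<And>i. i < M \<Longrightarrow> a i < B" "\<And>i. i < M \<Longrightarrow> b i < B"
    and "(\<Sum>i<M. a i * B ^ i) = (\<Sum>i<M. b i * B ^ i)" "i < M"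
  shows "a i = b i"
  using assms
proof (induction M arbitrary: a b i)
  case (Suc M)
  have sum: "(\<Sum>i<Suc M. c i * B ^ i) = c 0 + B * (\<Sum>i<M. c (Suc i) * B ^ i)" for c :: "nat \<Rightarrow> nat"
    by (simp add: sum.lessThan_Suc_shift sum_distrib_left mult_ac del: sum.lessThan_Suc)
  have eq: "a 0 + B * (\<Sum>i<M. a (Suc i) * B ^ i) = b 0 + B * (\<Sum>i<M. b (Suc i) * B ^ i)"
    using Suc.prems(3) unfolding sum .
  have lt: "a 0 < B" "b 0 < B" using Suc.prems(1)[of 0] Suc.prems(2)[of 0] by simp_all
  then have a0: "a 0 = b 0" using arg_cong[OF eq, of "\<lambda>x. x mod B"] by simp
  then have s: "(\<Sum>i<M. a (Suc i) * B ^ i) = (\<Sum>i<M. b (Suc i) * B ^ i)"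
    using eq lt by simp
  show ?case
  proof (cases i)
    case 0
    then show ?thesis using a0 by simp
  next
    case (Suc j)
    then show ?thesis
      using Suc.IH[of "\<lambda>i. a (Suc i)" "\<lambda>i. b (Suc i)" j] Suc.prems s by simp
  qed
qed simp

lemma poly_eq_0_of_nats:
  fixes q :: "complex poly"
  assumes "\<And>k. k \<ge> k0 \<Longrightarrow> poly q (of_nat k) = 0"
  shows "q = 0"
proof (rule ccontr)
  assume "q \<noteq> 0"
  then have "finite {x. poly q x = 0}" by (rule poly_roots_finite)
  moreover have "of_nat ` {k0..} \<subseteq> {x. poly q x = 0}" using assms by auto
  ultimately have "finite (of_nat ` {k0..} :: complex set)" by (rule finite_subset[rotated])
  then have "finite {k0..}" by (rule finite_imageD) (simp add: inj_on_def)
  then show False by (simp add: infinite_Ici)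
qed

definition var_bound :: "nat \<Rightarrow> gl_poly \<Rightarrow> bool" where
  "var_bound M p \<longleftrightarrow> (\<forall>\<mu>\<in>Poly_Mapping.keys p. Poly_Mapping.keys \<mu> \<subseteq> {..<M})"

lemma ex_var_bound: "\<exists>M. var_bound M p"
proof -
  have "finite (\<Union>\<mu>\<in>Poly_Mapping.keys p. Poly_Mapping.keys \<mu>)" by simp
  then obtain M where "(\<Union>\<mu>\<in>Poly_Mapping.keys p. Poly_Mapping.keys \<mu>) \<subseteq> {..<M}"
    by (metis finite_nat_iff_bounded)
  then show ?thesis by (auto simp: var_bound_def)
qed

lemma var_bound_mono: "var_bound M p \<Longrightarrow> M \<le> M' \<Longrightarrow> var_bound M' p"
  by (force simp: var_bound_def)

lemma ev_cong:
  assumes "var_bound M p" "\<And>i. 1 \<le> i \<Longrightarrow> i \<le> M \<Longrightarrow> s i = s' i"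
  shows "ev z s p = ev z s' p"
  unfolding ev_def
proof (intro sum.cong prod.cong refl arg_cong2[of _ _ _ _ "(*)"] arg_cong2[of _ _ _ _ power])
  fix \<mu> i assume "\<mu> \<in> Poly_Mapping.keys p" "i \<in> Poly_Mapping.keys \<mu>"
  then have "i < M" using assms(1) by (auto simp: var_bound_def)
  then show "s (i + 1) = s' (i + 1)" by (intro assms(2)) simp_all
qed

lemma ev_cong': "(\<And>i. 1 \<le> i \<Longrightarrow> s i = s' i) \<Longrightarrow> ev z s p = ev z s' p"
  using ex_var_bound[of p] ev_cong by metis

text \<open>Substituting \<open>T\<^bsup>B\<^sup>i\<^esup>\<close> for the variables separates the monomials by base \<open>B\<close> digits.\<close>

lemma ev_eq_0_imp_eq_0:
  assumes "\<And>n s. n \<ge> n0 \<Longrightarrow> ev (of_nat n) s p = 0"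
  shows "p = 0"
proof (rule poly_mapping_eqI)
  fix \<mu>
  obtain M where M: "var_bound M p" using ex_var_bound by blast
  define B where "B = Suc (Max (insert 0 (\<Union>\<mu>\<in>Poly_Mapping.keys p. Poly_Mapping.lookup \<mu> ` {..<M})))"
  have B: "Poly_Mapping.lookup \<kappa> i < B" if "\<kappa> \<in> Poly_Mapping.keys p" "i < M" for \<kappa> i
    unfolding B_def less_Suc_eq_le by (rule Max_ge) (use that in auto)
  define e where "e \<kappa> = (\<Sum>i<M. Poly_Mapping.lookup \<kappa> i * B ^ i)" for \<kappa> :: "nat \<Rightarrow>\<^sub>0 nat"
  have inj: "inj_on e (Poly_Mapping.keys p)"
  proof (rule inj_onI, rule poly_mapping_eqI)
    fix \<kappa> \<kappa>' i assume k: "\<kappa> \<in> Poly_Mapping.keys p" "\<kappa>' \<in> Poly_Mapping.keys p" and eq: "e \<kappa> = e \<kappa>'"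
    show "Poly_Mapping.lookup \<kappa> i = Poly_Mapping.lookup \<kappa>' i"
    proof (cases "i < M")
      case True
      show ?thesis by (rule base_digits_inj[of M _ B]) (use B k eq True in \<open>auto simp: e_def\<close>)
    next
      case False
      then have "i \<notin> Poly_Mapping.keys \<kappa>" "i \<notin> Poly_Mapping.keys \<kappa>'" using M k by (auto simp: var_bound_def)
      then show ?thesis by (simp add: in_keys_iff)
    qed
  qed
  have "poly (Poly_Mapping.lookup p \<mu>) (of_nat n) = 0" if n: "n \<ge> n0" for n
  proof (cases "\<mu> \<in> Poly_Mapping.keys p")
    case True
    define q where "q = (\<Sum>\<kappa>\<in>Poly_Mapping.keys p. monom (poly (Poly_Mapping.lookup p \<kappa>) (of_nat n)) (e \<kappa>))"
    have "poly q T = 0" for T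
    proof -
      have "(\<Prod>i\<in>Poly_Mapping.keys \<kappa>. (T ^ B ^ i) ^ Poly_Mapping.lookup \<kappa> i) = T ^ e \<kappa>" if "\<kappa> \<in> Poly_Mapping.keys p" for \<kappa>
      proof -
        have "(\<Prod>i\<in>Poly_Mapping.keys \<kappa>. (T ^ B ^ i) ^ Poly_Mapping.lookup \<kappa> i) = (\<Prod>i<M. (T ^ B ^ i) ^ Poly_Mapping.lookup \<kappa> i)"
          by (rule prod.mono_neutral_left) (use M that in \<open>auto simp: var_bound_def in_keys_iff\<close>)
        also have "\<dots> = T ^ e \<kappa>" by (simp add: e_def power_sum mult.commute flip: power_mult)
        finally show ?thesis .
      qed
      then have "ev (of_nat n) (\<lambda>j. T ^ B ^ (j - 1)) p = poly q T"
        by (simp add: ev_def q_def poly_sum poly_monom)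
      then show ?thesis using assms[OF n] by simp
    qed
    then have "q = 0" by (metis poly_all_0_iff_0)
    moreover have "coeff q (e \<mu>) = (\<Sum>\<kappa>\<in>Poly_Mapping.keys p. if \<kappa> = \<mu> then poly (Poly_Mapping.lookup p \<kappa>) (of_nat n) else 0)"
      unfolding q_def coeff_sum coeff_monom using inj True by (intro sum.cong) (auto dest: inj_onD)
    ultimately show ?thesis using True by simp
  qed (simp add: in_keys_iff)
  then have "Poly_Mapping.lookup p \<mu> = 0" by (rule poly_eq_0_of_nats)
  then show "Poly_Mapping.lookup p \<mu> = Poly_Mapping.lookup 0 \<mu>" by simp
qed

section \<open>Density of the dominant weights\<close>

inductive polyfun :: "((nat \<Rightarrow> complex) \<Rightarrow> complex) \<Rightarrow> bool" where
  polyfun_const: "polyfun (\<lambda>_. c)"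
| polyfun_coord: "polyfun (\<lambda>x. x i)"
| polyfun_add: "polyfun f \<Longrightarrow> polyfun g \<Longrightarrow> polyfun (\<lambda>x. f x + g x)"
| polyfun_mult: "polyfun f \<Longrightarrow> polyfun g \<Longrightarrow> polyfun (\<lambda>x. f x * g x)"

lemma polyfun_sum: "(\<And>a. a \<in> A \<Longrightarrow> polyfun (f a)) \<Longrightarrow> polyfun (\<lambda>x. \<Sum>a\<in>A. f a x)"
  by (induction A rule: infinite_finite_induct) (auto intro: polyfun.intros)

lemma polyfun_prod: "(\<And>a. a \<in> A \<Longrightarrow> polyfun (f a)) \<Longrightarrow> polyfun (\<lambda>x. \<Prod>a\<in>A. f a x)"
  by (induction A rule: infinite_finite_induct) (auto intro: polyfun.intros)

lemma polyfun_power: "polyfun f \<Longrightarrow> polyfun (\<lambda>x. f x ^ k)"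
  by (induction k) (auto intro: polyfun.intros)

lemma polyfun_univariate: "polyfun f \<Longrightarrow> \<exists>q. \<forall>t. f (x(k := t)) = poly q t"
proof (induction rule: polyfun.induct)
  case (polyfun_const c)
  show ?case by (rule exI[of _ "[:c:]"]) simp
next
  case (polyfun_coord i)
  show ?case by (rule exI[of _ "if i = k then [:0, 1:] else [:x i:]"]) simp
next
  case (polyfun_add f g)
  then show ?case by (metis poly_add)
next
  case (polyfun_mult f g)
  then show ?case by (metis poly_mult)
qed

text \<open>The coordinates are freed one at a time: with the others fixed, \<open>f\<close> is a
  polynomial in the k-th coordinate that vanishes at all natural numbers.\<close>

lemma polyfun_eq_0:
  assumes f: "polyfun f" and zero: "\<And>a :: nat \<Rightarrow> nat. f (\<lambda>i. of_nat (a i)) = 0"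
    and "\<And>i. i \<ge> k \<Longrightarrow> x i \<in> \<nat>"
  shows "f x = 0"
  using assms(3)
proof (induction k arbitrary: x)
  case 0
  then have "\<forall>i. \<exists>a. x i = of_nat a" by (auto elim: Nats_cases)
  then obtain a where "\<And>i. x i = of_nat (a i)" by metis
  then have "x = (\<lambda>i. of_nat (a i))" by auto
  then show ?case using zero by simp
next
  case (Suc k)
  obtain q where q: "\<And>t. f (x(k := t)) = poly q t" using polyfun_univariate[OF f] by blast
  have "poly q (of_nat a) = 0" for a
    unfolding q[symmetric] by (rule Suc.IH) (use Suc.prems in auto)
  then have "q = 0" by (rule poly_eq_0_of_nats[of 0])
  then show ?case using q[of "x k"] by simp
qed

lemma polyfun_complete_h: "(\<And>f. f \<in> set fs \<Longrightarrow> polyfun f) \<Longrightarrow> polyfun (\<lambda>x. complete_h (map (\<lambda>f. f x) fs) k)"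
proof (induction fs arbitrary: k)
  case Nil
  show ?case by (cases k) (simp_all add: polyfun_const)
next
  case (Cons f fs)
  show ?case
  proof (induction k)
    case (Suc k)
    then show ?case using Cons by (auto intro!: polyfun_add polyfun_mult)
  qed (simp add: polyfun_const)
qed

lemma polyfun_ev: "(\<And>m. polyfun (s m)) \<Longrightarrow> polyfun (\<lambda>x. ev z (\<lambda>m. s m x) p)"
  unfolding ev_def by (intro polyfun_sum polyfun_mult polyfun_prod polyfun_power polyfun_const)

text \<open>The nonzero entries are the reciprocals of the roots, which cannot be 0 because of the
  constant term; missing degree is made up by zeros.\<close>

lemma factor_roots:
  fixes q :: "complex poly"
  assumes "degree q \<le> n" "coeff q 0 = 1"
  shows "\<exists>xs. length xs = n \<and> q = prod_list (map (\<lambda>x. [:1, - x:]) xs)"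
  using assms
proof (induction n arbitrary: q)
  case 0
  then have "q = [:1:]" by (metis degree_0_id le_zero_eq)
  then show ?case by (simp flip: one_pCons)
next
  case (Suc n)
  show ?case
  proof (cases "degree q = 0")
    case True
    then have "q = [:1:]" using Suc.prems(2) by (metis degree_0_id)
    then have "q = prod_list (map (\<lambda>x. [:1, - x:]) (replicate (Suc n) 0))"
      by (simp flip: one_pCons)
    then show ?thesis by (metis length_replicate)
  next
    case False
    then have "\<not> constant (poly q)" by (simp add: constant_degree)
    then obtain r where r: "poly q r = 0" using fundamental_theorem_of_algebra by blast
    then have "[:- r, 1:] dvd q" by (simp add: poly_eq_0_iff_dvd)
    then obtain q1 where q1: "q = [:- r, 1:] * q1" by (rule dvdE)
    have r0: "r \<noteq> 0" using r Suc.prems(2) by (auto simp: poly_0_coeff_0)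
    define q2 where "q2 = smult (- r) q1"
    have "[:- r, 1:] = smult (- r) [:1, - (1 / r):]" using r0 by simp
    then have q: "q = [:1, - (1 / r):] * q2"
      unfolding q2_def q1 by (simp only: mult_smult_left mult_smult_right)
    have "q1 \<noteq> 0" using Suc.prems(2) q1 by auto
    then have "degree q = Suc (degree q1)" unfolding q1 by (subst degree_mult_eq) auto
    then have "degree q2 \<le> n" using Suc.prems(1) r0 by (simp add: q2_def)
    moreover have "coeff q2 0 = 1" using Suc.prems(2) unfolding q by (simp add: coeff_mult)
    ultimately obtain xs where "length xs = n" "q2 = prod_list (map (\<lambda>x. [:1, - x:]) xs)" using Suc.IH by blast
    then show ?thesis using q by (intro exI[of _ "(1 / r) # xs"]) simp
  qed
qed

text \<open>The generating series of the h_i is the reciprocal of the product of the 1 - x v. So the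
  polynomial to factor is the reciprocal of the prescribed series, cut off after degree n.\<close>

lemma ex_complete_h_eq:
  "\<exists>xs. length xs = n \<and> (\<forall>i. 1 \<le> i \<longrightarrow> i \<le> n \<longrightarrow> complete_h xs i = s i)"
proof -
  define S where "S = Abs_fps (\<lambda>k. if k = 0 then 1 else s k)"
  define q where "q = (\<Sum>i\<le>n. monom (fps_nth (inverse S) i) i)"
  have S: "S * inverse S = 1" by (rule inverse_mult_eq_1') (simp add: S_def)
  have cq: "coeff q i = (if i \<le> n then fps_nth (inverse S) i else 0)" for i
    by (auto simp: q_def coeff_sum coeff_monom)
  have "degree q \<le> n" by (rule degree_le) (simp add: cq)
  moreover have "coeff q 0 = 1" by (simp add: cq S_def)
  ultimately obtain xs where xs: "length xs = n" "q = prod_list (map (\<lambda>x. [:1, - x:]) xs)"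
    using factor_roots by blast
  have lin: "fps_of_poly [:1, - x:] = 1 - fps_const x * fps_X" for x :: complex
    by (subst fps_of_poly_linear') (simp flip: fps_const_neg)
  have "fps_of_poly (prod_list (map (\<lambda>x. [:1, - x:]) xs)) = root_prod 0 xs"
    by (simp add: root_prod_def fps_of_poly_prod_list comp_def lin)
  then have H: "Abs_fps (complete_h xs) * fps_of_poly q = 1"
    using complete_h_generating[of xs] xs by simp
  let ?H = "Abs_fps (complete_h xs)"
  have "?H - S = ?H * S * (inverse S - fps_of_poly q)"
  proof -
    have "?H * S * (inverse S - fps_of_poly q) = ?H * (S * inverse S) - S * (?H * fps_of_poly q)"
      by (simp add: right_diff_distrib mult_ac)
    then show ?thesis unfolding S H by simp
  qed
  moreover have "fps_nth (?H * S * (inverse S - fps_of_poly q)) i = 0" if "i \<le> n" for i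
    using that by (auto simp: fps_mult_nth cq intro!: sum.neutral)
  ultimately have "fps_nth (?H - S) i = 0" if "i \<le> n" for i using that by simp
  then have "complete_h xs i = s i" if "1 \<le> i" "i \<le> n" for i
    using that by (fastforce simp: S_def)
  then show ?thesis using xs(1) by blast
qed

lemma ex_dom_weight: "\<exists>c. (\<forall>i\<ge>Suc n. c i = 0) \<and> (\<forall>i. 1 \<le> i \<longrightarrow> i \<le> n \<longrightarrow> dom_weight n c i = lam i)"
  for lam :: "nat \<Rightarrow> complex"
proof -
  define l where "l i = (if i \<le> n then lam i else 0)" for i
  define c where "c i = l i - l (Suc i)" for i
  have "dom_weight n c i = l i" if "i \<le> Suc n" for i
    using that
  proof (induction i rule: inc_induct)
    case (step k)
    then have "{k..n} = insert k {Suc k..n}" by auto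
    then show ?case using step by (simp add: dom_weight_def c_def)
  qed (simp add: dom_weight_def l_def)
  then show ?thesis by (intro exI[of _ c]) (auto simp: c_def l_def)
qed

lemma vanish_on_dominant_weights:
  assumes "\<And>n a. n \<ge> n0 \<Longrightarrow> ev (of_nat n) (complete_h (hc_list n (dom_weight n (\<lambda>i. of_nat (a i :: nat))))) p = 0"
  shows "p = 0"
proof -
  obtain M where M: "var_bound M p" using ex_var_bound by blast
  show ?thesis
  proof (rule ev_eq_0_imp_eq_0[of "max M n0"])
    \<comment> \<open>With n at least the number M of variables, h_1, ..., h_M can take any
      prescribed values.\<close>
    fix n s assume n: "max M n0 \<le> n"
    obtain xs where xs: "length xs = n" "\<And>i. 1 \<le> i \<Longrightarrow> i \<le> n \<Longrightarrow> complete_h xs i = s i"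
      using ex_complete_h_eq by blast
    obtain c where c: "\<And>i. i \<ge> Suc n \<Longrightarrow> c i = 0"
      "\<And>i. 1 \<le> i \<Longrightarrow> i \<le> n \<Longrightarrow> dom_weight n c i = xs ! (i - 1) - of_nat (n + 1) / 2 + of_nat i"
      using ex_dom_weight[of n "\<lambda>i. xs ! (i - 1) - of_nat (n + 1) / 2 + of_nat i"] by metis
    have hc: "hc_list n (dom_weight n c) = xs"
      by (rule nth_equalityI) (use xs c in \<open>simp_all add: hc_list_def del: upt_Suc\<close>)
    define f where "f x = ev (of_nat n) (complete_h (hc_list n (dom_weight n x))) p" for x
    have "polyfun f"
    proof -
      let ?fs = "map (\<lambda>i x. dom_weight n x i + of_nat (n + 1) / 2 - of_nat i) [1..<Suc n]"
      have "polyfun (\<lambda>x. dom_weight n x i + of_nat (n + 1) / 2 - of_nat i)" for i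
      proof -
        have "polyfun (\<lambda>x. dom_weight n x i + (of_nat (n + 1) / 2 - of_nat i))"
          unfolding dom_weight_def by (intro polyfun_add polyfun_sum polyfun_const polyfun_coord)
        then show ?thesis by (simp add: algebra_simps)
      qed
      then have "polyfun (\<lambda>x. complete_h (map (\<lambda>f. f x) ?fs) m)" for m
        by (intro polyfun_complete_h) auto
      then have "polyfun (\<lambda>x. complete_h (hc_list n (dom_weight n x)) m)" for m
        by (simp add: hc_list_def comp_def del: upt_Suc)
      then show ?thesis unfolding f_def by (rule polyfun_ev)
    qed
    \<comment> \<open>The coordinates of \<open>c\<close> beyond n are 0, hence natural; the
      coordinates 0, ..., n are arbitrary.\<close>
    then have "f c = 0"
      by (rule polyfun_eq_0[of _ "Suc n"]) (use n assms c in \<open>auto simp: f_def\<close>)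
    then show "ev (of_nat n) s p = 0"
      using ev_cong[OF var_bound_mono[OF M, of n], of "complete_h xs" s] xs n by (simp add: f_def hc)
  qed
qed

section \<open>Triangularity of the Schur substitution\<close>

lemma fps_power_nth_1:
  fixes f :: "complex fps"
  assumes "fps_nth f 0 = 1"
  shows "fps_nth (f ^ k) 1 = of_nat k * fps_nth f 1"
  by (induction k) (simp_all add: fps_mult_nth_1 assms fps_power_zeroth algebra_simps)

lemma num_S_nth_1: "fps_nth (num_S s a) 1 = s 1" and num_S_nth_0: "fps_nth (num_S s a) 0 = 1"
  by (simp_all add: num_S_def fps_compose_nth)

text \<open>As a polynomial, \<open>C\<^sub>m\<close> is \<open>m S\<^sub>m\<close> plus a polynomial in \<open>N, S\<^sub>1, \<dots>, S\<^sub>m\<^sub>-\<^sub>1\<close>.\<close>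

lemma ev_schur_C_upd:
  assumes "1 \<le> m" "r \<le> m"
  shows "ev (of_nat n) (s(m := t)) (schur_C r) = ev (of_nat n) s (schur_C r) + (if r = m then of_nat m * (t - s m) else 0)"
proof -
  define a b :: complex where "a = (of_nat n + 1) / 2" and "b = (of_nat n - 1) / 2"
  define K where "K = ((1 - fps_const a * fps_X) * inverse (1 - fps_const b * fps_X)) ^ n"
  define I where "I x = inverse (1 - fps_const x * fps_X :: complex fps)" for x
  let ?s = "s(m := t)"
  define d where "d = t - s m"
  have upd: "num_S ?s x = num_S s x + fps_const d * (fps_X * I x) ^ m" for x
  proof -
    have "Abs_fps (\<lambda>k. if k = 0 then 1 else ?s k) = Abs_fps (\<lambda>k. if k = 0 then 1 else s k) + fps_const d * fps_X ^ m"
      using assms(1) by (auto simp: fps_eq_iff d_def)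
    moreover have u: "fps_nth (fps_X * I x) 0 = 0" by simp
    ultimately show ?thesis
      by (simp add: num_S_def I_def[symmetric] fps_compose_add_distrib fps_compose_mult_distrib[OF u] fps_compose_power[OF u, symmetric])
  qed
  let ?A = "num_S s a" and ?B = "num_S s b" and ?A' = "num_S ?s a" and ?B' = "num_S ?s b"
  \<comment> \<open>Cross-multiplying the new and the old quotient leaves d v^m G. As G has constant
    term 0 and linear coefficient m (b - a) = -m, the first coefficient that can change is that of
    v^(m+1), which defines C_m.\<close>
  define G where "G = I b ^ m * ?A - I a ^ m * ?B"
  have I: "fps_nth (I x) 0 = 1" "fps_nth (I x) 1 = x" for x
  proof -
    have "I x = Abs_fps (\<lambda>k. x ^ k)" unfolding I_def
    proof (rule fps_inverse_unique)
      show "(1 - fps_const x * fps_X) * Abs_fps (\<lambda>k. x ^ k) = 1"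
      proof (rule fps_ext)
        fix k show "fps_nth ((1 - fps_const x * fps_X) * Abs_fps (\<lambda>k. x ^ k)) k = fps_nth 1 k"
          by (cases k) (simp_all add: left_diff_distrib mult.assoc)
      qed
    qed
    then show "fps_nth (I x) 0 = 1" "fps_nth (I x) 1 = x" by simp_all
  qed
  have G0: "fps_nth G 0 = 0"
    by (simp add: G_def fps_power_zeroth I num_S_nth_0)
  have "fps_nth G 1 = of_nat m * (b - a)"
    unfolding G_def fps_sub_nth fps_mult_nth_1
    by (simp only: fps_power_nth_1 I num_S_nth_0 num_S_nth_1 fps_power_zeroth) (simp add: algebra_simps)
  also have "b - a = - 1" by (simp add: a_def b_def field_simps)
  finally have G1: "fps_nth G 1 = - of_nat m" by simp
  define D where "D = K * fps_const d * inverse (?A * ?A')"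
  have inv: "inverse ?A * ?A = 1" "inverse ?A' * ?A' = 1"
    by (rule inverse_mult_eq_1; simp add: num_S_nth_0)+
  have "K * (?B' * inverse ?A') - K * (?B * inverse ?A)
    = K * (inverse ?A * inverse ?A') * (?B' * ?A - ?B * ?A')"
  proof -
    have "K * (inverse ?A * inverse ?A') * (?B' * ?A - ?B * ?A')
      = K * ?B' * inverse ?A' * (inverse ?A * ?A) - K * ?B * inverse ?A * (inverse ?A' * ?A')"
      by (simp add: right_diff_distrib mult_ac)
    then show ?thesis unfolding inv by (simp add: mult_ac)
  qed
  also have "?B' * ?A - ?B * ?A' = fps_const d * fps_X ^ m * G"
    unfolding upd G_def by (simp add: algebra_simps power_mult_distrib)
  also have "K * (inverse ?A * inverse ?A') * (fps_const d * fps_X ^ m * G) = fps_X ^ m * (D * G)"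
    by (simp add: D_def fps_inverse_mult mult_ac)
  finally have diff: "K * (?B' * inverse ?A') = K * (?B * inverse ?A) + fps_X ^ m * (D * G)"
    by (simp only: diff_eq_eq add.commute)
  have "fps_nth K 0 = 1" by (simp add: K_def fps_power_zeroth)
  then have D0: "fps_nth D 0 = d"
    by (simp add: D_def num_S_nth_0)
  have DG: "fps_nth (D * G) 1 = - of_nat m * d" by (simp only: fps_mult_nth_1 D0 G0 G1) simp
  have C: "ev (of_nat n) s' (schur_C r) = - fps_nth (K * (num_S s' b * inverse (num_S s' a))) (r + 1)" for s'
    using arg_cong[OF fmap_schur_series[of n s'], of "\<lambda>F. fps_nth F (r + 1)"]
    by (simp add: schur_C_def fps_ring_hom.H_uminus[OF ev_hom] fps_ring_hom.fmap_nth[OF ev_hom] K_def a_def b_def)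
  have "fps_nth (fps_X ^ m * (D * G)) (r + 1) = (if r = m then - of_nat m * d else 0)"
  proof (cases "r = m")
    case True
    then show ?thesis using DG by (simp add: fps_X_power_mult_nth)
  next
    case False
    then have "r + 1 = m \<or> r + 1 < m" using assms by auto
    then show ?thesis using G0 False by (auto simp: fps_X_power_mult_nth)
  qed
  then show ?thesis unfolding C diff by (simp add: d_def)
qed

text \<open>The C_r are prescribed one after the other: adjusting the last S leaves the earlier C_r
  alone, and its coefficient M + 1 in the new one is invertible.\<close>

lemma ex_schur_C_values:
  "\<exists>s. \<forall>r. 1 \<le> r \<longrightarrow> r \<le> M \<longrightarrow> ev (of_nat n) s (schur_C r) = c r"
proof (induction M)
  case (Suc M)
  then obtain s where s: "\<And>r. 1 \<le> r \<Longrightarrow> r \<le> M \<Longrightarrow> ev (of_nat n) s (schur_C r) = c r" by blast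
  define t where "t = s (Suc M) + (c (Suc M) - ev (of_nat n) s (schur_C (Suc M))) / of_nat (Suc M)"
  have "ev (of_nat n) (s(Suc M := t)) (schur_C r) = c r" if "1 \<le> r" "r \<le> Suc M" for r
    using that s[of r] ev_schur_C_upd[of "Suc M" r n s t]
    by (cases "r = Suc M") (simp_all add: t_def del: of_nat_Suc)
  then show ?case by blast
qed simp

lemma ev_schur_subst_hc:
  "ev (of_nat n) (complete_h (hc_list n lam)) (schur_subst p) = ev (of_nat n) (cas_val n lam) p"
  unfolding ev_schur_subst by (rule ev_cong') (rule ev_schur_C)

text \<open>Vanishing on dominant weights makes the polynomial zero after the Schur substitution.
  That substitution is injective, since finitely many of the C_r can be given arbitrary values by
  choosing the S_i.\<close>

lemma casimir_values_determine:
  assumes "\<And>n a. n \<ge> n0 \<Longrightarrow> ev (of_nat n) (cas_val n (dom_weight n (\<lambda>i. of_nat (a i :: nat)))) p = 0"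
  shows "p = 0"
proof -
  have zero: "schur_subst p = 0"
    by (rule vanish_on_dominant_weights[of n0]) (simp add: ev_schur_subst_hc assms)
  obtain M where M: "var_bound M p" using ex_var_bound by blast
  show ?thesis
  proof (rule ev_eq_0_imp_eq_0[of 0])
    fix n c
    obtain s where s: "\<And>r. 1 \<le> r \<Longrightarrow> r \<le> M \<Longrightarrow> ev (of_nat n) s (schur_C r) = c r"
      using ex_schur_C_values by blast
    have "ev (of_nat n) c p = ev (of_nat n) s (schur_subst p)"
      unfolding ev_schur_subst by (rule ev_cong[OF M]) (simp add: s)
    then show "ev (of_nat n) c p = 0"
      unfolding zero by (simp add: fps_ring_hom.H_0[OF ev_hom])
  qed
qed

section \<open>The average weight system\<close>

lemma w_gl_unique:
  assumes "\<And>n. n \<ge> 1 \<Longrightarrow> casimir_subst n p = casimir_subst n q"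
  shows "p = q"
proof -
  have "p - q = 0"
  proof (rule casimir_values_determine[of 1])
    fix n :: nat and a :: "nat \<Rightarrow> nat" assume n: "n \<ge> 1"
    obtain phi where phi: "hw_functional n (dom_weight n (\<lambda>i. of_nat (a i))) phi"
      using ex_hw_functional by blast
    have "gl_cong n (csR n p) (csR n q)"
      using assms[OF n] by (simp add: casimir_subst_eq U_class_eq_iff)
    from hw_functional.phi_cong'[OF phi this]
    show "ev (of_nat n) (cas_val n (dom_weight n (\<lambda>i. of_nat (a i)))) (p - q) = 0"
      by (simp add: hw_functional.phi_csR[OF phi] fps_ring_hom.H_diff[OF ev_hom])
  qed
  then show ?thesis by simp
qed

lemma casimir_subst_w_gl:
  assumes "1 \<le> m" "\<alpha> permutes {1..m}" "1 \<le> n"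
  shows "casimir_subst n (w_gl m \<alpha>) = w_glN n m \<alpha>"
proof -
  have "\<exists>!p. \<forall>n\<ge>1. casimir_subst n p = w_glN n m \<alpha>"
    using ex_w_gl[OF assms(1,2)] w_gl_unique by (metis (mono_tags, lifting))
  from theI'[OF this] show ?thesis using assms(3) unfolding w_gl_def by blast
qed

lemma (in hw_functional) ev_W:
  assumes "1 \<le> n"
  shows "ev (of_nat n) (cas_val n lam) (W m) = fact (m + n - 1) * fps_nth (avg_series n lam) m"
\<comment> \<open>\<open>W 0\<close> is 1 by convention, which agrees with the constant term 1/(n -
  1)! of \<open>avg_series\<close>.\<close>
proof (cases "m = 0")
  case True
  then show ?thesis
    by (simp add: W_def fps_ring_hom.H_1[OF ev_hom] avg_series_def)
next
  case False
  have "ev (of_nat n) (cas_val n lam) (w_gl m \<alpha>) = phi (wR n m \<alpha>)" if "\<alpha> permutes {1..m}" for \<alpha>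
  proof -
    have "gl_cong n (csR n (w_gl m \<alpha>)) (wR n m \<alpha>)"
      using casimir_subst_w_gl[of m \<alpha> n] False that assms
      by (simp add: casimir_subst_eq w_glN_eq U_class_eq_iff wR_free)
    from phi_cong'[OF this] show ?thesis by (simp add: phi_csR)
  qed
  then have "ev (of_nat n) (cas_val n lam) (W m) = 1 / fact m * phi (\<Sum>\<alpha> | \<alpha> permutes {1..m}. wR n m \<alpha>)"
    using False by (simp add: W_def fps_ring_hom.H_mult[OF ev_hom] fps_ring_hom.H_sum[OF ev_hom] ev_coef phi_sum)
  then show ?thesis unfolding phi_sum_wR[OF assms] by simp
qed

text \<open>At N = n the factorials are genuine and the claim is the coefficient of t^m in
  \<open>avg_series_eq\<close>, multiplied by (m + n - 1)!. Agreement for all n and all dominant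
  weights gives the identity of polynomials.\<close>

lemma schur_subst_W:
  "schur_subst (W m) = (\<Sum>k\<le>m. coef (fact_ratio m k * fps_nth sinh_power (m - k)) * schur_S k)"
    (is "_ = ?R")
proof -
  have "schur_subst (W m) - ?R = 0"
  proof (rule vanish_on_dominant_weights[of 1])
    fix n :: nat and a :: "nat \<Rightarrow> nat" assume n: "n \<ge> 1"
    let ?lam = "dom_weight n (\<lambda>i. of_nat (a i))"
    let ?h = "complete_h (hc_list n ?lam)"
    obtain phi where phi: "hw_functional n ?lam phi"
      using ex_hw_functional by blast
    have "ev (of_nat n) ?h ?R = (\<Sum>k\<le>m. fact (m + n - 1) / fact (k + n - 1) * fps_nth (inverse (sinh_series ^ (n - 1))) (m - k) * ?h k)"
      using n by (simp add: fps_ring_hom.H_mult[OF ev_hom] fps_ring_hom.H_sum[OF ev_hom] ev_coef fact_ratio_eval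
          sinh_power_eval ev_schur_S) (auto intro!: sum.cong)
    also have "\<dots> = fact (m + n - 1) * fps_nth (avg_series n ?lam) m"
    proof -
      have "k + n - 1 = k + (n - 1)" for k using n by simp
      then show ?thesis unfolding avg_series_eq[OF n]
        by (simp add: fps_mult_nth sum_distrib_left atLeast0AtMost) (simp add: mult_ac)
    qed
    also have "\<dots> = ev (of_nat n) ?h (schur_subst (W m))"
      using hw_functional.ev_W[OF phi n] by (simp add: ev_schur_subst_hc)
    finally show "ev (of_nat n) ?h (schur_subst (W m) - ?R) = 0"
      by (simp add: fps_ring_hom.H_diff[OF ev_hom])
  qed
  then show ?thesis by simp
qed

theorem theorem4:
  "(\<forall>m. schur_subst (W m) =
      (\<Sum>k\<le>m. coef (fact_ratio m k * fps_nth sinh_power (m - k)) * schur_S k))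
   \<and> (\<forall>m. \<exists>(K::nat) (c :: nat \<Rightarrow> complex poly).
        schur_subst (W m) = (\<Sum>k\<le>K. coef (c k) * schur_S k))"
proof (intro conjI allI)
  fix m
  show "schur_subst (W m) = (\<Sum>k\<le>m. coef (fact_ratio m k * fps_nth sinh_power (m - k)) * schur_S k)"
    by (rule schur_subst_W)
  then show "\<exists>(K::nat) (c :: nat \<Rightarrow> complex poly). schur_subst (W m) = (\<Sum>k\<le>K. coef (c k) * schur_S k)"
    by (intro exI[of _ m] exI[of _ "\<lambda>k. fact_ratio m k * fps_nth sinh_power (m - k)"])
qed

end
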